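(* For the Besov spaces $B^\sigma_{2,\infty}$ defined on the eyebolted Vicsek cross $K$ (with its normalized $\alpha$-Hausdorff measure $\mu$, $\alpha=\log21/\log9$), the critical exponents are $$\sigma^*=\sigma^\#=\frac12\Big(1+\frac{\log 21}{\log 9}\Big).$$ Moreover, (i) $B^{\sigma^*}_{2,\infty}$ is dense in $L^2(K,\mu)$; (ii) every $u\in B^{\sigma^*}_{2,\infty}$ is constant on each line segment contained in $K$ and parallel to $\overline{p_2p_4}$, and $B^{\sigma^*}_{2,\infty}$ is not dense in $C(K)$.
   Context: **Eyebolted Vicsek cross.** In $\mathbb R^2$ let $p_1=(-\frac12,-\frac12)$, $p_2=(\frac12,-\frac12)$, $p_3=(\frac12,\frac12)$, $p_4=(-\frac12,\frac12)$, and let $S$ be the unit square with these vertices, divided into $81$ sub-squares of side $1/9$; the sub-square with index $(i,j)$, $-4\le i,j\le 4$, has center $(i/9,j/9)$. Select the following $21$ sub-squares: the nine $(k,k)$, $|k|\le 4$ (along $\overline{p_1p_3}$); the eight $(k,-k)$, $1\le |k|\le 4$ (along $\overline{p_2p_4}$); and two "eyebolts", the lower-right one consisting of the pair $(3,-1),(4,-2)$ or the pair $(1,-3),(2,-4)$, and the upper-left one consisting of the pair $(-3,1),(-4,2)$ or the pair $(-1,3),(-2,4)$ (a fixed choice is made for each eyebolt; the assertions do not depend on it). Let $a_1,\dots,a_{21}$ be the centers of the selected sub-squares, $F_i(x)=\frac19x+a_i$, and let $K$ be the nonempty compact set with $K=\bigcup_{i=1}^{21}F_i(K)$. **Besov spaces.**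 For $\sigma>0$, $[u]^2_{B^\sigma_{2,\infty}}=\sup_{0<r<1}r^{-\alpha-2\sigma}\int_K\int_{B(x,r)}|u(x)-u(y)|^2d\mu(y)d\mu(x)$ and $B^\sigma_{2,\infty}=\{u\in L^2(K,\mu):\|u\|_2+[u]_{B^\sigma_{2,\infty}}<\infty\}$. When $2\sigma>\alpha$, elements of $B^\sigma_{2,\infty}$ have continuous representatives and $B^\sigma_{2,\infty}$ is regarded as a subset of $C(K)$. The critical exponents are $\sigma^*=\sup\{\sigma: B^\sigma_{2,\infty}\cap C(K)\text{ is dense in }C(K)\}$ (sup norm) and $\sigma^\#=\sup\{\sigma: B^\sigma_{2,\infty}\text{ contains non-constant functions}\}$. *)

theory Defs
  imports "HOL-Analysis.Analysis"
begin

section \<open>The eyebolted Vicsek cross\<close>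

definition diagonal_cells :: "(int \<times> int) set" where
  "diagonal_cells = {(k, k) | k. \<bar>k\<bar> \<le> 4} \<union> {(k, - k) | k. 1 \<le> \<bar>k\<bar> \<and> \<bar>k\<bar> \<le> 4}"

text \<open>The two admissible choices for each eyebolt; every choice is a set of two cells.\<close>

definition lower_right_eyebolts :: "(int \<times> int) set set" where
  "lower_right_eyebolts = {{(3, -1), (4, -2)}, {(1, -3), (2, -4)}}"

definition upper_left_eyebolts :: "(int \<times> int) set set" where
  "upper_left_eyebolts = {{(-3, 1), (-4, 2)}, {(-1, 3), (-2, 4)}}"

text \<open>The plane is \<open>real \<times> real\<close>, whose library metric is the Euclidean one.\<close>

definition cell_center :: "int \<times> int \<Rightarrow> real \<times> real" where
  "cell_center c = (of_int (fst c) / 9, of_int (snd c) / 9)"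

definition cell_map :: "int \<times> int \<Rightarrow> real \<times> real \<Rightarrow> real \<times> real" where
  "cell_map c x = (1 / 9) *\<^sub>R x + cell_center c"

definition is_eyebolted_vicsek_cross ::
  "(int \<times> int) set \<Rightarrow> (int \<times> int) set \<Rightarrow> (real \<times> real) set \<Rightarrow> bool" where
  "is_eyebolted_vicsek_cross L U K \<longleftrightarrow>
     K \<noteq> {} \<and> compact K \<and> K = (\<Union>c \<in> diagonal_cells \<union> L \<union> U. cell_map c ` K)"

definition p2 :: "real \<times> real" where "p2 = (1 / 2, - (1 / 2))"
definition p4 :: "real \<times> real" where "p4 = (- (1 / 2), 1 / 2)"

lemma card_selected_cells:
  assumes "L \<in> lower_right_eyebolts" and "U \<in> upper_left_eyebolts"
  shows "card (diagonal_cells \<union> L \<union> U) = 21"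
proof -
  have "diagonal_cells = (\<lambda>k. (k, k)) ` {-4..4} \<union> (\<lambda>k. (k, - k)) ` ({-4..4} - {0})"
    unfolding diagonal_cells_def by (intro arg_cong2[where f = "(\<union>)"]) (auto simp: image_iff)
  moreover have "{-4..4::int} = {-4, -3, -2, -1, 0, 1, 2, 3, 4}"
    by (simp add: set_eq_iff, presburger)
  ultimately have cells: "diagonal_cells =
      (\<lambda>k. (k, k)) ` {-4, -3, -2, -1, 0, 1, 2, 3, 4} \<union>
      (\<lambda>k. (k, - k)) ` ({-4, -3, -2, -1, 0, 1, 2, 3, 4} - {0})"
    by simp
  have "L = {(3, -1), (4, -2)} \<or> L = {(1, -3), (2, -4)}"
    and "U = {(-3, 1), (-4, 2)} \<or> U = {(-1, 3), (-2, 4)}"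
    using assms by (simp_all add: lower_right_eyebolts_def upper_left_eyebolts_def)
  then show ?thesis
    by (elim disjE) (simp_all add: cells insert_Diff_if)
qed

section \<open>Hausdorff measure\<close>

text \<open>Intended for \<open>s > 0\<close>: the convention \<open>0 powr s = 0\<close> is then the right one for covering
  sets of diameter \<open>0\<close>, in particular for the empty set, so that finite covers are included.
  Boundedness is required because \<open>diameter\<close> is unspecified on unbounded sets.\<close>

definition hausdorff_pre_measure :: "real \<Rightarrow> real \<Rightarrow> 'a::metric_space set \<Rightarrow> ennreal" where
  "hausdorff_pre_measure s \<delta> A =
     (INF C \<in> {C :: nat \<Rightarrow> 'a set. A \<subseteq> (\<Union>i. C i) \<and> (\<forall>i. bounded (C i) \<and> diameter (C i) \<le> \<delta>)}.
        \<Sum>i. ennreal (diameter (C i) powr s))"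

definition hausdorff_outer_measure :: "real \<Rightarrow> 'a::metric_space set \<Rightarrow> ennreal" where
  "hausdorff_outer_measure s A = (SUP \<delta> \<in> {0<..}. hausdorff_pre_measure s \<delta> A)"

text \<open>The outer measure is a metric outer measure, hence countably additive on the Borel sets, so
  \<open>measure_of\<close> assigns its values to them and does not fall back to the zero measure.\<close>

definition hausdorff_measure :: "real \<Rightarrow> 'a::metric_space measure" where
  "hausdorff_measure s = measure_of UNIV (sets borel) (hausdorff_outer_measure s)"

text \<open>The normalized measure lives on the space \<open>K\<close> itself, so measurability and integrals
  only see the restriction of a function to \<open>K\<close>.\<close>

definition normalized_hausdorff :: "real \<Rightarrow> 'a::metric_space set \<Rightarrow> 'a measure" where
  "normalized_hausdorff s K = uniform_measure (restrict_space (hausdorff_measure s) K) K"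

section \<open>Besov spaces\<close>

text \<open>Elements of \<open>L\<^sup>2\<close> and of the Besov spaces are represented by functions, not by classes modulo
  null sets.\<close>

definition L2_space :: "'a measure \<Rightarrow> ('a \<Rightarrow> real) set" where
  "L2_space \<mu> = {u \<in> borel_measurable \<mu>. integrable \<mu> (\<lambda>x. (u x)\<^sup>2)}"

definition L2_norm :: "'a measure \<Rightarrow> ('a \<Rightarrow> real) \<Rightarrow> real" where
  "L2_norm \<mu> u = sqrt (\<integral>x. (u x)\<^sup>2 \<partial>\<mu>)"

definition besov_seminorm_sq ::
  "'a::metric_space measure \<Rightarrow> real \<Rightarrow> real \<Rightarrow> ('a \<Rightarrow> real) \<Rightarrow> ennreal" where
  "besov_seminorm_sq \<mu> \<alpha> \<sigma> u =
     (SUP r \<in> {0<..<1}. ennreal (r powr (- \<alpha> - 2 * \<sigma>)) *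
        (\<integral>\<^sup>+x. (\<integral>\<^sup>+y\<in>ball x r. ennreal (\<bar>u x - u y\<bar>\<^sup>2) \<partial>\<mu>) \<partial>\<mu>))"

definition besov :: "'a::metric_space measure \<Rightarrow> real \<Rightarrow> real \<Rightarrow> ('a \<Rightarrow> real) set" where
  "besov \<mu> \<alpha> \<sigma> = {u \<in> L2_space \<mu>. besov_seminorm_sq \<mu> \<alpha> \<sigma> u < \<infinity>}"

definition dense_in_L2 :: "'a measure \<Rightarrow> ('a \<Rightarrow> real) set \<Rightarrow> bool" where
  "dense_in_L2 \<mu> B \<longleftrightarrow>
     (\<forall>f \<in> L2_space \<mu>. \<forall>\<epsilon>>0. \<exists>u \<in> B. L2_norm \<mu> (\<lambda>x. f x - u x) < \<epsilon>)"

text \<open>Density in \<open>C(K)\<close>, for the supremum norm, of the continuous functions belonging to \<open>B\<close>.\<close>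

definition dense_in_C :: "'a::metric_space set \<Rightarrow> ('a \<Rightarrow> real) set \<Rightarrow> bool" where
  "dense_in_C K B \<longleftrightarrow>
     (\<forall>f. continuous_on K f \<longrightarrow>
        (\<forall>\<epsilon>>0. \<exists>u \<in> B. continuous_on K u \<and> (\<forall>x \<in> K. \<bar>f x - u x\<bar> < \<epsilon>)))"

definition continuous_representative ::
  "'a::metric_space set \<Rightarrow> 'a measure \<Rightarrow> ('a \<Rightarrow> real) \<Rightarrow> ('a \<Rightarrow> real) \<Rightarrow> bool" where
  "continuous_representative K \<mu> u v \<longleftrightarrow> continuous_on K v \<and> (AE x in \<mu>. u x = v x)"

text \<open>The critical exponents are suprema in the extended reals, so that no value is assigned by
  convention to the supremum of an empty or unbounded set. ``Constant'' refers to the class of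
  the function modulo null sets.\<close>

definition sigma_star :: "'a::metric_space set \<Rightarrow> 'a measure \<Rightarrow> real \<Rightarrow> ereal" where
  "sigma_star K \<mu> \<alpha> = Sup (ereal ` {\<sigma>. 0 < \<sigma> \<and> dense_in_C K (besov \<mu> \<alpha> \<sigma>)})"

definition sigma_sharp :: "'a::metric_space measure \<Rightarrow> real \<Rightarrow> ereal" where
  "sigma_sharp \<mu> \<alpha> =
     Sup (ereal ` {\<sigma>. 0 < \<sigma> \<and> (\<exists>u \<in> besov \<mu> \<alpha> \<sigma>. \<not> (\<exists>c. AE x in \<mu>. u x = c))})"

end

theory Submission
  imports Defs
begin

text \<open>At level \<open>n\<close>, consider \<open>9 ^ n\<close> times the sum of the squared differences of a function between
  the centre and the corners of the cells. The exponent \<open>(1 + \<alpha>) / 2\<close> is the one at which a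
  finite Besov seminorm bounds these energies uniformly in \<open>n\<close>; a larger exponent makes them decay
  exponentially, a smaller one lets them grow exponentially. The theorem is therefore about the
  resistances of a sequence of networks of half diagonals.

  Along the main diagonal a cell consists of nine smaller diagonals in series, and with the weight
  \<open>9 ^ n\<close> its resistance is the same at all levels. Along the anti-diagonal each arm is bypassed on
  two of nine halves by an eyebolt of conductance at least \<open>1 / 6\<close>, so the conductance grows by at
  least \<open>1 / 20\<close> from level to level (\<open>resistance_step\<close>). Energies bounded at all levels then leave
  no drop along an anti-diagonal (\<open>anti_energy_zero\<close>). A segment of \<open>K\<close> parallel to \<open>p4 - p2\<close>
  runs along such diagonals, because the cells of one level lie on one colour of a
  checkerboard (\<open>anti_line_cell\<close>). This gives constancy on segments, and it excludes that
  the first coordinate is a uniform limit. Energies that tend to zero leave no drop along the main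
  diagonals either, and the function is constant.

  Conversely the conductance grows only linearly. Interpolating vertex values linearly along the
  arms, and placing the drop of the bypassed piece on the halves of the eyebolt that are parallel to
  the main diagonal, extends any values given at one level to \<open>K\<close>. The energy of the extension at
  level \<open>n\<close> grows at most linearly in \<open>n\<close> (\<open>sum_extend_forms\<close>). Below the critical exponent
  this growth is admissible, and prescribing the values of a continuous function at a deep level
  gives density in \<open>C(K)\<close>. If the given values have no drop along anti-diagonals, the energy stays bounded and
  the extension belongs to the critical space. The child \<open>(2, 2)\<close> of a cell touches the other
  cells in two corners on the main diagonal only, so its indicator is a limit of such extensions
  (\<open>approximable_inner_cell\<close>). Up to null sets every cell is a countable disjoint union of children of
  this kind, and density in \<open>L\<^sup>2\<close> follows.

  All of this uses the normalized measure only through the mass \<open>21 ^ (- n)\<close> of the cells of level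
  \<open>n\<close>. It comes from the scaling of Hausdorff measure, once the measure of \<open>K\<close> is known to
  be positive and finite.\<close>

section \<open>Hausdorff measure as a measure\<close>

lemma hausdorff_pre_measure_le:
  assumes "A \<subseteq> (\<Union>i. C i)" and "\<And>i. bounded (C i)" and "\<And>i. diameter (C i) \<le> \<delta>"
  shows "hausdorff_pre_measure s \<delta> A \<le> (\<Sum>i. ennreal (diameter (C i) powr s))"
  unfolding hausdorff_pre_measure_def using assms by (intro INF_lower) auto

lemma le_hausdorff_pre_measure:
  assumes "\<And>C :: nat \<Rightarrow> _. A \<subseteq> (\<Union>i. C i) \<Longrightarrow> (\<And>i. bounded (C i)) \<Longrightarrow> (\<And>i. diameter (C i) \<le> \<delta>)
    \<Longrightarrow> b \<le> (\<Sum>i. ennreal (diameter (C i) powr s))"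
  shows "b \<le> hausdorff_pre_measure s \<delta> A"
  unfolding hausdorff_pre_measure_def using assms by (intro INF_greatest) auto

lemma hausdorff_pre_measure_lessE:
  assumes "hausdorff_pre_measure s \<delta> A < b"
  obtains C :: "nat \<Rightarrow> _" where "A \<subseteq> (\<Union>i. C i)" "\<And>i. bounded (C i)"
    "\<And>i. diameter (C i) \<le> \<delta>" "(\<Sum>i. ennreal (diameter (C i) powr s)) < b"
  using assms unfolding hausdorff_pre_measure_def INF_less_iff by auto

lemma hausdorff_pre_measure_antimono:
  assumes "\<delta> \<le> \<delta>'"
  shows "hausdorff_pre_measure s \<delta>' A \<le> hausdorff_pre_measure s \<delta> A"
proof (rule le_hausdorff_pre_measure, rule hausdorff_pre_measure_le)
  fix C :: "nat \<Rightarrow> _" and i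
  assume "\<And>i. diameter (C i) \<le> \<delta>"
  from this[of i] show "diameter (C i) \<le> \<delta>'" using assms by simp
qed

lemma hausdorff_pre_measure_mono:
  assumes "A \<subseteq> B"
  shows "hausdorff_pre_measure s \<delta> A \<le> hausdorff_pre_measure s \<delta> B"
  by (rule le_hausdorff_pre_measure, rule hausdorff_pre_measure_le) (use assms in blast)+

lemma hausdorff_pre_le_outer:
  assumes "0 < \<delta>"
  shows "hausdorff_pre_measure s \<delta> A \<le> hausdorff_outer_measure s A"
  unfolding hausdorff_outer_measure_def using assms by (intro SUP_upper) auto

lemma hausdorff_outer_leI:
  assumes "\<And>\<delta>. 0 < \<delta> \<Longrightarrow> hausdorff_pre_measure s \<delta> A \<le> b"
  shows "hausdorff_outer_measure s A \<le> b"
  unfolding hausdorff_outer_measure_def using assms by (intro SUP_least) auto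

lemma hausdorff_outer_mono:
  assumes "A \<subseteq> B"
  shows "hausdorff_outer_measure s A \<le> hausdorff_outer_measure s B"
  by (meson assms hausdorff_outer_leI hausdorff_pre_le_outer hausdorff_pre_measure_mono order_trans)

lemma hausdorff_outer_empty [simp]: "hausdorff_outer_measure s {} = 0"
proof -
  have "hausdorff_pre_measure s \<delta> {} \<le> 0" if "0 < \<delta>" for \<delta>
    using hausdorff_pre_measure_le[of "{}" "\<lambda>_. {}" \<delta> s] that by simp
  then have "hausdorff_outer_measure s {} \<le> 0" by (rule hausdorff_outer_leI)
  then show ?thesis by simp
qed

lemma hausdorff_pre_countably_subadditive:
  fixes A :: "nat \<Rightarrow> 'a::metric_space set"
  shows "hausdorff_pre_measure s \<delta> (\<Union>n. A n) \<le> (\<Sum>n. hausdorff_pre_measure s \<delta> (A n))"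
proof (cases "\<forall>n. hausdorff_pre_measure s \<delta> (A n) < \<infinity>")
  case False
  then obtain n where "hausdorff_pre_measure s \<delta> (A n) = \<infinity>"
    using top.not_eq_extremum by (metis infinity_ennreal_def)
  then have "(\<Sum>n. hausdorff_pre_measure s \<delta> (A n)) = \<infinity>"
    by (metis ennreal_suminf_lessD infinity_ennreal_def less_irrefl top.not_eq_extremum)
  then show ?thesis by simp
next
  case True
  show ?thesis
  proof (rule ennreal_le_epsilon)
    fix e :: real
    assume "0 < e"
    have "\<exists>C :: nat \<Rightarrow> 'a set. A n \<subseteq> (\<Union>i. C i) \<and> (\<forall>i. bounded (C i) \<and> diameter (C i) \<le> \<delta>) \<and>
      (\<Sum>i. ennreal (diameter (C i) powr s)) \<le> hausdorff_pre_measure s \<delta> (A n) + ennreal (e * (1/2) ^ Suc n)" for n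
    proof -
      have less: "hausdorff_pre_measure s \<delta> (A n) < hausdorff_pre_measure s \<delta> (A n) + ennreal (e * (1/2) ^ Suc n)"
        using True[rule_format, of n] \<open>0 < e\<close>
          ennreal_add_left_cancel_less[of "hausdorff_pre_measure s \<delta> (A n)" 0 "ennreal (e * (1/2) ^ Suc n)"]
        unfolding add_0_right by (simp del: ennreal_add_left_cancel_less)
      obtain C where "A n \<subseteq> (\<Union>i. C i)" "\<And>i. bounded (C i)" "\<And>i. diameter (C i) \<le> \<delta>"
        "(\<Sum>i. ennreal (diameter (C i) powr s)) < hausdorff_pre_measure s \<delta> (A n) + ennreal (e * (1/2) ^ Suc n)"
        by (rule hausdorff_pre_measure_lessE[OF less]; rule that)
      then show ?thesis by (intro exI[of _ C]) (auto intro: less_imp_le)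
    qed
    then obtain C :: "nat \<Rightarrow> nat \<Rightarrow> 'a set" where C: "\<And>n. A n \<subseteq> (\<Union>i. C n i)" "\<And>n i. bounded (C n i)"
      "\<And>n i. diameter (C n i) \<le> \<delta>"
      "\<And>n. (\<Sum>i. ennreal (diameter (C n i) powr s)) \<le> hausdorff_pre_measure s \<delta> (A n) + ennreal (e * (1/2) ^ Suc n)"
      by metis
    define B where "B j = (case prod_decode j of (n, i) \<Rightarrow> C n i)" for j
    have "(\<Union>n. A n) \<subseteq> (\<Union>j. B j)"
    proof
      fix x assume "x \<in> (\<Union>n. A n)"
      then obtain n i where "x \<in> C n i" using C(1) by blast
      then have "x \<in> B (prod_encode (n, i))" by (simp add: B_def)
      then show "x \<in> (\<Union>j. B j)" by blast
    qed
    then have "hausdorff_pre_measure s \<delta> (\<Union>n. A n) \<le> (\<Sum>j. ennreal (diameter (B j) powr s))"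
      by (rule hausdorff_pre_measure_le) (auto simp: B_def C split: prod.split)
    also have "\<dots> = (\<Sum>j. (\<lambda>(n, i). ennreal (diameter (C n i) powr s)) (prod_decode j))"
      by (auto simp: B_def split: prod.split intro!: suminf_cong)
    also have "\<dots> = (\<Sum>n. \<Sum>i. ennreal (diameter (C n i) powr s))"
      by (subst suminf_ennreal_2dimen[symmetric, where g = "\<lambda>n. \<Sum>i. ennreal (diameter (C n i) powr s)"])
         (auto simp: comp_def)
    also have "\<dots> \<le> (\<Sum>n. hausdorff_pre_measure s \<delta> (A n) + ennreal (e * (1/2) ^ Suc n))"
      by (intro suminf_le C) auto
    also have "\<dots> = (\<Sum>n. hausdorff_pre_measure s \<delta> (A n)) + (\<Sum>n. ennreal (e * (1/2) ^ Suc n))"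
      by (intro suminf_add[symmetric]) auto
    also have "(\<Sum>n. ennreal (e * (1/2) ^ Suc n)) = ennreal e"
    proof -
      have "(\<lambda>n. e * (1/2) ^ Suc n) sums (e * 1)"
        using power_half_series by (intro sums_mult)
      then show ?thesis using \<open>0 < e\<close>
        by (intro suminf_ennreal_eq) auto
    qed
    finally show "hausdorff_pre_measure s \<delta> (\<Union>n. A n)
      \<le> (\<Sum>n. hausdorff_pre_measure s \<delta> (A n)) + ennreal e" .
  qed
qed

lemma hausdorff_outer_countably_subadditive:
  fixes A :: "nat \<Rightarrow> 'a::metric_space set"
  shows "hausdorff_outer_measure s (\<Union>n. A n) \<le> (\<Sum>n. hausdorff_outer_measure s (A n))"
proof (rule hausdorff_outer_leI)
  fix \<delta> :: real assume "0 < \<delta>"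
  have "hausdorff_pre_measure s \<delta> (\<Union>n. A n) \<le> (\<Sum>n. hausdorff_pre_measure s \<delta> (A n))"
    by (rule hausdorff_pre_countably_subadditive)
  also have "\<dots> \<le> (\<Sum>n. hausdorff_outer_measure s (A n))"
    by (intro suminf_le hausdorff_pre_le_outer \<open>0 < \<delta>\<close>) auto
  finally show "hausdorff_pre_measure s \<delta> (\<Union>n. A n) \<le> (\<Sum>n. hausdorff_outer_measure s (A n))" .
qed

lemma hausdorff_outer_measure_space: "outer_measure_space UNIV (hausdorff_outer_measure s)"
  by (auto simp: outer_measure_space_def positive_def increasing_def countably_subadditive_def
      intro: hausdorff_outer_mono hausdorff_outer_countably_subadditive)

lemma hausdorff_outer_Un_le:
  fixes A B :: "'a::metric_space set"
  shows "hausdorff_outer_measure s (A \<union> B) \<le> hausdorff_outer_measure s A + hausdorff_outer_measure s B"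
proof -
  define C where "C n = (if n = 0 then A else if n = 1 then B else {})" for n :: nat
  have "A \<union> B = (\<Union>n. C n)" by (auto simp: C_def split: if_splits)
  then have "hausdorff_outer_measure s (A \<union> B) \<le> (\<Sum>n. hausdorff_outer_measure s (C n))"
    using hausdorff_outer_countably_subadditive[of s C] by simp
  also have "\<dots> = (\<Sum>n\<in>{0, 1}. hausdorff_outer_measure s (C n))"
    by (intro suminf_finite) (auto simp: C_def)
  finally show ?thesis by (simp add: C_def)
qed

text \<open>A set of diameter below \<open>d\<close> cannot meet both \<open>A\<close> and
  \<open>B\<close>, so a fine cover of the union splits into a cover of \<open>A\<close> and a
  cover of \<open>B\<close>.\<close>

lemma hausdorff_outer_separated:
  fixes A B :: "'a::metric_space set"
  assumes "0 < d" and sep: "\<And>x y. x \<in> A \<Longrightarrow> y \<in> B \<Longrightarrow> d \<le> dist x y"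
  shows "hausdorff_outer_measure s A + hausdorff_outer_measure s B \<le> hausdorff_outer_measure s (A \<union> B)"
proof -
  let ?H = "hausdorff_outer_measure s"
  have pre: "hausdorff_pre_measure s \<delta> A + hausdorff_pre_measure s \<delta> B \<le> ?H (A \<union> B)"
    if "0 < \<delta>" "\<delta> < d" for \<delta>
  proof -
    have "hausdorff_pre_measure s \<delta> A + hausdorff_pre_measure s \<delta> B \<le> hausdorff_pre_measure s \<delta> (A \<union> B)"
    proof (rule le_hausdorff_pre_measure)
      fix C :: "nat \<Rightarrow> 'a set"
      assume C: "A \<union> B \<subseteq> (\<Union>i. C i)" "\<And>i. bounded (C i)" "\<And>i. diameter (C i) \<le> \<delta>"
      define P Q where "P i = (if C i \<inter> A = {} then {} else C i)"
        and "Q i = (if C i \<inter> B = {} then {} else C i)" for i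
      have PQ: "C i \<inter> A = {} \<or> C i \<inter> B = {}" for i
      proof (rule ccontr)
        assume "\<not> ?thesis"
        then obtain x y where "x \<in> C i" "x \<in> A" "y \<in> C i" "y \<in> B" by blast
        then have "d \<le> dist x y" "dist x y \<le> diameter (C i)"
          using sep C(2) by (auto intro: diameter_bounded_bound)
        then show False using C(3)[of i] that by simp
      qed
      have "hausdorff_pre_measure s \<delta> A \<le> (\<Sum>i. ennreal (diameter (P i) powr s))"
        using C that by (intro hausdorff_pre_measure_le) (auto simp: P_def, blast)
      moreover have "hausdorff_pre_measure s \<delta> B \<le> (\<Sum>i. ennreal (diameter (Q i) powr s))"
        using C that by (intro hausdorff_pre_measure_le) (auto simp: Q_def, blast)
      ultimately have "hausdorff_pre_measure s \<delta> A + hausdorff_pre_measure s \<delta> B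
        \<le> (\<Sum>i. ennreal (diameter (P i) powr s)) + (\<Sum>i. ennreal (diameter (Q i) powr s))"
        by (rule add_mono)
      also have "\<dots> = (\<Sum>i. ennreal (diameter (P i) powr s) + ennreal (diameter (Q i) powr s))"
        by (intro suminf_add) auto
      also have "\<dots> \<le> (\<Sum>i. ennreal (diameter (C i) powr s))"
        using PQ by (intro suminf_le) (auto simp: P_def Q_def)
      finally show "hausdorff_pre_measure s \<delta> A + hausdorff_pre_measure s \<delta> B
        \<le> (\<Sum>i. ennreal (diameter (C i) powr s))" .
    qed
    also have "\<dots> \<le> ?H (A \<union> B)" using that by (intro hausdorff_pre_le_outer)
    finally show ?thesis .
  qed
  have pre2: "hausdorff_pre_measure s \<delta>1 A + hausdorff_pre_measure s \<delta>2 B \<le> ?H (A \<union> B)"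
    if "0 < \<delta>1" "0 < \<delta>2" for \<delta>1 \<delta>2
  proof -
    let ?m = "min (min \<delta>1 \<delta>2) (d / 2)"
    have "hausdorff_pre_measure s \<delta>1 A + hausdorff_pre_measure s \<delta>2 B
      \<le> hausdorff_pre_measure s ?m A + hausdorff_pre_measure s ?m B"
      by (intro add_mono hausdorff_pre_measure_antimono) auto
    also have "\<dots> \<le> ?H (A \<union> B)" using that \<open>0 < d\<close> by (intro pre) auto
    finally show ?thesis .
  qed
  have ne: "{0<..} \<noteq> ({} :: real set)" by (auto intro: exI[of _ 1])
  have "?H A + ?H B = (SUP \<delta>1\<in>{0<..}. hausdorff_pre_measure s \<delta>1 A + ?H B)"
    unfolding hausdorff_outer_measure_def[of s A] using ne by (intro ennreal_SUP_add_left[symmetric])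
  also have "\<dots> = (SUP \<delta>1\<in>{0<..}. SUP \<delta>2\<in>{0<..}. hausdorff_pre_measure s \<delta>1 A + hausdorff_pre_measure s \<delta>2 B)"
    unfolding hausdorff_outer_measure_def[of s B] using ne by (simp add: ennreal_SUP_add_right)
  also have "\<dots> \<le> ?H (A \<union> B)" using pre2 by (intro SUP_least) auto
  finally show ?thesis .
qed

text \<open>Caratheodory's criterion for a metric outer measure. The part of \<open>A\<close> off the closed set
  \<open>F\<close> is exhausted by the parts at distance at least \<open>1 / (n + 1)\<close> from \<open>F\<close>. The shells between
  consecutive ones are separated as soon as their indices differ by two, so the even and the odd
  shells each have total measure at most that of \<open>A\<close>, and the tail of shells is negligible.\<close>

lemma hausdorff_outer_closed_split:
  fixes F :: "'a::metric_space set"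
  assumes "closed F"
  shows "hausdorff_outer_measure s (A \<inter> F) + hausdorff_outer_measure s (A - F)
    = hausdorff_outer_measure s A"
proof (rule antisym)
  let ?H = "hausdorff_outer_measure s"
  have "?H A = ?H ((A \<inter> F) \<union> (A - F))" by (simp add: Un_Diff_Int Un_commute)
  then show "?H A \<le> ?H (A \<inter> F) + ?H (A - F)" using hausdorff_outer_Un_le by metis
  show "?H (A \<inter> F) + ?H (A - F) \<le> ?H A"
  proof (cases "F = {} \<or> ?H A = \<infinity>")
    case True
    then show ?thesis by auto
  next
    case False
    define R where "R n = {x \<in> A. 1 / real (n + 1) \<le> infdist x F}" for n
    define D where "D n = R (Suc n) - R n" for n
    have R_mono: "R m \<subseteq> R n" if "m \<le> n" for m n
    proof -
      have "1 / real (n + 1) \<le> 1 / real (m + 1)" using that by (intro divide_left_mono) auto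
      then show ?thesis by (auto simp: R_def)
    qed
    have gap: "1 / real (m + 1) - 1 / real (n + 1) \<le> dist x y" if "x \<in> A - R n" "y \<in> R m" for x y m n
    proof -
      have "infdist y F \<le> infdist x F + dist y x" by (rule infdist_triangle)
      then show ?thesis using that by (auto simp: R_def dist_commute)
    qed
    have RF: "?H (A \<inter> F) + ?H (R n) \<le> ?H A" for n
    proof -
      have "?H (A \<inter> F) + ?H (R n) \<le> ?H ((A \<inter> F) \<union> R n)"
      proof (rule hausdorff_outer_separated)
        show "0 < 1 / real (n + 1)" by simp
        fix x y assume "x \<in> A \<inter> F" "y \<in> R n"
        then show "1 / real (n + 1) \<le> dist x y"
          using infdist_le[of x F y] by (auto simp: R_def dist_commute)
      qed
      also have "\<dots> \<le> ?H A" by (intro hausdorff_outer_mono) (auto simp: R_def)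
      finally show ?thesis .
    qed
    have partial: "(\<Sum>k<n. ?H (D (2 * k + p))) \<le> ?H (\<Union>k<n. D (2 * k + p))" for n p
    proof (induction n)
      case 0
      show ?case by simp
    next
      case (Suc n)
      have "?H (\<Union>k<n. D (2 * k + p)) + ?H (D (2 * n + p)) \<le> ?H ((\<Union>k<n. D (2 * k + p)) \<union> D (2 * n + p))"
      proof (cases n)
        case 0
        then show ?thesis by simp
      next
        case (Suc n')
        show ?thesis
        proof (rule hausdorff_outer_separated)
          have "1 / real (2 * n + p + 1) < 1 / real (2 * n' + p + 2)"
            by (rule divide_strict_left_mono) (auto simp: Suc)
          then show "0 < 1 / real (2 * n' + p + 2) - 1 / real (2 * n + p + 1)" by simp
          fix y x assume "y \<in> (\<Union>k<n. D (2 * k + p))" and x: "x \<in> D (2 * n + p)"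
          then obtain k where k: "k < n" "y \<in> D (2 * k + p)" by blast
          then have "k \<le> n'" "y \<in> R (Suc (2 * k + p))" using Suc by (simp_all add: D_def)
          moreover have "Suc (2 * k + p) \<le> 2 * n' + p + 1" using \<open>k \<le> n'\<close> by simp
          ultimately have "y \<in> R (2 * n' + p + 1)" using R_mono by blast
          then show "1 / real (2 * n' + p + 2) - 1 / real (2 * n + p + 1) \<le> dist y x"
            using gap[of x "2 * n + p" y "2 * n' + p + 1"] x by (auto simp: D_def R_def dist_commute add_ac)
        qed
      qed
      then show ?case using Suc by (auto simp: lessThan_Suc Un_commute add.commute intro: order_trans add_mono)
    qed
    have half: "(\<Sum>k. ?H (D (2 * k + p))) \<le> ?H A" for p
    proof (rule suminf_le_const)
      fix n
      have "?H (\<Union>k<n. D (2 * k + p)) \<le> ?H A" by (intro hausdorff_outer_mono) (auto simp: D_def R_def)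
      then show "(\<Sum>k<n. ?H (D (2 * k + p))) \<le> ?H A" using partial order_trans by blast
    qed auto
    have total: "(\<Sum>k. ?H (D k)) \<le> ?H A + ?H A"
    proof (rule suminf_le_const)
      fix n
      have "(\<Sum>k<n. ?H (D k)) \<le> (\<Sum>k<2 * n. ?H (D k))" by (intro sum_mono2) auto
      also have "\<dots> = (\<Sum>k<n. ?H (D (2 * k + 0))) + (\<Sum>k<n. ?H (D (2 * k + 1)))"
        by (induction n) (auto simp: algebra_simps)
      also have "\<dots> \<le> (\<Sum>k. ?H (D (2 * k + 0))) + (\<Sum>k. ?H (D (2 * k + 1)))"
        by (intro add_mono sum_le_suminf) auto
      also have "\<dots> \<le> ?H A + ?H A" by (intro add_mono half)
      finally show "(\<Sum>k<n. ?H (D k)) \<le> ?H A + ?H A" .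
    qed auto
    then have fin: "(\<Sum>k. ?H (D k)) < \<infinity>" using False by (auto simp: less_top order_le_less_trans)
    define h where "h k = enn2real (?H (D k))" for k
    have h: "?H (D k) = ennreal (h k)" "0 \<le> h k" for k
    proof -
      have "?H (D k) < \<infinity>" using fin by (metis ennreal_suminf_lessD infinity_ennreal_def)
      then show "?H (D k) = ennreal (h k)" by (simp add: h_def)
    qed (simp add: h_def)
    have sh: "summable h" using fin h by (intro summable_suminf_not_top) auto
    show ?thesis
    proof (rule ennreal_le_epsilon)
      fix e :: real assume "0 < e"
      obtain N where N: "norm (\<Sum>i. h (i + N)) < e"
        using suminf_exist_split[OF \<open>0 < e\<close> sh] by blast
      have "A - F \<subseteq> (\<Union>i. R i)"
      proof
        fix x assume x: "x \<in> A - F"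
        then have "0 < infdist x F" using assms False
          by (metis Diff_iff in_closed_iff_infdist_zero infdist_nonneg less_eq_real_def)
        then obtain n where "1 / real (Suc n) < infdist x F" by (rule nat_approx_posE)
        then show "x \<in> (\<Union>i. R i)" using x by (auto simp: R_def intro!: exI[of _ n])
      qed
      moreover have "R n \<subseteq> R N \<union> (\<Union>i. D (i + N))" for n
      proof (induction n)
        case 0 show ?case using R_mono[of 0 N] by auto
      next
        case (Suc n)
        show ?case
        proof (cases "Suc n \<le> N")
          case True then show ?thesis using R_mono by blast
        next
          case False
          have "D ((n - N) + N) \<subseteq> (\<Union>i. D (i + N))" by blast
          then have "D n \<subseteq> (\<Union>i. D (i + N))" using False by simp
          then show ?thesis using Suc by (auto simp: D_def)
        qed
      qed
      ultimately have "A - F \<subseteq> R N \<union> (\<Union>i. D (i + N))" by blast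
      then have "?H (A - F) \<le> ?H (R N \<union> (\<Union>i. D (i + N)))" by (rule hausdorff_outer_mono)
      also have "\<dots> \<le> ?H (R N) + (\<Sum>i. ?H (D (i + N)))"
        by (rule order_trans[OF hausdorff_outer_Un_le]) (intro add_left_mono hausdorff_outer_countably_subadditive)
      also have "(\<Sum>i. ?H (D (i + N))) = ennreal (\<Sum>i. h (i + N))"
        unfolding h using sh h(2) by (intro suminf_ennreal2) (auto simp: summable_iff_shift)
      also have "?H (R N) + ennreal (\<Sum>i. h (i + N)) \<le> ?H (R N) + ennreal e"
        using N by (intro add_left_mono ennreal_leI) auto
      finally have "?H (A \<inter> F) + ?H (A - F) \<le> ?H (A \<inter> F) + (?H (R N) + ennreal e)"
        by (intro add_left_mono)
      also have "\<dots> \<le> ?H A + ennreal e" using RF[of N] by (metis add.assoc add_right_mono)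
      finally show "?H (A \<inter> F) + ?H (A - F) \<le> ?H A + ennreal e" .
    qed
  qed
qed

lemma measure_space_hausdorff:
  "measure_space UNIV (sets borel) (hausdorff_outer_measure s :: 'a::metric_space set \<Rightarrow> ennreal)"
proof -
  let ?H = "hausdorff_outer_measure s :: 'a set \<Rightarrow> ennreal"
  interpret sigma_algebra UNIV "UNIV :: 'a set set" using sigma_algebra_Pow[of UNIV] by simp
  let ?L = "lambda_system UNIV UNIV ?H"
  have ms: "measure_space UNIV ?L ?H"
    by (rule caratheodory_lemma[OF hausdorff_outer_measure_space])
  then have sa: "sigma_algebra UNIV ?L" by (simp add: measure_space_def)
  have "{F :: 'a set. closed F} \<subseteq> ?L"
    using hausdorff_outer_closed_split[of _ s] by (auto simp: lambda_system_eq)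
  then have sub: "sets borel \<subseteq> ?L"
    unfolding borel_eq_closed using sigma_algebra.sigma_sets_subset[OF sa] by (simp add: sets_measure_of)
  show ?thesis
    unfolding measure_space_def
  proof (intro conjI)
    show "sigma_algebra UNIV (sets (borel :: 'a measure))"
      using sets.sigma_algebra_axioms[of "borel :: 'a measure"] by simp
    show "positive (sets borel) ?H" by (simp add: positive_def)
    show "countably_additive (sets borel) ?H"
      using ms sub unfolding measure_space_def countably_additive_def by blast
  qed
qed

lemma space_hausdorff_measure [simp]: "space (hausdorff_measure s) = UNIV"
  by (simp add: hausdorff_measure_def space_measure_of_conv)

lemma sets_hausdorff_measure [simp]: "sets (hausdorff_measure s :: 'a::metric_space measure) = sets borel"
  unfolding hausdorff_measure_def using sets.sets_measure_of_eq[of "borel :: 'a measure"]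
  by simp

lemma emeasure_hausdorff_measure:
  assumes "A \<in> sets borel"
  shows "emeasure (hausdorff_measure s) A = hausdorff_outer_measure s A"
proof -
  have ms: "measure_space UNIV (sets borel) (hausdorff_outer_measure s :: 'a set \<Rightarrow> ennreal)"
    by (rule measure_space_hausdorff)
  show ?thesis
    unfolding hausdorff_measure_def using ms assms
    by (intro emeasure_measure_of_sigma) (auto simp: measure_space_def)
qed

lemma hausdorff_outer_similarity_le:
  fixes f :: "'a::metric_space \<Rightarrow> 'b::metric_space"
  assumes f: "\<And>x y. dist (f x) (f y) = \<rho> * dist x y" and "0 < \<rho>" and "0 < s"
  shows "hausdorff_outer_measure s (f ` A) \<le> ennreal (\<rho> powr s) * hausdorff_outer_measure s A"
proof (rule hausdorff_outer_leI)
  fix \<delta> :: real assume "0 < \<delta>"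
  have *: "hausdorff_pre_measure s \<delta> (f ` A) / ennreal (\<rho> powr s) \<le> hausdorff_pre_measure s (\<delta> / \<rho>) A"
  proof (rule le_hausdorff_pre_measure)
    fix C :: "nat \<Rightarrow> 'a set"
    assume C: "A \<subseteq> (\<Union>i. C i)" "\<And>i. bounded (C i)" "\<And>i. diameter (C i) \<le> \<delta> / \<rho>"
    have dl: "diameter (f ` C i) \<le> \<rho> * diameter (C i)" for i
    proof (cases "C i = {}")
      case False
      have "(SUP (x, y)\<in>f ` C i \<times> f ` C i. dist x y) \<le> \<rho> * diameter (C i)"
        using False f \<open>0 < \<rho>\<close> diameter_bounded_bound[OF C(2)]
        by (intro cSUP_least) (auto intro!: mult_left_mono)
      then show ?thesis using False by (simp add: diameter_def)
    qed simp
    have bd: "bounded (f ` C i)" for i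
    proof -
      obtain x e where e: "\<forall>y\<in>C i. dist x y \<le> e" using C(2)[of i] unfolding bounded_def by blast
      then have "\<forall>y\<in>f ` C i. dist (f x) y \<le> \<rho> * e" using f \<open>0 < \<rho>\<close> by auto
      then show ?thesis unfolding bounded_def by blast
    qed
    have "hausdorff_pre_measure s \<delta> (f ` A) \<le> (\<Sum>i. ennreal (diameter (f ` C i) powr s))"
    proof (rule hausdorff_pre_measure_le)
      fix i show "diameter (f ` C i) \<le> \<delta>"
        using dl[of i] C(3)[of i] \<open>0 < \<rho>\<close> by (simp add: field_simps)
    next
      show "f ` A \<subseteq> (\<Union>i. f ` C i)" using C(1) by blast
    qed (rule bd)
    also have "\<dots> \<le> (\<Sum>i. ennreal (\<rho> powr s) * ennreal (diameter (C i) powr s))"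
    proof (intro suminf_le)
      fix i
      have "diameter (f ` C i) powr s \<le> (\<rho> * diameter (C i)) powr s"
        using dl[of i] diameter_ge_0[OF bd] \<open>0 < s\<close> by (intro powr_mono2) auto
      also have "\<dots> = \<rho> powr s * diameter (C i) powr s"
        using \<open>0 < \<rho>\<close> diameter_ge_0[OF C(2)] by (intro powr_mult)
      finally show "ennreal (diameter (f ` C i) powr s) \<le> ennreal (\<rho> powr s) * ennreal (diameter (C i) powr s)"
        by (simp add: ennreal_mult[symmetric] ennreal_leI)
    qed auto
    also have "\<dots> = ennreal (\<rho> powr s) * (\<Sum>i. ennreal (diameter (C i) powr s))" by simp
    finally show "hausdorff_pre_measure s \<delta> (f ` A) / ennreal (\<rho> powr s)
        \<le> (\<Sum>i. ennreal (diameter (C i) powr s))"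
      using \<open>0 < \<rho>\<close> by (subst divide_le_posI_ennreal) (auto simp: mult.commute)
  qed
  have "hausdorff_pre_measure s (\<delta> / \<rho>) A \<le> hausdorff_outer_measure s A"
    using \<open>0 < \<delta>\<close> \<open>0 < \<rho>\<close> by (intro hausdorff_pre_le_outer) simp
  with * have **: "hausdorff_pre_measure s \<delta> (f ` A) / ennreal (\<rho> powr s) \<le> hausdorff_outer_measure s A"
    by (rule order_trans)
  have "hausdorff_pre_measure s \<delta> (f ` A)
      = ennreal (\<rho> powr s) * (hausdorff_pre_measure s \<delta> (f ` A) / ennreal (\<rho> powr s))"
    using \<open>0 < \<rho>\<close> by (simp add: ennreal_times_divide ennreal_mult_divide_eq mult.commute[of "ennreal (\<rho> powr s)"])
  also have "\<dots> \<le> ennreal (\<rho> powr s) * hausdorff_outer_measure s A" using ** by (intro mult_left_mono) auto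
  finally show "hausdorff_pre_measure s \<delta> (f ` A) \<le> ennreal (\<rho> powr s) * hausdorff_outer_measure s A" .
qed

lemma hausdorff_outer_similarity:
  fixes f :: "'a::metric_space \<Rightarrow> 'a"
  assumes f: "\<And>x y. dist (f x) (f y) = \<rho> * dist x y" and gf: "\<And>x. g (f x) = x" and fg: "\<And>x. f (g x) = x"
    and "0 < \<rho>" and "0 < s"
  shows "hausdorff_outer_measure s (f ` A) = ennreal (\<rho> powr s) * hausdorff_outer_measure s A"
proof (rule antisym)
  show "hausdorff_outer_measure s (f ` A) \<le> ennreal (\<rho> powr s) * hausdorff_outer_measure s A"
    by (rule hausdorff_outer_similarity_le) (use assms in auto)
  have "dist (g x) (g y) = (1 / \<rho>) * dist x y" for x y
    using f[of "g x" "g y"] fg \<open>0 < \<rho>\<close> by (simp add: field_simps)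
  then have "hausdorff_outer_measure s (g ` f ` A)
      \<le> ennreal ((1 / \<rho>) powr s) * hausdorff_outer_measure s (f ` A)"
    using assms by (intro hausdorff_outer_similarity_le) auto
  then have "ennreal (\<rho> powr s) * hausdorff_outer_measure s A
      \<le> ennreal (\<rho> powr s) * (ennreal ((1 / \<rho>) powr s) * hausdorff_outer_measure s (f ` A))"
    by (intro mult_left_mono) (auto simp: image_image gf)
  also have "\<dots> = hausdorff_outer_measure s (f ` A)"
    using \<open>0 < \<rho>\<close> by (simp add: mult.assoc[symmetric] ennreal_mult[symmetric] powr_mult[symmetric])
  finally show "ennreal (\<rho> powr s) * hausdorff_outer_measure s A \<le> hausdorff_outer_measure s (f ` A)" .
qed

section \<open>Cells of the eyebolted cross\<close>

definition embed :: "int \<times> int \<Rightarrow> real \<times> real" where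
  "embed c = (of_int (fst c), of_int (snd c))"

text \<open>Cells of level \<open>n\<close> are indexed by pairs of integers instead of words: the index
  is the address read in base 9 with digits from \<open>-4\<close> to \<open>4\<close>, and
  the cell lies in the square of side \<open>1 / 9 ^ n\<close> around \<open>1 / 9 ^ n\<close>
  times its index.\<close>

definition place :: "nat \<Rightarrow> int \<times> int \<Rightarrow> real \<times> real \<Rightarrow> real \<times> real" where
  "place n c x = (1 / 9 ^ n) *\<^sub>R (x + embed c)"

definition shift :: "nat \<Rightarrow> int \<times> int \<Rightarrow> int \<times> int \<Rightarrow> int \<times> int" where
  "shift m c t = (9 ^ m * fst c + fst t, 9 ^ m * snd c + snd t)"

abbreviation child :: "int \<times> int \<Rightarrow> int \<times> int \<Rightarrow> int \<times> int" where
  "child \<equiv> shift 1"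

text \<open>A label is \<open>(0, 0)\<close> for the centre, or a pair of signs for a corner. Corners
  shared by the cells \<open>c\<close> and \<open>c + e\<close> then have the labels
  \<open>e\<close> and \<open>- e\<close>.\<close>

definition vertex :: "nat \<Rightarrow> int \<times> int \<Rightarrow> int \<times> int \<Rightarrow> real \<times> real" where
  "vertex n c e = place n c ((1 / 2) *\<^sub>R embed e)"

definition main_ends :: "(int \<times> int) set" where "main_ends = {(1, 1), (-1, -1)}"
definition anti_ends :: "(int \<times> int) set" where "anti_ends = {(1, -1), (-1, 1)}"
definition corners :: "(int \<times> int) set" where "corners = main_ends \<union> anti_ends"

lemma corners_cases:
  assumes "e \<in> corners"
  obtains "e = (1, 1)" | "e = (-1, -1)" | "e = (1, -1)" | "e = (-1, 1)"
  using assms by (auto simp: corners_def main_ends_def anti_ends_def)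

lemma corners_iff: "e \<in> corners \<longleftrightarrow> \<bar>fst e\<bar> = 1 \<and> \<bar>snd e\<bar> = 1"
  by (cases e) (auto simp: corners_def main_ends_def anti_ends_def abs_if split: if_splits)

lemma uminus_corners: "e \<in> corners \<Longrightarrow> - e \<in> corners"
  by (auto simp: corners_iff)

lemma fst_place [simp]: "fst (place n c x) = (fst x + of_int (fst c)) / 9 ^ n"
  and snd_place [simp]: "snd (place n c x) = (snd x + of_int (snd c)) / 9 ^ n"
  by (simp_all add: place_def embed_def)

lemma fst_shift [simp]: "fst (shift m c t) = 9 ^ m * fst c + fst t"
  and snd_shift [simp]: "snd (shift m c t) = 9 ^ m * snd c + snd t"
  by (simp_all add: shift_def)

lemma fst_vertex: "fst (vertex n c e) = (of_int (fst e) / 2 + of_int (fst c)) / 9 ^ n"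
  and snd_vertex: "snd (vertex n c e) = (of_int (snd e) / 2 + of_int (snd c)) / 9 ^ n"
  by (simp_all add: vertex_def embed_def)

lemma place_shift: "place (n + m) (shift m c t) x = place n c (place m t x)"
  by (rule prod_eqI) (simp_all add: field_simps power_add)

lemma place_1: "place 1 c x = cell_map c x"
  by (rule prod_eqI) (simp_all add: cell_map_def cell_center_def)

lemma place_child: "place (Suc n) (child c i) x = place n c (cell_map i x)"
  using place_shift[of n 1 c i x] by (simp add: place_1[symmetric])

lemma place_0: "place 0 (0, 0) x = x"
  by (rule prod_eqI) simp_all

lemma dist_le_coordinates: "dist x y \<le> \<bar>fst x - fst y\<bar> + \<bar>snd x - snd y\<bar>" for x y :: "real \<times> real"
  using sqrt_sum_squares_le_sum_abs[of "fst x - fst y" "snd x - snd y"]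
  by (simp add: dist_prod_def dist_real_def)

lemma coordinates_le_dist:
  fixes x y :: "real \<times> real"
  shows "\<bar>fst x - fst y\<bar> \<le> dist x y" "\<bar>snd x - snd y\<bar> \<le> dist x y"
  using dist_fst_le[of x y] dist_snd_le[of x y] by (simp_all add: dist_real_def)

lemma dist_place: "dist (place n c x) (place n c y) = (1 / 9 ^ n) * dist x y"
  by (simp add: place_def dist_norm scaleR_diff_right[symmetric])

lemma continuous_place: "continuous_on A (place n c)"
  unfolding place_def by (intro continuous_intros)

lemma vertex_shared: "vertex n c e = vertex n (c + e) (- e)"
  by (rule prod_eqI) (simp_all add: fst_vertex snd_vertex)

primrec cells :: "(int \<times> int) set \<Rightarrow> nat \<Rightarrow> (int \<times> int) set" where
  "cells D 0 = {(0, 0)}"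
| "cells D (Suc n) = (\<lambda>(c, i). child c i) ` (cells D n \<times> D)"

locale eyebolted_cross =
  fixes L U :: "(int \<times> int) set" and K :: "(real \<times> real) set"
  assumes L: "L \<in> lower_right_eyebolts" and U: "U \<in> upper_left_eyebolts"
    and cross: "is_eyebolted_vicsek_cross L U K"
begin

definition D where "D = diagonal_cells \<union> L \<union> U"

abbreviation cs :: "nat \<Rightarrow> (int \<times> int) set" where "cs \<equiv> cells D"

definition cell :: "nat \<Rightarrow> int \<times> int \<Rightarrow> (real \<times> real) set" where "cell n c = place n c ` K"

text \<open>The signs tell on which side of the anti-diagonal the two eyebolts lie.\<close>

lemma D_explicit:
  obtains s s' :: int where "s = 1 \<or> s = -1" "s' = 1 \<or> s' = -1"
    "D = {(0,0), (1,1), (2,2), (3,3), (4,4), (-1,-1), (-2,-2), (-3,-3), (-4,-4),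
          (1,-1), (2,-2), (3,-3), (4,-4), (-1,1), (-2,2), (-3,3), (-4,4),
          (s + 2, s - 2), (s + 3, s - 3), (s' - 2, s' + 2), (s' - 3, s' + 3)}"
proof -
  have r: "{-4..4::int} = {-4, -3, -2, -1, 0, 1, 2, 3, 4}"
    by (simp add: set_eq_iff, presburger)
  have "diagonal_cells = (\<lambda>k. (k, k)) ` {-4..4} \<union> (\<lambda>k. (k, - k)) ` ({-4..4} - {0})"
    unfolding diagonal_cells_def by (intro arg_cong2[where f = "(\<union>)"]) (auto simp: image_iff)
  then have d: "diagonal_cells = {(0,0), (1,1), (2,2), (3,3), (4,4), (-1,-1), (-2,-2), (-3,-3), (-4,-4),
          (1,-1), (2,-2), (3,-3), (4,-4), (-1,1), (-2,2), (-3,3), (-4,4)}"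
    unfolding r by (simp add: insert_Diff_if insert_commute)
  have "L = {(3, -1), (4, -2)} \<or> L = {(1, -3), (2, -4)}"
    using L by (simp add: lower_right_eyebolts_def)
  then have "\<exists>s. (s = 1 \<or> s = -1) \<and> L = {(s + 2, s - 2), (s + 3, s - 3)}"
    by (elim disjE) (intro exI[of _ 1], simp, intro exI[of _ "-1"], simp)
  moreover have "U = {(-1, 3), (-2, 4)} \<or> U = {(-3, 1), (-4, 2)}"
    using U by (auto simp: upper_left_eyebolts_def)
  then have "\<exists>s. (s = 1 \<or> s = -1) \<and> U = {(s - 2, s + 2), (s - 3, s + 3)}"
    by (elim disjE) (intro exI[of _ 1], simp, intro exI[of _ "-1"], simp)
  ultimately obtain s s' :: int where s: "s = 1 \<or> s = -1" "s' = 1 \<or> s' = -1"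
    "L = {(s + 2, s - 2), (s + 3, s - 3)}" "U = {(s' - 2, s' + 2), (s' - 3, s' + 3)}" by blast
  show ?thesis
    by (rule that[OF s(1,2)]) (unfold D_def, unfold d s(3,4), simp only: Un_insert_left Un_empty_left)
qed

lemma finite_D [simp]: "finite D"
  by (rule D_explicit) (simp only: finite.emptyI finite.insertI)

lemma card_D: "card D = 21"
  using card_selected_cells[OF L U] by (simp add: D_def)

lemma D_bounds: assumes "i \<in> D" shows "\<bar>fst i\<bar> \<le> 4" "\<bar>snd i\<bar> \<le> 4"
  using assms by (rule_tac [!] D_explicit) auto

lemma D_even: assumes "i \<in> D" shows "even (fst i + snd i)"
  using assms by (rule_tac D_explicit) auto

lemma D_diagonal: assumes "\<bar>k\<bar> \<le> 4" shows "(k, k) \<in> D" "(k, - k) \<in> D"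
proof -
  show "(k, k) \<in> D" using assms by (auto simp: D_def diagonal_cells_def)
  show "(k, - k) \<in> D"
  proof (cases "k = 0")
    case True then show ?thesis by (auto simp: D_def diagonal_cells_def)
  next
    case False then show ?thesis using assms by (auto simp: D_def diagonal_cells_def)
  qed
qed

lemma D_corner: assumes "e \<in> corners" shows "(4 * fst e, 4 * snd e) \<in> D"
  using assms D_diagonal[of 4] D_diagonal[of "-4"] by (elim corners_cases) auto

lemma D_not_anti_neighbour: "(3, 1) \<notin> D" "(1, 3) \<notin> D"
  by (rule_tac [!] D_explicit) auto

lemma K_props: "K \<noteq> {}" "compact K" "K = (\<Union>i\<in>D. cell_map i ` K)"
  using cross by (simp_all add: is_eyebolted_vicsek_cross_def D_def)

lemma K_closed: "closed K" using K_props compact_imp_closed by blast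

text \<open>At a point of \<open>K\<close> where a coordinate is largest in modulus, one step of the
  self-similarity bounds it by a ninth of itself plus \<open>4 / 9\<close>.\<close>

lemma K_square:
  assumes "x \<in> K" shows "\<bar>fst x\<bar> \<le> 1 / 2" "\<bar>snd x\<bar> \<le> 1 / 2"
proof -
  have "\<exists>y\<in>K. \<forall>z\<in>K. \<bar>fst z\<bar> \<le> \<bar>fst y\<bar>"
    by (rule continuous_attains_sup[OF K_props(2,1)]) (intro continuous_intros)
  then obtain y where y: "y \<in> K" "\<And>z. z \<in> K \<Longrightarrow> \<bar>fst z\<bar> \<le> \<bar>fst y\<bar>" by blast
  obtain i z where "i \<in> D" "z \<in> K" "y = cell_map i z" using y(1) K_props(3) by blast
  then have "fst y = fst z / 9 + of_int (fst i) / 9" "\<bar>real_of_int (fst i)\<bar> \<le> 4"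
    using D_bounds[of i] by (simp_all add: cell_map_def cell_center_def)
  then have "\<bar>fst y\<bar> \<le> \<bar>fst y\<bar> / 9 + 4 / 9" using y(2)[OF \<open>z \<in> K\<close>] by linarith
  then show "\<bar>fst x\<bar> \<le> 1 / 2" using y(2)[OF assms] by linarith
  have "\<exists>y\<in>K. \<forall>z\<in>K. \<bar>snd z\<bar> \<le> \<bar>snd y\<bar>"
    by (rule continuous_attains_sup[OF K_props(2,1)]) (intro continuous_intros)
  then obtain y where y: "y \<in> K" "\<And>z. z \<in> K \<Longrightarrow> \<bar>snd z\<bar> \<le> \<bar>snd y\<bar>" by blast
  obtain i z where "i \<in> D" "z \<in> K" "y = cell_map i z" using y(1) K_props(3) by blast
  then have "snd y = snd z / 9 + of_int (snd i) / 9" "\<bar>real_of_int (snd i)\<bar> \<le> 4"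
    using D_bounds[of i] by (simp_all add: cell_map_def cell_center_def)
  then have "\<bar>snd y\<bar> \<le> \<bar>snd y\<bar> / 9 + 4 / 9" using y(2)[OF \<open>z \<in> K\<close>] by linarith
  then show "\<bar>snd x\<bar> \<le> 1 / 2" using y(2)[OF assms] by linarith
qed

lemma finite_cs [simp]: "finite (cs n)"
  by (induction n) auto

lemma child_in_cs: "c \<in> cs n \<Longrightarrow> i \<in> D \<Longrightarrow> child c i \<in> cs (Suc n)"
  by (force simp del: One_nat_def)

lemma cs_SucE:
  assumes "c \<in> cs (Suc n)" obtains a i where "a \<in> cs n" "i \<in> D" "c = child a i"
  using assms by auto

lemma child_inj:
  assumes "child c i = child c' i'" "i \<in> D" "i' \<in> D" shows "c = c'" "i = i'"
proof -
  have *: "9 * fst c + fst i = 9 * fst c' + fst i'" "9 * snd c + snd i = 9 * snd c' + snd i'"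
    using assms(1) by (simp_all add: prod_eq_iff)
  have "fst c = fst c'" "snd c = snd c'"
    using * D_bounds[OF assms(2)] D_bounds[OF assms(3)] by linarith+
  then show "c = c'" "i = i'" using * by (simp_all add: prod_eq_iff)
qed

lemma child_inj_on: "inj_on (\<lambda>(c, i). child c i) (A \<times> D)"
proof (rule inj_onI)
  fix p q
  assume *: "p \<in> A \<times> D" "q \<in> A \<times> D" "(\<lambda>(c, i). child c i) p = (\<lambda>(c, i). child c i) q"
  then have "child (fst p) (snd p) = child (fst q) (snd q)" "snd p \<in> D" "snd q \<in> D"
    by (simp_all only: case_prod_unfold mem_Times_iff)
  from child_inj[OF this] show "p = q" by (simp add: prod_eq_iff)
qed

lemma sum_cs_Suc: "(\<Sum>c\<in>cs (Suc n). f c) = (\<Sum>c\<in>cs n. \<Sum>i\<in>D. f (child c i))"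
proof -
  have "(\<Sum>c\<in>cs (Suc n). f c) = (\<Sum>(c, i)\<in>cs n \<times> D. f (child c i))"
    unfolding cells.simps by (subst sum.reindex[OF child_inj_on]) (simp add: case_prod_unfold comp_def)
  then show ?thesis by (simp add: sum.cartesian_product)
qed

lemma card_cs: "card (cs n) = 21 ^ n"
proof (induction n)
  case (Suc n)
  have "card (cs (Suc n)) = card (cs n \<times> D)" unfolding cells.simps by (rule card_image[OF child_inj_on])
  then show ?case using Suc by (simp add: card_D)
qed simp

lemma cs_even: "c \<in> cs n \<Longrightarrow> even (fst c + snd c)"
proof (induction n arbitrary: c)
  case (Suc n)
  then obtain a i where "a \<in> cs n" "i \<in> D" "c = child a i" by (elim cs_SucE)
  moreover from this have "even (fst a + snd a)" "even (fst i + snd i)" using Suc D_even by auto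
  ultimately show ?case by simp
qed simp

lemma cs_bounds: "c \<in> cs n \<Longrightarrow> \<bar>2 * fst c\<bar> \<le> 9 ^ n - 1 \<and> \<bar>2 * snd c\<bar> \<le> 9 ^ n - 1"
proof (induction n arbitrary: c)
  case (Suc n)
  then obtain a i where a: "a \<in> cs n" "i \<in> D" "c = child a i" by (elim cs_SucE)
  have "\<bar>2 * (9 * x + y)\<bar> \<le> 9 * N - 1" if "\<bar>2 * x\<bar> \<le> N - 1" "\<bar>y\<bar> \<le> 4" for x y N :: int
    using that by (auto simp: abs_le_iff)
  from this[of "fst a" "9 ^ n" "fst i"] this[of "snd a" "9 ^ n" "snd i"]
  show ?case using a Suc.IH[OF a(1)] D_bounds[OF a(2)] by simp
qed simp

lemma shift_child: "child (shift m a t) i = shift (Suc m) a (child t i)"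
  by (simp add: prod_eq_iff algebra_simps)

lemma cs_addE:
  assumes "c \<in> cs (n + m)" obtains a t where "a \<in> cs n" "t \<in> cs m" "c = shift m a t"
proof -
  have "\<exists>a\<in>cs n. \<exists>t\<in>cs m. c = shift m a t" using assms
  proof (induction m arbitrary: c)
    case 0
    have "c = shift 0 c (0, 0)" by (simp add: prod_eq_iff)
    then show ?case using 0 by (metis add_0_right cells.simps(1) insertI1)
  next
    case (Suc m)
    then obtain b i where b: "b \<in> cs (n + m)" "i \<in> D" "c = child b i" by (auto elim: cs_SucE)
    obtain a t where "a \<in> cs n" "t \<in> cs m" "b = shift m a t" using Suc.IH[OF b(1)] by blast
    then show ?case using b shift_child child_in_cs by blast
  qed
  then show ?thesis using that by blast
qed

lemma place_in_K: "x \<in> K \<Longrightarrow> c \<in> cs n \<Longrightarrow> place n c x \<in> K"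
proof (induction n arbitrary: c x)
  case 0
  then show ?case by (simp add: place_0)
next
  case (Suc n)
  then obtain a i where a: "a \<in> cs n" "i \<in> D" "c = child a i" by (elim cs_SucE)
  moreover have "cell_map i x \<in> K" using Suc.prems(1) a(2) K_props(3) by blast
  ultimately show ?case using Suc.IH by (simp add: place_child del: One_nat_def)
qed

lemma cell_subset_K: "c \<in> cs n \<Longrightarrow> cell n c \<subseteq> K"
  unfolding cell_def using place_in_K by blast

lemma cell_child_Un: "cell n c = (\<Union>i\<in>D. cell (Suc n) (child c i))"
proof -
  have "cell n c = (\<Union>i\<in>D. place n c ` cell_map i ` K)"
    unfolding cell_def by (subst K_props(3)) blast
  then show ?thesis by (simp add: cell_def place_child image_image del: One_nat_def)
qed

lemma cell_child_subset: "i \<in> D \<Longrightarrow> cell (Suc n) (child c i) \<subseteq> cell n c"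
  using cell_child_Un by blast

lemma K_cells: "K = (\<Union>c\<in>cs n. cell n c)"
proof (induction n)
  case 0
  then show ?case by (simp add: cell_def place_0)
next
  case (Suc n)
  have "(\<Union>c\<in>cs (Suc n). cell (Suc n) c) = (\<Union>c\<in>cs n. \<Union>i\<in>D. cell (Suc n) (child c i))" by auto
  then show ?case unfolding cell_child_Un[symmetric] using Suc by simp
qed

lemma K_cellE: assumes "x \<in> K" obtains c where "c \<in> cs n" "x \<in> cell n c"
  using assms K_cells[of n] by blast

lemma cell_compact: "compact (cell n c)"
  unfolding cell_def using K_props(2) continuous_place by (intro compact_continuous_image) auto

lemma cell_nonempty: "cell n c \<noteq> {}" using K_props(1) by (simp add: cell_def)

lemma cell_square:
  assumes "x \<in> cell n c"
  shows "\<bar>9 ^ n * fst x - of_int (fst c)\<bar> \<le> 1 / 2" "\<bar>9 ^ n * snd x - of_int (snd c)\<bar> \<le> 1 / 2"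
  using assms K_square by (auto simp: cell_def)

lemma cell_diameter:
  assumes "x \<in> cell n c" "y \<in> cell n c" shows "dist x y \<le> 2 / 9 ^ n"
proof -
  obtain x' y' where *: "x' \<in> K" "y' \<in> K" "x = place n c x'" "y = place n c y'"
    using assms by (auto simp: cell_def)
  have "dist x' y' \<le> 2"
    using dist_le_coordinates[of x' y'] K_square[OF *(1)] K_square[OF *(2)] by linarith
  then show ?thesis by (simp add: * dist_place divide_right_mono)
qed

text \<open>A corner is the fixed point of the map of the corner digit, hence a limit of iterates of any
  point of \<open>K\<close>.\<close>

lemma vertex_in_K:
  assumes "e \<in> insert (0, 0) corners" shows "(1 / 2) *\<^sub>R embed e \<in> K"
proof -
  define i where "i = (4 * fst e, 4 * snd e)"
  have i: "i \<in> D" using assms D_corner D_diagonal[of 0] by (auto simp: i_def)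
  let ?p = "(1 / 2) *\<^sub>R embed e"
  obtain z where z: "z \<in> K" using K_props by blast
  have fix_p: "cell_map i ?p = ?p"
    by (rule prod_eqI) (simp_all add: cell_map_def cell_center_def i_def embed_def)
  define f where "f k = (cell_map i ^^ k) z" for k
  have fK: "f k \<in> K" for k
    using z i K_props(3) by (induction k) (auto simp: f_def)
  have "f k - ?p = (1 / 9) ^ k *\<^sub>R (z - ?p)" for k
  proof (induction k)
    case (Suc k)
    have "f (Suc k) - ?p = cell_map i (f k) - cell_map i ?p" by (simp add: f_def fix_p)
    also have "\<dots> = (1 / 9) *\<^sub>R (f k - ?p)" by (simp add: cell_map_def scaleR_diff_right)
    finally show ?case using Suc by simp
  qed (simp add: f_def)
  moreover have "(\<lambda>k. (1 / 9) ^ k *\<^sub>R (z - ?p)) \<longlonglongrightarrow> 0 *\<^sub>R (z - ?p)"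
    by (intro tendsto_intros LIMSEQ_power_zero) auto
  ultimately have "(\<lambda>k. f k - ?p) \<longlonglongrightarrow> 0" by simp
  then have "f \<longlonglongrightarrow> ?p" by (simp add: LIM_zero_iff)
  then show ?thesis using fK K_closed closed_sequentially by blast
qed

lemma vertex_in_cell: "e \<in> insert (0, 0) corners \<Longrightarrow> vertex n c e \<in> cell n c"
  using vertex_in_K by (auto simp: vertex_def cell_def)

lemma vertex_in_K': "c \<in> cs n \<Longrightarrow> e \<in> insert (0, 0) corners \<Longrightarrow> vertex n c e \<in> K"
  using vertex_in_cell cell_subset_K by blast

text \<open>All cells of one level lie on the same colour of a checkerboard, so cells that come
  close share a corner and never an edge.\<close>

lemma close_cells:
  assumes "c \<in> cs n" "c' \<in> cs n" "x \<in> cell n c" "y \<in> cell n c'" "dist x y < 1 / 9 ^ n"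
  shows "c' = c \<or> c' - c \<in> corners"
proof -
  have "\<bar>fst x - fst y\<bar> < 1 / 9 ^ n" "\<bar>snd x - snd y\<bar> < 1 / 9 ^ n"
    using assms(5) coordinates_le_dist[of x y] by linarith+
  then have "9 ^ n * \<bar>fst x - fst y\<bar> < 1" "9 ^ n * \<bar>snd x - snd y\<bar> < 1"
    by (simp_all add: field_simps)
  then have "\<bar>9 ^ n * fst x - 9 ^ n * fst y\<bar> < 1" "\<bar>9 ^ n * snd x - 9 ^ n * snd y\<bar> < 1"
    by (simp_all add: right_diff_distrib[symmetric] abs_mult)
  then have "\<bar>real_of_int (fst c' - fst c)\<bar> < 2" "\<bar>real_of_int (snd c' - snd c)\<bar> < 2"
    using cell_square[OF assms(3)] cell_square[OF assms(4)] unfolding of_int_diff by linarith+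
  then have "\<bar>fst c' - fst c\<bar> < 2" "\<bar>snd c' - snd c\<bar> < 2" by linarith+
  moreover have "even ((fst c' - fst c) + (snd c' - snd c))"
    using cs_even[OF assms(1)] cs_even[OF assms(2)] by presburger
  ultimately have "fst c' - fst c = 0 \<and> snd c' - snd c = 0 \<or> \<bar>fst c' - fst c\<bar> = 1 \<and> \<bar>snd c' - snd c\<bar> = 1"
    by presburger
  then show ?thesis by (auto simp: corners_iff prod_eq_iff)
qed

lemma cells_meet_in_vertex:
  assumes "c \<in> cs n" "c' \<in> cs n" "c \<noteq> c'" "x \<in> cell n c" "x \<in> cell n c'"
  shows "c' - c \<in> corners" "x = vertex n c (c' - c)"
proof -
  show e: "c' - c \<in> corners" using close_cells[OF assms(1,2,4,5)] assms(3) by auto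
  have cd: "9 ^ n * u = of_int a + of_int (a' - a) / 2"
    if "\<bar>a' - a\<bar> = 1" "\<bar>9 ^ n * u - of_int a\<bar> \<le> 1 / 2" "\<bar>9 ^ n * u - of_int a'\<bar> \<le> 1 / 2" for u :: real and a a' :: int
  proof -
    have "real_of_int a' = of_int a + 1 \<or> real_of_int a' = of_int a - 1" using that(1) by linarith
    then show ?thesis
    proof
      assume a': "real_of_int a' = of_int a + 1"
      have "9 ^ n * u \<le> of_int a + 1 / 2" "of_int a + 1 / 2 \<le> 9 ^ n * u"
        using that(2,3) a' by linarith+
      then show ?thesis using a' by simp
    next
      assume a': "real_of_int a' = of_int a - 1"
      have "9 ^ n * u \<le> of_int a - 1 / 2" "of_int a - 1 / 2 \<le> 9 ^ n * u"
        using that(2,3) a' by linarith+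
      then show ?thesis using a' by simp
    qed
  qed
  have "9 ^ n * fst x = of_int (fst c) + of_int (fst c' - fst c) / 2"
    "9 ^ n * snd x = of_int (snd c) + of_int (snd c' - snd c) / 2"
    using e by (intro cd cell_square[OF assms(4)] cell_square[OF assms(5)]; simp add: corners_iff)+
  then show "x = vertex n c (c' - c)"
    by (intro prod_eqI) (simp_all add: fst_vertex snd_vertex field_simps)
qed

end

section \<open>The normalized measure\<close>

definition hdim :: real where "hdim = ln 21 / ln 9"

lemma hdim_pos: "0 < hdim" by (simp add: hdim_def)

lemma nine_powr_hdim: "(9 ^ n) powr hdim = 21 ^ n" "(1 / 9 ^ n) powr hdim = 1 / 21 ^ n"
proof -
  have "9 powr hdim = 21" by (simp add: hdim_def powr_def)
  then show *: "(9 ^ n) powr hdim = 21 ^ n"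
    by (simp add: powr_power[symmetric] powr_realpow[symmetric] powr_powr mult.commute
        flip: powr_powr[of 9 _ "real n"])
  show "(1 / 9 ^ n) powr hdim = 1 / 21 ^ n"
    by (simp add: powr_divide *)
qed

context eyebolted_cross
begin

definition meeting :: "nat \<Rightarrow> (real \<times> real) set \<Rightarrow> (int \<times> int) set" where
  "meeting n T = {c \<in> cs n. cell n c \<inter> T \<noteq> {}}"

lemma finite_meeting [simp]: "finite (meeting n T)" by (simp add: meeting_def)

lemma card_meeting_small:
  assumes "\<And>x y. x \<in> T \<Longrightarrow> y \<in> T \<Longrightarrow> dist x y < 1 / 9 ^ n"
  shows "card (meeting n T) \<le> 16"
proof (cases "T = {}")
  case False
  then obtain z where z: "z \<in> T" by blast
  let ?f = "\<lfloor>9 ^ n * fst z\<rfloor>" and ?g = "\<lfloor>9 ^ n * snd z\<rfloor>"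
  have "meeting n T \<subseteq> {?f - 1..?f + 2} \<times> {?g - 1..?g + 2}"
  proof
    fix c assume "c \<in> meeting n T"
    then obtain y where y: "y \<in> cell n c" "y \<in> T" by (auto simp: meeting_def)
    have "\<bar>fst y - fst z\<bar> < 1 / 9 ^ n" "\<bar>snd y - snd z\<bar> < 1 / 9 ^ n"
      using assms[OF y(2) z] coordinates_le_dist[of y z] by linarith+
    then have "9 ^ n * \<bar>fst y - fst z\<bar> < 1" "9 ^ n * \<bar>snd y - snd z\<bar> < 1"
      by (simp_all add: field_simps)
    then have "\<bar>9 ^ n * fst y - 9 ^ n * fst z\<bar> < 1" "\<bar>9 ^ n * snd y - 9 ^ n * snd z\<bar> < 1"
      by (simp_all add: right_diff_distrib[symmetric] abs_mult)
    then have "\<bar>of_int (fst c) - 9 ^ n * fst z\<bar> < 3 / 2" "\<bar>of_int (snd c) - 9 ^ n * snd z\<bar> < 3 / 2"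
      using cell_square[OF y(1)] by linarith+
    then have "fst c \<in> {?f - 1..?f + 2}" "snd c \<in> {?g - 1..?g + 2}"
      unfolding atLeastAtMost_iff by linarith+
    then show "c \<in> {?f - 1..?f + 2} \<times> {?g - 1..?g + 2}" by (simp add: mem_Times_iff)
  qed
  then have "card (meeting n T) \<le> card ({?f - 1..?f + 2} \<times> {?g - 1..?g + 2})" by (intro card_mono) auto
  then show ?thesis by (simp add: card_cartesian_product)
qed (simp add: meeting_def)

lemma card_meeting_deeper: "card (meeting (n + k) T) \<le> 21 ^ k * card (meeting n T)"
proof (induction k)
  case (Suc k)
  have "meeting (Suc (n + k)) T \<subseteq> (\<lambda>(c, i). child c i) ` (meeting (n + k) T \<times> D)"
  proof
    fix c assume "c \<in> meeting (Suc (n + k)) T"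
    then have c: "c \<in> cs (Suc (n + k))" "cell (Suc (n + k)) c \<inter> T \<noteq> {}" by (simp_all add: meeting_def del: cells.simps)
    obtain a i where a: "a \<in> cs (n + k)" "i \<in> D" "c = child a i" using c(1) by (elim cs_SucE)
    then have "a \<in> meeting (n + k) T" using c(2) cell_child_subset unfolding meeting_def by blast
    then show "c \<in> (\<lambda>(c, i). child c i) ` (meeting (n + k) T \<times> D)"
      using a by (intro image_eqI[of _ _ "(a, i)"]) auto
  qed
  then have "card (meeting (Suc (n + k)) T) \<le> card ((\<lambda>(c, i). child c i) ` (meeting (n + k) T \<times> D))"
    by (intro card_mono) auto
  also have "\<dots> \<le> card (meeting (n + k) T \<times> D)" by (intro card_image_le) auto
  also have "\<dots> = 21 * card (meeting (n + k) T)" by (simp add: card_cartesian_product card_D)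
  finally show ?case using Suc by simp
qed simp

text \<open>At the level \<open>n\<close> whose side is just above \<open>d\<close> the set meets at
  most 16 cells. Each has \<open>21 ^ (N - n)\<close> descendants of level \<open>N\<close>,
  and \<open>21 ^ (- n)\<close> is comparable to \<open>d powr hdim\<close>.\<close>

lemma card_meeting_le_powr:
  assumes "\<And>x y. x \<in> T \<Longrightarrow> y \<in> T \<Longrightarrow> dist x y \<le> d" and "0 < d" "d < 1"
  shows "\<exists>n. \<forall>N\<ge>n. real (card (meeting N T)) \<le> 336 * 21 ^ N * d powr hdim"
proof -
  obtain m where "(1 / 9) ^ m < d" using real_arch_pow_inv[of d "1/9"] assms by auto
  then have ex: "1 / 9 ^ m \<le> d" by (simp add: power_divide)
  define M where "M = (LEAST m. 1 / 9 ^ m \<le> d)"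
  have M: "1 / 9 ^ M \<le> d" unfolding M_def using ex by (rule LeastI)
  have "M \<noteq> 0" using M assms(3) by (intro notI) simp
  then obtain n where n: "M = Suc n" using not0_implies_Suc by blast
  have "\<not> 1 / 9 ^ n \<le> d" using not_less_Least[of n "\<lambda>m. 1 / 9 ^ m \<le> d"] n M_def by simp
  then have "card (meeting n T) \<le> 16" using assms(1) by (intro card_meeting_small) (metis not_le order_le_less_trans)
  have "1 / 21 ^ M \<le> d powr hdim"
    unfolding nine_powr_hdim(2)[symmetric] using M hdim_pos by (intro powr_mono2) auto
  then have *: "1 \<le> 21 * 21 ^ n * d powr hdim" by (simp add: n field_simps)
  show ?thesis
  proof (intro exI allI impI)
    fix N assume "n \<le> N"
    then obtain k where k: "N = n + k" using le_Suc_ex by blast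
    have "card (meeting N T) \<le> 21 ^ k * 16"
      using card_meeting_deeper[of n k T] \<open>card (meeting n T) \<le> 16\<close> unfolding k
      by (meson le_trans mult_le_mono2)
    then have "real (card (meeting N T)) \<le> real (21 ^ k * 16)" by (rule of_nat_mono)
    also have "\<dots> \<le> (16 * 21 ^ k) * (21 * 21 ^ n * d powr hdim)"
      using mult_left_mono[OF *, of "16 * 21 ^ k"] by simp
    also have "\<dots> = 336 * 21 ^ N * d powr hdim" by (simp add: k power_add)
    finally show "real (card (meeting N T)) \<le> 336 * 21 ^ N * d powr hdim" .
  qed
qed

text \<open>A cover by small sets may be taken open and finite. Its members then meet at most
  \<open>336 * 21 ^ N * d powr hdim\<close> cells of a deep level \<open>N\<close>, and together they must meet all of the
  \<open>21 ^ N\<close> cells.\<close>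

lemma hausdorff_K_pos: "0 < hausdorff_outer_measure hdim K"
proof -
  \<comment> \<open>Half of \<open>1 / 336\<close>: the other half pays for enlarging the sets of the cover to open sets.\<close>
  have "ennreal (1 / 672) \<le> hausdorff_pre_measure hdim (1 / 2) K"
  proof (rule le_hausdorff_pre_measure)
    fix C :: "nat \<Rightarrow> (real \<times> real) set"
    assume C: "K \<subseteq> (\<Union>i. C i)" "\<And>i. bounded (C i)" "\<And>i. diameter (C i) \<le> 1 / 2"
    have D0: "0 \<le> diameter (C i)" for i using diameter_ge_0[OF C(2)] .
    have "\<exists>\<eta>>0. \<eta> < 1 / 8 \<and> (diameter (C i) + 2 * \<eta>) powr hdim \<le> diameter (C i) powr hdim + 1 / 672 * (1/2) ^ Suc i" for i
    proof -
      have "((\<lambda>t. (diameter (C i) + 2 * t) powr hdim) \<longlongrightarrow> (diameter (C i) + 2 * 0) powr hdim) (at_right 0)"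
        using hdim_pos D0[of i] by (intro tendsto_powr2 tendsto_intros) (auto simp: eventually_at_right_less intro!: eventually_at_rightI[of 0 1])
      then have "\<forall>\<^sub>F t in at_right 0. (diameter (C i) + 2 * t) powr hdim < diameter (C i) powr hdim + 1 / 672 * (1/2) ^ Suc i"
        by (rule order_tendstoD) simp
      moreover have "\<forall>\<^sub>F t in at_right (0::real). t < 1 / 8" by (rule eventually_at_rightI[of 0 "1/8"]) auto
      moreover have "\<forall>\<^sub>F t in at_right (0::real). 0 < t" by (rule eventually_at_right_less)
      ultimately have "\<forall>\<^sub>F t in at_right (0::real). 0 < t \<and> t < 1 / 8 \<and>
          (diameter (C i) + 2 * t) powr hdim < diameter (C i) powr hdim + 1 / 672 * (1/2) ^ Suc i"
        by eventually_elim auto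
      then show ?thesis using eventually_happens'[OF trivial_limit_at_right_real] by (blast intro: less_imp_le)
    qed
    then obtain \<eta> where \<eta>: "\<And>i. 0 < \<eta> i" "\<And>i. \<eta> i < 1 / 8"
      "\<And>i. (diameter (C i) + 2 * \<eta> i) powr hdim \<le> diameter (C i) powr hdim + 1 / 672 * (1/2) ^ Suc i" by metis
    define T where "T i = (\<Union>y\<in>C i. ball y (\<eta> i))" for i
    define d where "d i = diameter (C i) + 2 * \<eta> i" for i
    have T: "dist x y \<le> d i" if xy: "x \<in> T i" "y \<in> T i" for i x y
    proof -
      obtain x' y' where *: "x' \<in> C i" "y' \<in> C i" "dist x' x < \<eta> i" "dist y' y < \<eta> i"
        using xy by (auto simp: T_def)
      have "dist x y \<le> dist x' x + dist x' y' + dist y' y"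
        using dist_triangle[of x y x'] dist_triangle[of x' y y'] by (simp add: dist_commute)
      then show ?thesis using * diameter_bounded_bound[OF C(2) *(1,2)] by (simp add: d_def)
    qed
    have d: "0 < d i" "d i < 1" for i using D0[of i] \<eta>(1,2)[of i] C(3)[of i] by (simp_all add: d_def)
    have "\<exists>n. \<forall>N\<ge>n. real (card (meeting N (T i))) \<le> 336 * 21 ^ N * d i powr hdim" for i
      using T d by (intro card_meeting_le_powr)
    then obtain n where n: "\<And>i N. n i \<le> N \<Longrightarrow> real (card (meeting N (T i))) \<le> 336 * 21 ^ N * d i powr hdim"
      by metis
    have "open (T i)" for i by (auto simp: T_def)
    moreover have KT: "K \<subseteq> (\<Union>i\<in>UNIV. T i)" 
    proof
      fix x assume "x \<in> K"
      then obtain i where "x \<in> C i" using C(1) by blast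
      then have "x \<in> T i" using \<eta>(1)[of i] centre_in_ball[of x "\<eta> i"] unfolding T_def by blast
      then show "x \<in> (\<Union>i\<in>UNIV. T i)" by blast
    qed
    ultimately obtain I where I: "finite I" "K \<subseteq> (\<Union>i\<in>I. T i)"
      using compactE_image[OF K_props(2), of UNIV T] by metis
    define N where "N = Max (insert 0 (n ` I))"
    have nN: "n i \<le> N" if "i \<in> I" for i using that I(1) by (simp add: N_def)
    have "cs N \<subseteq> (\<Union>i\<in>I. meeting N (T i))"
    proof
      fix c assume c: "c \<in> cs N"
      obtain x where "x \<in> cell N c" using cell_nonempty by blast
      moreover from this obtain i where "i \<in> I" "x \<in> T i" using cell_subset_K[OF c] I(2) by blast
      ultimately show "c \<in> (\<Union>i\<in>I. meeting N (T i))" using c by (auto simp: meeting_def)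
    qed
    then have "card (cs N) \<le> card (\<Union>i\<in>I. meeting N (T i))" using I(1) by (intro card_mono) auto
    also have "\<dots> \<le> (\<Sum>i\<in>I. card (meeting N (T i)))" by (rule card_UN_le[OF I(1)])
    finally have "real (21 ^ N) \<le> real (\<Sum>i\<in>I. card (meeting N (T i)))"
      unfolding card_cs by (rule of_nat_mono)
    also have "\<dots> \<le> (\<Sum>i\<in>I. 336 * 21 ^ N * d i powr hdim)"
      unfolding of_nat_sum using n nN by (intro sum_mono) auto
    also have "\<dots> = 336 * 21 ^ N * (\<Sum>i\<in>I. d i powr hdim)" by (simp add: sum_distrib_left)
    finally have "1 / 336 \<le> (\<Sum>i\<in>I. d i powr hdim)" by (simp add: field_simps)
    also have "\<dots> \<le> (\<Sum>i\<in>I. diameter (C i) powr hdim + 1 / 672 * (1/2) ^ Suc i)"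
      using \<eta>(3) by (intro sum_mono) (simp add: d_def)
    also have "\<dots> = (\<Sum>i\<in>I. diameter (C i) powr hdim) + 1 / 672 * (\<Sum>i\<in>I. (1/2) ^ Suc i)"
      by (simp only: sum.distrib sum_distrib_left)
    also have "(\<Sum>i\<in>I. (1/2::real) ^ Suc i) \<le> 1"
      using sum_le_suminf[of "\<lambda>i. (1/2::real) ^ Suc i" I] power_half_series I(1)
      by (simp add: sums_iff)
    finally have "1 / 672 \<le> (\<Sum>i\<in>I. diameter (C i) powr hdim)" by simp
    then have "ennreal (1 / 672) \<le> ennreal (\<Sum>i\<in>I. diameter (C i) powr hdim)" by (rule ennreal_leI)
    also have "\<dots> = (\<Sum>i\<in>I. ennreal (diameter (C i) powr hdim))" by (intro sum_ennreal[symmetric]) auto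
    also have "\<dots> \<le> (\<Sum>i. ennreal (diameter (C i) powr hdim))" using I(1) by (intro sum_le_suminf) auto
    finally show "ennreal (1 / 672) \<le> (\<Sum>i. ennreal (diameter (C i) powr hdim))" .
  qed
  also have "\<dots> \<le> hausdorff_outer_measure hdim K" by (rule hausdorff_pre_le_outer) simp
  finally show ?thesis by (auto intro: order_less_le_trans[of _ "ennreal (1 / 672)"])
qed

lemma hausdorff_K_finite: "hausdorff_outer_measure hdim K < \<infinity>"
proof -
  have "hausdorff_pre_measure hdim \<delta> K \<le> ennreal (2 powr hdim)" if "0 < \<delta>" for \<delta>
  proof -
    have "\<exists>n. (1 / 9) ^ n < \<delta> / 2" using that by (intro real_arch_pow_inv) auto
    then obtain n where "(1 / 9) ^ n < \<delta> / 2" by blast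
    then have n: "2 / 9 ^ n \<le> \<delta>" by (simp add: power_divide field_simps)
    obtain f where f: "bij_betw f {..<(21::nat) ^ n} (cs n)"
      using ex_bij_betw_nat_finite[OF finite_cs[of n]] by (auto simp: card_cs atLeast0LessThan)
    define C where "C i = (if i < 21 ^ n then cell n (f i) else {})" for i
    have dC: "diameter (C i) \<le> 2 / 9 ^ n" "bounded (C i)" for i
    proof -
      show "bounded (C i)" using compact_imp_bounded[OF cell_compact] by (simp add: C_def)
      have "diameter (cell n c) \<le> 2 / 9 ^ n" for c
        using cell_diameter[of _ n c] by (intro diameter_le) (auto simp: dist_norm)
      then show "diameter (C i) \<le> 2 / 9 ^ n" by (simp add: C_def)
    qed
    have "K \<subseteq> (\<Union>i. C i)"
    proof
      fix x assume "x \<in> K"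
      then obtain c where c: "c \<in> cs n" "x \<in> cell n c" by (elim K_cellE)
      then have "c \<in> f ` {..<21 ^ n}" using bij_betw_imp_surj_on[OF f] by simp
      then obtain i where "i < 21 ^ n" "c = f i" by blast
      then have "x \<in> C i" using c by (simp add: C_def)
      then show "x \<in> (\<Union>i. C i)" by blast
    qed
    then have "hausdorff_pre_measure hdim \<delta> K \<le> (\<Sum>i. ennreal (diameter (C i) powr hdim))"
      using dC n by (intro hausdorff_pre_measure_le) (auto intro: order_trans)
    also have "\<dots> = (\<Sum>i<21 ^ n. ennreal (diameter (C i) powr hdim))"
      by (intro suminf_finite) (auto simp: C_def)
    also have "\<dots> \<le> (\<Sum>i<(21::nat) ^ n. ennreal (2 powr hdim / 21 ^ n))"
    proof (intro sum_mono ennreal_leI)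
      fix i
      have "diameter (C i) powr hdim \<le> (2 / 9 ^ n) powr hdim"
        using dC hdim_pos diameter_ge_0[OF dC(2)] by (intro powr_mono2) auto
      then show "diameter (C i) powr hdim \<le> 2 powr hdim / 21 ^ n"
        by (simp add: powr_divide nine_powr_hdim)
    qed
    also have "\<dots> = ennreal (2 powr hdim)"
      by (simp add: ennreal_of_nat_eq_real_of_nat ennreal_mult[symmetric])
    finally show ?thesis .
  qed
  then have "hausdorff_outer_measure hdim K \<le> ennreal (2 powr hdim)" by (rule hausdorff_outer_leI)
  then show ?thesis using order_le_less_trans by fastforce
qed

definition \<mu> :: "(real \<times> real) measure" where "\<mu> = normalized_hausdorff hdim K"

lemma space_\<mu> [simp]: "space \<mu> = K"
  by (simp add: \<mu>_def normalized_hausdorff_def space_restrict_space)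

lemma sets_\<mu>: "sets \<mu> = sets (restrict_space borel K)"
  by (simp add: \<mu>_def normalized_hausdorff_def cong: sets_restrict_space_cong)

lemma K_borel [measurable]: "K \<in> sets borel"
  by (rule borel_closed[OF K_closed])

lemma in_sets_\<mu>: "A \<in> sets \<mu> \<longleftrightarrow> A \<subseteq> K \<and> A \<in> sets borel"
  unfolding sets_\<mu> using sets_restrict_space_iff[of K borel A] K_borel by auto

lemma measurable_\<mu> [measurable (raw)]: "f \<in> borel \<rightarrow>\<^sub>M N \<Longrightarrow> f \<in> \<mu> \<rightarrow>\<^sub>M N"
  using measurable_restrict_space1[of f borel N K] measurable_cong_sets[OF sets_\<mu> refl] by blast

lemma emeasure_\<mu>:
  assumes "A \<subseteq> K" "A \<in> sets borel"
  shows "emeasure \<mu> A = hausdorff_outer_measure hdim A / hausdorff_outer_measure hdim K"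
proof -
  let ?R = "restrict_space (hausdorff_measure hdim) K"
  have s: "B \<in> sets ?R" if "B \<subseteq> K" "B \<in> sets borel" for B
    using that by (subst sets_restrict_space_iff) auto
  have "emeasure ?R B = hausdorff_outer_measure hdim B" if "B \<subseteq> K" "B \<in> sets borel" for B
    using that by (subst emeasure_restrict_space) (auto simp: emeasure_hausdorff_measure)
  moreover have "emeasure \<mu> A = emeasure ?R (K \<inter> A) / emeasure ?R K"
    unfolding \<mu>_def normalized_hausdorff_def using s assms by (intro emeasure_uniform_measure) auto
  moreover have "K \<inter> A = A" using assms by blast
  ultimately show ?thesis using assms by simp
qed

lemma emeasure_\<mu>_K: "emeasure \<mu> K = 1"
  using hausdorff_K_pos hausdorff_K_finite by (simp add: emeasure_\<mu> ennreal_divide_self)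

lemma cell_borel [measurable]: "cell n c \<in> sets borel"
  by (rule borel_compact[OF cell_compact])

lemma cell_in_sets: "c \<in> cs n \<Longrightarrow> cell n c \<in> sets \<mu>"
  using cell_subset_K by (simp add: in_sets_\<mu> cell_borel)

lemma emeasure_cell:
  assumes "c \<in> cs n" shows "emeasure \<mu> (cell n c) = ennreal (1 / 21 ^ n)"
proof -
  let ?H = "hausdorff_outer_measure hdim"
  have "?H (cell n c) = ennreal ((1 / 9 ^ n) powr hdim) * ?H K"
    unfolding cell_def
  proof (rule hausdorff_outer_similarity[where g = "\<lambda>y. 9 ^ n *\<^sub>R y - embed c"])
    show "dist (place n c x) (place n c y) = 1 / 9 ^ n * dist x y" for x y by (rule dist_place)
  qed (auto simp: place_def hdim_pos)
  then have "emeasure \<mu> (cell n c) = ennreal (1 / 21 ^ n) * ?H K / ?H K"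
    using assms cell_in_sets[OF assms] by (simp add: emeasure_\<mu> in_sets_\<mu> nine_powr_hdim)
  then show ?thesis using hausdorff_K_pos hausdorff_K_finite
    by (simp add: ennreal_mult_divide_eq)
qed

sublocale \<mu>: finite_measure \<mu>
  by (rule finite_measureI) (simp add: emeasure_\<mu>_K)

lemma measure_\<mu>_K: "measure \<mu> K = 1"
  using emeasure_\<mu>_K by (simp add: measure_def)

lemma measure_cell: "c \<in> cs n \<Longrightarrow> measure \<mu> (cell n c) = 1 / 21 ^ n"
  using emeasure_cell by (simp add: measure_def)

lemma null_point: assumes "x \<in> K" shows "emeasure \<mu> {x} = 0"
proof -
  have le: "emeasure \<mu> {x} \<le> ennreal ((1 / 21) ^ n)" for n
  proof -
    obtain c where c: "c \<in> cs n" "x \<in> cell n c" using assms by (elim K_cellE)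
    then have "emeasure \<mu> {x} \<le> emeasure \<mu> (cell n c)" by (intro emeasure_mono cell_in_sets) auto
    then show ?thesis using emeasure_cell[OF c(1)] by (simp add: power_divide)
  qed
  have "(\<lambda>n. ennreal ((1 / 21) ^ n)) \<longlonglongrightarrow> ennreal 0"
    by (intro tendsto_ennrealI LIMSEQ_power_zero) auto
  then have "emeasure \<mu> {x} \<le> 0" using le LIMSEQ_le_const by (metis ennreal_0)
  then show ?thesis by simp
qed

text \<open>Almost every point has a unique cell at each level: two cells of one level share at most
  a corner, there are countably many corners, and points are null sets.\<close>

lemma AE_unique_cell: "AE x in \<mu>. \<forall>n. \<exists>!c. c \<in> cs n \<and> x \<in> cell n c"
proof -
  define Z where "Z = (\<Union>n. \<Union>c\<in>cs n. \<Union>e\<in>corners. {vertex n c e})"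
  have fc: "finite corners" by (simp add: corners_def main_ends_def anti_ends_def)
  have "Z \<in> null_sets \<mu>"
    unfolding Z_def
  proof (intro null_sets_UN' countable_finite[OF finite_cs] countable_finite[OF fc])
    fix n c e assume "c \<in> cs n" "e \<in> corners"
    then have "vertex n c e \<in> K" by (intro vertex_in_K') auto
    then show "{vertex n c e} \<in> null_sets \<mu>" using null_point by (auto simp: in_sets_\<mu> null_sets_def)
  qed auto
  then have "AE x in \<mu>. x \<notin> Z" by (rule AE_not_in)
  then show ?thesis
  proof (rule AE_mp[OF _ AE_I2], intro impI allI)
    fix x n assume x: "x \<in> space \<mu>" "x \<notin> Z"
    then obtain c where c: "c \<in> cs n" "x \<in> cell n c" using K_cellE[of x n] unfolding space_\<mu> by metis
    show "\<exists>!c. c \<in> cs n \<and> x \<in> cell n c"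
    proof (intro ex1I[of _ c] conjI c)
      fix c' assume c': "c' \<in> cs n \<and> x \<in> cell n c'"
      show "c' = c"
      proof (rule ccontr)
        assume "c' \<noteq> c"
        then have "c' - c \<in> corners" "x = vertex n c (c' - c)"
          using cells_meet_in_vertex[of c n c' x] c c' by auto
        then show False using x(2) c(1) by (auto simp: Z_def)
      qed
    qed
  qed
qed

text \<open>Any cell of level \<open>n\<close> that contains the point will do. The choices at different
  levels are independent, so a chosen cell need not contain the next one.\<close>

definition code :: "nat \<Rightarrow> real \<times> real \<Rightarrow> int \<times> int" where
  "code n x = (SOME c. c \<in> cs n \<and> x \<in> cell n c)"

lemma code: assumes "x \<in> K" shows "code n x \<in> cs n" "x \<in> cell n (code n x)"
proof -
  have "\<exists>c. c \<in> cs n \<and> x \<in> cell n c" using K_cells[of n] assms by blast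
  then show "code n x \<in> cs n" "x \<in> cell n (code n x)" unfolding code_def by (metis (mono_tags, lifting) someI_ex)+
qed

end

section \<open>Averages of functions of finite energy\<close>

lemma geometric_steps_converge:
  fixes a :: "nat \<Rightarrow> real"
  assumes step: "\<And>n. N \<le> n \<Longrightarrow> \<bar>a (Suc n) - a n\<bar> \<le> M * s ^ n" and s: "0 \<le> s" "s \<le> 1 / 3" and "0 \<le> M"
  shows "\<exists>l. a \<longlonglongrightarrow> l \<and> (\<forall>n\<ge>N. \<bar>l - a n\<bar> \<le> 3 / 2 * M * s ^ n)"
proof -
  have b: "\<bar>a (n + k) - a n\<bar> \<le> 3 / 2 * M * (s ^ n - s ^ (n + k))" if "N \<le> n" for n k
  proof (induction k)
    case (Suc k)
    have "M * s ^ (n + k) \<le> 3 / 2 * M * (s ^ (n + k) - s ^ (n + Suc k))"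
    proof -
      have "2 / 3 * s ^ (n + k) \<le> (1 - s) * s ^ (n + k)" using s by (intro mult_right_mono) auto
      then have "s ^ (n + k) \<le> 3 / 2 * (s ^ (n + k) - s ^ (n + Suc k))" by (simp add: algebra_simps)
      from mult_left_mono[OF this \<open>0 \<le> M\<close>] show ?thesis by (simp add: mult_ac)
    qed
    moreover have "\<bar>a (Suc (n + k)) - a (n + k)\<bar> \<le> M * s ^ (n + k)" using that by (intro step) simp
    ultimately have "\<bar>a (n + Suc k) - a n\<bar>
        \<le> 3 / 2 * M * (s ^ (n + k) - s ^ (n + Suc k)) + 3 / 2 * M * (s ^ n - s ^ (n + k))"
      using Suc unfolding add_Suc_right by linarith
    also have "\<dots> = 3 / 2 * M * (s ^ n - s ^ (n + Suc k))" by (simp add: field_simps)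
    finally show ?case .
  qed simp
  have b': "\<bar>a m - a n\<bar> \<le> 3 / 2 * M * s ^ n" if "N \<le> n" "n \<le> m" for m n
  proof -
    obtain k where k: "m = n + k" using \<open>n \<le> m\<close> le_Suc_ex by blast
    have "0 \<le> 3 / 2 * M * s ^ (n + k)" using s \<open>0 \<le> M\<close> by simp
    then show ?thesis using b[OF that(1), of k] unfolding k right_diff_distrib by linarith
  qed
  have z: "(\<lambda>n. 3 / 2 * M * s ^ n) \<longlonglongrightarrow> 3 / 2 * M * 0"
    using s by (intro tendsto_mult_left LIMSEQ_power_zero) auto
  have "Cauchy a"
  proof (rule CauchyI')
    fix e :: real assume "0 < e"
    then have "\<forall>\<^sub>F n in sequentially. 3 / 2 * M * s ^ n < e" using order_tendstoD(2)[OF z] by simp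
    then obtain n0 where n0: "\<And>n. n0 \<le> n \<Longrightarrow> 3 / 2 * M * s ^ n < e" unfolding eventually_sequentially by blast
    have "norm (a m - a n) < e" if "max n0 N \<le> m" "m < n" for m n
    proof -
      have "\<bar>a n - a m\<bar> \<le> 3 / 2 * M * s ^ m" using that by (intro b') auto
      moreover have "3 / 2 * M * s ^ m < e" using that by (intro n0) simp
      ultimately show ?thesis unfolding real_norm_def by linarith
    qed
    then have "\<forall>m\<ge>max n0 N. \<forall>n>m. norm (a m - a n) < e" by blast
    then show "\<exists>M. \<forall>m\<ge>M. \<forall>n>m. dist (a m) (a n) < e" unfolding dist_norm by blast
  qed
  then obtain l where l: "a \<longlonglongrightarrow> l" using Cauchy_convergent_iff convergent_def by blast
  have "\<bar>l - a n\<bar> \<le> 3 / 2 * M * s ^ n" if "N \<le> n" for n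
  proof (rule LIMSEQ_le_const2)
    show "(\<lambda>m. \<bar>a m - a n\<bar>) \<longlonglongrightarrow> \<bar>l - a n\<bar>" using l by (intro tendsto_intros)
    show "\<exists>N. \<forall>m\<ge>N. \<bar>a m - a n\<bar> \<le> 3 / 2 * M * s ^ n" using b'[OF that] by blast
  qed
  then show ?thesis using l by blast
qed

lemma (in finite_measure) square_integrable_imp_integrable:
  fixes u :: "'a \<Rightarrow> real"
  assumes "u \<in> borel_measurable M" "integrable M (\<lambda>x. (u x)\<^sup>2)"
  shows "integrable M u"
proof (rule Bochner_Integration.integrable_bound[of M "\<lambda>x. (u x)\<^sup>2 + 1"])
  show "integrable M (\<lambda>x. (u x)\<^sup>2 + 1)" using assms by simp
  have "\<bar>t\<bar> \<le> t\<^sup>2 + 1" for t :: real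
  proof -
    have "0 \<le> (\<bar>t\<bar> - 1)\<^sup>2" "0 \<le> \<bar>t\<bar>" by simp_all
    then show ?thesis by (simp add: power2_eq_square algebra_simps)
  qed
  then show "AE x in M. norm (u x) \<le> norm ((u x)\<^sup>2 + 1)" by simp
qed (use assms in simp)

lemma square_sum_le: "(a + b)\<^sup>2 \<le> 2 * a\<^sup>2 + 2 * b\<^sup>2" for a b :: real
proof -
  have "0 \<le> (a - b)\<^sup>2" by simp
  then show ?thesis by (simp add: power2_eq_square algebra_simps)
qed

definition ball_energy :: "'a::metric_space measure \<Rightarrow> ('a \<Rightarrow> real) \<Rightarrow> real \<Rightarrow> ennreal" where
  "ball_energy M u r = (\<integral>\<^sup>+x. (\<integral>\<^sup>+y\<in>ball x r. ennreal (\<bar>u x - u y\<bar>\<^sup>2) \<partial>M) \<partial>M)"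

definition set_energy :: "'a measure \<Rightarrow> ('a \<Rightarrow> real) \<Rightarrow> 'a set \<Rightarrow> 'a set \<Rightarrow> ennreal" where
  "set_energy M u A B = (\<integral>\<^sup>+x. (\<integral>\<^sup>+y. ennreal ((u x - u y)\<^sup>2) * indicator B y \<partial>M) * indicator A x \<partial>M)"

definition average :: "'a measure \<Rightarrow> ('a \<Rightarrow> real) \<Rightarrow> 'a set \<Rightarrow> real" where
  "average M u A = (\<integral>x. indicator A x * u x \<partial>M) / measure M A"

context finite_measure
begin

text \<open>The function \<open>(t - k)\<^sup>2\<close> lies above its tangent at the average.\<close>

lemma average_deviation_le:
  fixes u :: "'a \<Rightarrow> real"
  assumes [measurable]: "u \<in> borel_measurable M" "A \<in> sets M" and int: "integrable M u"
    and pos: "0 < measure M A"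
  shows "ennreal (measure M A * (average M u A - k)\<^sup>2) \<le> (\<integral>\<^sup>+x. ennreal ((u x - k)\<^sup>2) * indicator A x \<partial>M)"
proof (cases "(\<integral>\<^sup>+x. ennreal ((u x - k)\<^sup>2) * indicator A x \<partial>M) = \<infinity>")
  case False
  let ?m = "average M u A"
  have nn: "(\<integral>\<^sup>+x. ennreal ((u x - k)\<^sup>2) * indicator A x \<partial>M) = (\<integral>\<^sup>+x. ennreal (indicator A x * (u x - k)\<^sup>2) \<partial>M)"
    by (intro nn_integral_cong) (auto split: split_indicator)
  have i2: "integrable M (\<lambda>x. indicator A x * (u x - k)\<^sup>2)"
    using False nn by (intro integrableI_nonneg) (auto simp: less_top)
  have i1: "integrable M (\<lambda>x. indicator A x * u x)"
    using integrable_mult_indicator[OF assms(2) int] by simp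
  have i0: "integrable M (\<lambda>x. indicator A x :: real)" by (simp add: emeasure_eq_measure)
  have mean: "(\<integral>x. indicator A x * u x \<partial>M) = ?m * measure M A" using pos by (simp add: average_def)
  have lin: "(\<integral>x. p * indicator A x + r * (indicator A x * u x) \<partial>M) = p * measure M A + r * (?m * measure M A)" for p r
    using i1 i0 by (simp add: mean)
  have "measure M A * (?m - k)\<^sup>2 = (\<integral>x. ((?m - k)\<^sup>2 - 2 * (?m - k) * ?m) * indicator A x + 2 * (?m - k) * (indicator A x * u x) \<partial>M)"
    unfolding lin by (simp add: algebra_simps)
  also have "\<dots> \<le> (\<integral>x. indicator A x * (u x - k)\<^sup>2 \<partial>M)"
  proof (intro integral_mono i2 Bochner_Integration.integrable_add integrable_mult_right i1 i0)
    fix x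
    have "0 \<le> (u x - ?m)\<^sup>2" by simp
    then have "((?m - k)\<^sup>2 - 2 * (?m - k) * ?m) + 2 * (?m - k) * u x \<le> (u x - k)\<^sup>2"
      by (simp add: power2_eq_square algebra_simps)
    then show "((?m - k)\<^sup>2 - 2 * (?m - k) * ?m) * indicator A x + 2 * (?m - k) * (indicator A x * u x)
        \<le> indicator A x * (u x - k)\<^sup>2"
      by (auto split: split_indicator)
  qed
  finally show ?thesis
    unfolding nn using nn_integral_eq_integral[OF i2] by (simp add: ennreal_leI)
qed simp

lemma average_difference_le:
  fixes u :: "'a \<Rightarrow> real"
  assumes [measurable]: "u \<in> borel_measurable M" "A \<in> sets M" "B \<in> sets M" and int: "integrable M u"
    and pos: "0 < measure M A" "0 < measure M B"
  shows "ennreal (measure M A * measure M B * (average M u A - average M u B)\<^sup>2) \<le> set_energy M u A B"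
proof -
  have "ennreal (measure M A * measure M B * (average M u A - average M u B)\<^sup>2)
      = ennreal (measure M B) * ennreal (measure M A * (average M u A - average M u B)\<^sup>2)"
    by (simp add: ennreal_mult[symmetric] mult_ac)
  also have "\<dots> \<le> ennreal (measure M B) * (\<integral>\<^sup>+x. ennreal ((u x - average M u B)\<^sup>2) * indicator A x \<partial>M)"
    by (intro mult_left_mono average_deviation_le int pos) auto
  also have "\<dots> = (\<integral>\<^sup>+x. ennreal (measure M B * (average M u B - u x)\<^sup>2) * indicator A x \<partial>M)"
    by (simp add: nn_integral_cmult[symmetric] ennreal_mult mult.assoc power2_commute)
  also have "\<dots> \<le> set_energy M u A B"
    unfolding set_energy_def
  proof (intro nn_integral_mono mult_right_mono)
    fix x
    show "ennreal (measure M B * (average M u B - u x)\<^sup>2) \<le> (\<integral>\<^sup>+y. ennreal ((u x - u y)\<^sup>2) * indicator B y \<partial>M)"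
      using average_deviation_le[OF assms(1,3) int pos(2), of "u x"] by (simp add: power2_commute)
  qed simp
  finally show ?thesis .
qed

lemma deviation_from_average_le:
  fixes u :: "'a \<Rightarrow> real"
  assumes [measurable]: "u \<in> borel_measurable M" "A \<in> sets M" and int: "integrable M u"
    and pos: "0 < measure M A"
  shows "ennreal (measure M A) * (\<integral>\<^sup>+x. ennreal ((u x - average M u A)\<^sup>2) * indicator A x \<partial>M) \<le> set_energy M u A A"
proof -
  have "ennreal (measure M A) * (\<integral>\<^sup>+x. ennreal ((u x - average M u A)\<^sup>2) * indicator A x \<partial>M)
      = (\<integral>\<^sup>+x. ennreal (measure M A * (average M u A - u x)\<^sup>2) * indicator A x \<partial>M)"
    by (simp add: nn_integral_cmult[symmetric] ennreal_mult mult.assoc power2_commute)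
  also have "\<dots> \<le> set_energy M u A A"
    unfolding set_energy_def
  proof (intro nn_integral_mono mult_right_mono)
    fix x
    show "ennreal (measure M A * (average M u A - u x)\<^sup>2) \<le> (\<integral>\<^sup>+y. ennreal ((u x - u y)\<^sup>2) * indicator A y \<partial>M)"
      using average_deviation_le[OF assms(1,2) int pos, of "u x"] by (simp add: power2_commute)
  qed simp
  finally show ?thesis .
qed

end

lemma set_energy_le_ball_energy:
  assumes "\<And>x y. x \<in> A \<Longrightarrow> y \<in> B \<Longrightarrow> dist x y < r"
  shows "set_energy M u A B \<le> ball_energy M u r"
  unfolding set_energy_def ball_energy_def
proof (intro nn_integral_mono)
  fix x
  show "(\<integral>\<^sup>+y. ennreal ((u x - u y)\<^sup>2) * indicator B y \<partial>M) * indicator A x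
      \<le> (\<integral>\<^sup>+y\<in>ball x r. ennreal (\<bar>u x - u y\<bar>\<^sup>2) \<partial>M)"
  proof (cases "x \<in> A")
    case True
    then show ?thesis using assms
      by (auto intro!: nn_integral_mono split: split_indicator)
  qed simp
qed

context eyebolted_cross
begin

text \<open>Cells of one level overlap in null sets, so the energies of different cells are integrals
  over essentially disjoint sets of pairs.\<close>

lemma sum_set_energy_le_ball_energy:
  assumes [measurable]: "u \<in> borel_measurable \<mu>" and B: "\<And>c. c \<in> cs n \<Longrightarrow> B c \<in> sets \<mu>"
    and close: "\<And>c x y. c \<in> cs n \<Longrightarrow> x \<in> cell n c \<Longrightarrow> y \<in> B c \<Longrightarrow> dist x y < r"
  shows "(\<Sum>c\<in>cs n. set_energy \<mu> u (cell n c) (B c)) \<le> ball_energy \<mu> u r"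
proof -
  have [measurable]: "c \<in> cs n \<Longrightarrow> cell n c \<in> sets \<mu>" for c by (rule cell_in_sets)
  note B[measurable]
  have "(\<Sum>c\<in>cs n. set_energy \<mu> u (cell n c) (B c))
      = (\<integral>\<^sup>+x. (\<Sum>c\<in>cs n. (\<integral>\<^sup>+y. ennreal ((u x - u y)\<^sup>2) * indicator (B c) y \<partial>\<mu>) * indicator (cell n c) x) \<partial>\<mu>)"
    unfolding set_energy_def by (intro nn_integral_sum[symmetric]) measurable
  also have "\<dots> \<le> ball_energy \<mu> u r"
    unfolding ball_energy_def
  proof (rule nn_integral_mono_AE)
    show "AE x in \<mu>. (\<Sum>c\<in>cs n. (\<integral>\<^sup>+y. ennreal ((u x - u y)\<^sup>2) * indicator (B c) y \<partial>\<mu>) * indicator (cell n c) x)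
        \<le> (\<integral>\<^sup>+y\<in>ball x r. ennreal (\<bar>u x - u y\<bar>\<^sup>2) \<partial>\<mu>)"
      using AE_unique_cell
    proof eventually_elim
      case (elim x)
      then obtain c where c: "c \<in> cs n" "x \<in> cell n c" and un: "\<And>c'. c' \<in> cs n \<Longrightarrow> x \<in> cell n c' \<Longrightarrow> c' = c"
        by metis
      have "(\<Sum>c\<in>cs n. (\<integral>\<^sup>+y. ennreal ((u x - u y)\<^sup>2) * indicator (B c) y \<partial>\<mu>) * indicator (cell n c) x)
        = (\<Sum>c'\<in>{c}. (\<integral>\<^sup>+y. ennreal ((u x - u y)\<^sup>2) * indicator (B c') y \<partial>\<mu>) * indicator (cell n c') x)"
      proof (rule sum.mono_neutral_right)
        show "\<forall>c'\<in>cs n - {c}. (\<integral>\<^sup>+y. ennreal ((u x - u y)\<^sup>2) * indicator (B c') y \<partial>\<mu>) * indicator (cell n c') x = 0"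
        proof
          fix c' assume "c' \<in> cs n - {c}"
          then have "x \<notin> cell n c'" using un[of c'] by blast
          then show "(\<integral>\<^sup>+y. ennreal ((u x - u y)\<^sup>2) * indicator (B c') y \<partial>\<mu>) * indicator (cell n c') x = 0" by simp
        qed
      qed (use c in simp_all)
      also have "\<dots> \<le> (\<integral>\<^sup>+y\<in>ball x r. ennreal (\<bar>u x - u y\<bar>\<^sup>2) \<partial>\<mu>)"
        using c close[OF c] by (auto intro!: nn_integral_mono split: split_indicator)
      finally show ?case .
    qed
  qed
  finally show ?thesis .
qed

end

text \<open>The factor \<open>441 ^ n\<close> accounts for the masses of two cells, so \<open>C * q ^ n\<close> bounds a sum of
  squared differences of cell averages. At the critical exponent the rate is \<open>q = 1 / 9\<close>, above it
  the rate is smaller. The number 6 makes the ball of that radius contain all cells close to a given one,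
  and it is small enough for the radius to be below 1 from level 1 on.\<close>

locale finite_energy = eyebolted_cross +
  fixes u :: "real \<times> real \<Rightarrow> real" and C q :: real
  assumes u_L2: "u \<in> L2_space \<mu>" and C_nonneg: "0 \<le> C" and q: "0 < q" "q \<le> 1 / 9"
    and energy: "\<And>n. 1 \<le> n \<Longrightarrow> ball_energy \<mu> u (6 / 9 ^ n) \<le> ennreal (C * q ^ n / 441 ^ n)"
begin

lemma u_measurable [measurable]: "u \<in> borel_measurable \<mu>"
  using u_L2 by (simp add: L2_space_def)

lemma u_integrable: "integrable \<mu> u"
  using u_L2 by (simp add: L2_space_def \<mu>.square_integrable_imp_integrable)

definition avg :: "nat \<Rightarrow> int \<times> int \<Rightarrow> real" where "avg n c = average \<mu> u (cell n c)"

lemma cells_in_ball: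
  assumes "x \<in> cell n c" "y \<in> cell n c'" "dist x y \<le> 1 / 9 ^ n" "p \<in> cell n c" "p' \<in> cell n c'"
  shows "dist p p' < 6 / 9 ^ n"
proof -
  have "dist p x \<le> 2 / 9 ^ n" "dist y p' \<le> 2 / 9 ^ n" using assms by (auto intro: cell_diameter)
  moreover have "dist p p' \<le> dist p x + dist x y + dist y p'"
    using dist_triangle[of p p' x] dist_triangle[of x p' y] by linarith
  moreover have "2 / 9 ^ n + 1 / 9 ^ n + 2 / 9 ^ n < (6 / 9 ^ n :: real)" by (simp add: field_simps)
  ultimately show ?thesis using assms(3) by linarith
qed

text \<open>All pairs of points of two close cells enter the ball energy at the scale \<open>6 / 9 ^
  n\<close>, and each cell has mass \<open>1 / 21 ^ n\<close>.\<close>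

lemma avg_close:
  assumes "1 \<le> n" "c \<in> cs n" "c' \<in> cs n" "x \<in> cell n c" "y \<in> cell n c'" "dist x y \<le> 1 / 9 ^ n"
  shows "(avg n c - avg n c')\<^sup>2 \<le> C * q ^ n"
proof -
  have "ennreal (measure \<mu> (cell n c) * measure \<mu> (cell n c') * (avg n c - avg n c')\<^sup>2)
      \<le> set_energy \<mu> u (cell n c) (cell n c')"
    unfolding avg_def using assms u_integrable
    by (intro \<mu>.average_difference_le) (auto intro: cell_in_sets simp: measure_cell)
  also have "\<dots> \<le> ball_energy \<mu> u (6 / 9 ^ n)"
    using cells_in_ball[OF assms(4-6)] by (rule set_energy_le_ball_energy)
  also have "\<dots> \<le> ennreal (C * q ^ n / 441 ^ n)" by (rule energy[OF assms(1)])
  finally have "1 / 21 ^ n * (1 / 21 ^ n) * (avg n c - avg n c')\<^sup>2 \<le> C * q ^ n / 441 ^ n"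
    using assms C_nonneg q by (simp add: measure_cell ennreal_le_iff)
  moreover have "(441::real) ^ n = 21 ^ n * 21 ^ n" by (simp add: power_mult_distrib[symmetric])
  ultimately show ?thesis by (simp add: field_simps)
qed

lemma sum_avg_child:
  assumes "1 \<le> n" "i \<in> D"
  shows "(\<Sum>c\<in>cs n. (avg n c - avg (Suc n) (child c i))\<^sup>2) \<le> 21 * C * q ^ n"
proof -
  let ?B = "\<lambda>c. cell (Suc n) (child c i)"
  have ch: "child c i \<in> cs (Suc n)" if "c \<in> cs n" for c using that assms(2) by (rule child_in_cs)
  have "ennreal (\<Sum>c\<in>cs n. measure \<mu> (cell n c) * measure \<mu> (?B c) * (avg n c - avg (Suc n) (child c i))\<^sup>2)
      = (\<Sum>c\<in>cs n. ennreal (measure \<mu> (cell n c) * measure \<mu> (?B c) * (avg n c - avg (Suc n) (child c i))\<^sup>2))"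
    by (intro sum_ennreal[symmetric]) simp
  also have "\<dots> \<le> (\<Sum>c\<in>cs n. set_energy \<mu> u (cell n c) (?B c))"
    unfolding avg_def using u_integrable ch measure_cell[OF ch]
    by (intro sum_mono \<mu>.average_difference_le) (simp_all add: cell_in_sets measure_cell del: cells.simps)
  also have "\<dots> \<le> ball_energy \<mu> u (6 / 9 ^ n)"
  proof (rule sum_set_energy_le_ball_energy)
    fix c x y assume c: "c \<in> cs n" "x \<in> cell n c" "y \<in> ?B c"
    then have "y \<in> cell n c" using cell_child_subset[OF assms(2)] by blast
    then show "dist x y < 6 / 9 ^ n" using c(2) by (intro cells_in_ball[of x n c x c]) simp_all
  qed (use ch cell_in_sets in auto)
  also have "\<dots> \<le> ennreal (C * q ^ n / 441 ^ n)" by (rule energy[OF assms(1)])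
  finally have "(\<Sum>c\<in>cs n. measure \<mu> (cell n c) * measure \<mu> (?B c) * (avg n c - avg (Suc n) (child c i))\<^sup>2)
      \<le> C * q ^ n / 441 ^ n"
    using C_nonneg q by (simp add: ennreal_le_iff)
  moreover have "(\<Sum>c\<in>cs n. measure \<mu> (cell n c) * measure \<mu> (?B c) * (avg n c - avg (Suc n) (child c i))\<^sup>2)
      = (\<Sum>c\<in>cs n. (avg n c - avg (Suc n) (child c i))\<^sup>2) / (21 * 441 ^ n)"
    unfolding sum_divide_distrib
  proof (intro sum.cong refl)
    fix c assume c: "c \<in> cs n"
    have "(441::real) ^ n = 21 ^ n * 21 ^ n" by (simp add: power_mult_distrib[symmetric])
    then show "measure \<mu> (cell n c) * measure \<mu> (?B c) * (avg n c - avg (Suc n) (child c i))\<^sup>2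
      = (avg n c - avg (Suc n) (child c i))\<^sup>2 / (21 * 441 ^ n)"
      using measure_cell[OF c] measure_cell[OF ch[OF c]] by simp
  qed
  ultimately show ?thesis by (simp add: field_simps)
qed

lemma avg_child:
  assumes "1 \<le> n" "c \<in> cs n" "i \<in> D"
  shows "(avg n c - avg (Suc n) (child c i))\<^sup>2 \<le> 21 * C * q ^ n"
proof -
  have "(avg n c - avg (Suc n) (child c i))\<^sup>2 \<le> (\<Sum>c\<in>cs n. (avg n c - avg (Suc n) (child c i))\<^sup>2)"
    by (rule member_le_sum[OF assms(2), of "\<lambda>c. (avg n c - avg (Suc n) (child c i))\<^sup>2"]) simp_all
  also have "\<dots> \<le> 21 * C * q ^ n" using sum_avg_child[OF assms(1,3)] .
  finally show ?thesis .
qed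

abbreviation "B \<equiv> sqrt (21 * C)"
abbreviation "s \<equiv> sqrt q"

lemma B_nonneg: "0 \<le> B" using C_nonneg by simp

lemma s_bounds: "0 \<le> s" "s \<le> 1 / 3" "s < 1"
proof -
  show "0 \<le> s" using q by simp
  show "s \<le> 1 / 3" using q real_sqrt_le_mono[of q "1 / 9"] by (simp add: real_sqrt_divide)
  then show "s < 1" by linarith
qed

lemma s_power_square: "(s ^ n)\<^sup>2 = q ^ n"
proof -
  have "(s ^ n)\<^sup>2 = (s\<^sup>2) ^ n" by (simp only: power_mult[symmetric] mult.commute)
  then show ?thesis using q by simp
qed

lemma abs_le_of_square:
  assumes "t\<^sup>2 \<le> 21 * C * q ^ n" shows "\<bar>t\<bar> \<le> B * s ^ n"
proof -
  have "(B * s ^ n)\<^sup>2 = 21 * C * q ^ n"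
    using C_nonneg by (simp add: power_mult_distrib s_power_square)
  then have "t\<^sup>2 \<le> (B * s ^ n)\<^sup>2" using assms by simp
  then show ?thesis using B_nonneg s_bounds by (simp add: abs_le_square_iff[symmetric] abs_mult)
qed

lemma avg_close':
  assumes "1 \<le> n" "c \<in> cs n" "c' \<in> cs n" "x \<in> cell n c" "y \<in> cell n c'" "dist x y \<le> 1 / 9 ^ n"
  shows "\<bar>avg n c - avg n c'\<bar> \<le> B * s ^ n"
proof (rule abs_le_of_square)
  have "0 \<le> C * q ^ n" using C_nonneg q by simp
  then show "(avg n c - avg n c')\<^sup>2 \<le> 21 * C * q ^ n" using avg_close[OF assms] by simp
qed

lemma avg_code_step:
  assumes "x \<in> K" "1 \<le> n"
  shows "\<bar>avg (Suc n) (code (Suc n) x) - avg n (code n x)\<bar> \<le> (2 * B) * s ^ n"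
proof -
  obtain a i where a: "a \<in> cs n" "i \<in> D" "code (Suc n) x = child a i"
    using code(1)[OF assms(1), of "Suc n"] by (elim cs_SucE)
  have xa: "x \<in> cell n a"
    using code(2)[OF assms(1), of "Suc n"] cell_child_subset[OF a(2), of n a] unfolding a(3) by blast
  have "\<bar>avg n a - avg (Suc n) (child a i)\<bar> \<le> B * s ^ n"
    using a assms by (intro abs_le_of_square avg_child)
  moreover have "\<bar>avg n a - avg n (code n x)\<bar> \<le> B * s ^ n"
    using a xa code[OF assms(1)] assms by (intro avg_close'[where x = x and y = x]) auto
  ultimately show ?thesis unfolding a(3) by linarith
qed

text \<open>Averages over nearby cells of one level differ by at most a geometric error, so averages
  over shrinking cells converge to a uniformly continuous function.\<close>

lemma continuous_representative_exists: "\<exists>v. continuous_representative K \<mu> u v"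
proof -
  have "\<exists>l. \<forall>n\<ge>1. \<bar>l - avg n (code n x)\<bar> \<le> 3 * B * s ^ n" if "x \<in> K" for x
  proof -
    have *: "\<bar>avg (Suc n) (code (Suc n) x) - avg n (code n x)\<bar> \<le> (2 * B) * s ^ n" if "1 \<le> n" for n
      using \<open>x \<in> K\<close> that by (rule avg_code_step)
    have "0 \<le> 2 * B" using B_nonneg by simp
    from geometric_steps_converge[OF * s_bounds(1,2) this] obtain l
      where "\<forall>n\<ge>1. \<bar>l - avg n (code n x)\<bar> \<le> 3 / 2 * (2 * B) * s ^ n" by blast
    then show ?thesis by (intro exI[of _ l]) simp
  qed
  then obtain v where v: "\<And>x n. x \<in> K \<Longrightarrow> 1 \<le> n \<Longrightarrow> \<bar>v x - avg n (code n x)\<bar> \<le> 3 * B * s ^ n" by metis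
  have near: "\<bar>v x - avg n c\<bar> \<le> 4 * B * s ^ n" if "1 \<le> n" "c \<in> cs n" "x \<in> cell n c" for x n c
  proof -
    have x: "x \<in> K" using that cell_subset_K by blast
    have "\<bar>avg n (code n x) - avg n c\<bar> \<le> B * s ^ n"
      using that code[OF x] by (intro avg_close'[where x = x and y = x]) auto
    then show ?thesis using v[OF x that(1)] by linarith
  qed
  have lim0: "(\<lambda>n. M * s ^ n) \<longlonglongrightarrow> 0" for M
    using tendsto_mult_left[OF LIMSEQ_power_zero[of s], of M] s_bounds by simp
  have cont: "continuous_on K v"
    unfolding continuous_on_iff
  proof (intro ballI allI impI)
    fix x e :: real and p assume p: "p \<in> K" and "0 < e"
    have "\<forall>\<^sub>F n in sequentially. 9 * B * s ^ n < e" using order_tendstoD(2)[OF lim0 \<open>0 < e\<close>] .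
    then have "\<forall>\<^sub>F n in sequentially. 9 * B * s ^ n < e \<and> 1 \<le> n"
      using eventually_ge_at_top by (rule eventually_conj)
    then obtain n where n: "9 * B * s ^ n < e" "1 \<le> n" using eventually_happens' sequentially_bot by blast
    show "\<exists>d>0. \<forall>y\<in>K. dist y p < d \<longrightarrow> dist (v y) (v p) < e"
    proof (intro exI[of _ "1 / 9 ^ n"] conjI ballI impI)
      fix y assume y: "y \<in> K" "dist y p < 1 / 9 ^ n"
      have "\<bar>avg n (code n y) - avg n (code n p)\<bar> \<le> B * s ^ n"
        using y n code[OF y(1)] code[OF p] by (intro avg_close'[where x = y and y = p]) auto
      moreover have "\<bar>v y - avg n (code n y)\<bar> \<le> 4 * B * s ^ n" "\<bar>v p - avg n (code n p)\<bar> \<le> 4 * B * s ^ n"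
        using near n code y p by blast+
      ultimately have "\<bar>v y - v p\<bar> \<le> 9 * B * s ^ n" by linarith
      then show "dist (v y) (v p) < e" using n by (simp add: dist_real_def)
    qed simp
  qed
  have v_meas [measurable]: "v \<in> borel_measurable \<mu>"
    using borel_measurable_continuous_on_restrict[OF cont] measurable_cong_sets[OF sets_\<mu> refl] by blast
  have "(\<integral>\<^sup>+x. ennreal ((u x - v x)\<^sup>2) \<partial>\<mu>) \<le> ennreal (2 * C * q ^ n + 32 * B\<^sup>2 * q ^ n)" if n: "1 \<le> n" for n
  proof -
    have [measurable]: "c \<in> cs n \<Longrightarrow> cell n c \<in> sets \<mu>" for c by (rule cell_in_sets)
    have Bs: "(4 * B * s ^ n)\<^sup>2 = 16 * B\<^sup>2 * q ^ n"
      by (simp only: power_mult_distrib s_power_square) simp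
    have pt: "ennreal ((u x - v x)\<^sup>2) \<le> (\<Sum>c\<in>cs n. 2 * (ennreal ((u x - avg n c)\<^sup>2) * indicator (cell n c) x)
        + ennreal (32 * B\<^sup>2 * q ^ n) * indicator (cell n c) x)" if "x \<in> space \<mu>" for x
    proof -
      have x: "x \<in> K" using that by simp
      let ?c = "code n x"
      have "(u x - v x)\<^sup>2 \<le> 2 * (u x - avg n ?c)\<^sup>2 + 2 * (avg n ?c - v x)\<^sup>2"
        using square_sum_le[of "u x - avg n ?c" "avg n ?c - v x"] by simp
      moreover have "(avg n ?c - v x)\<^sup>2 \<le> (4 * B * s ^ n)\<^sup>2"
        using near[OF n code[OF x]] by (metis abs_ge_zero abs_minus_commute power2_abs power_mono)
      ultimately have "(u x - v x)\<^sup>2 \<le> 2 * (u x - avg n ?c)\<^sup>2 + 32 * B\<^sup>2 * q ^ n" using Bs by linarith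
      then have "ennreal ((u x - v x)\<^sup>2) \<le> 2 * (ennreal ((u x - avg n ?c)\<^sup>2) * indicator (cell n ?c) x)
        + ennreal (32 * B\<^sup>2 * q ^ n) * indicator (cell n ?c) x"
        using code[OF x] q by (simp add: ennreal_plus[symmetric] ennreal_mult[symmetric] ennreal_leI
          del: ennreal_plus flip: ennreal_numeral)
      also have "\<dots> \<le> (\<Sum>c\<in>cs n. 2 * (ennreal ((u x - avg n c)\<^sup>2) * indicator (cell n c) x)
        + ennreal (32 * B\<^sup>2 * q ^ n) * indicator (cell n c) x)"
        using code[OF x] by (intro member_le_sum[of ?c "cs n" "\<lambda>c. 2 * (ennreal ((u x - avg n c)\<^sup>2) * indicator (cell n c) x)
          + ennreal (32 * B\<^sup>2 * q ^ n) * indicator (cell n c) x"]) auto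
      finally show ?thesis .
    qed
    have "(\<integral>\<^sup>+x. ennreal ((u x - v x)\<^sup>2) \<partial>\<mu>)
      \<le> (\<integral>\<^sup>+x. (\<Sum>c\<in>cs n. 2 * (ennreal ((u x - avg n c)\<^sup>2) * indicator (cell n c) x)
        + ennreal (32 * B\<^sup>2 * q ^ n) * indicator (cell n c) x) \<partial>\<mu>)"
      by (intro nn_integral_mono pt)
    also have "\<dots> = (\<Sum>c\<in>cs n. 2 * (\<integral>\<^sup>+x. ennreal ((u x - avg n c)\<^sup>2) * indicator (cell n c) x \<partial>\<mu>)
        + ennreal (32 * B\<^sup>2 * q ^ n) * emeasure \<mu> (cell n c))"
      by (subst nn_integral_sum) (simp_all add: nn_integral_add nn_integral_cmult nn_integral_cmult_indicator)
    also have "\<dots> \<le> (\<Sum>c\<in>cs n. 2 * (ennreal (21 ^ n) * set_energy \<mu> u (cell n c) (cell n c))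
        + ennreal (32 * B\<^sup>2 * q ^ n) * ennreal (1 / 21 ^ n))"
    proof (intro sum_mono add_mono mult_left_mono)
      fix c assume c: "c \<in> cs n"
      have "ennreal (measure \<mu> (cell n c)) * (\<integral>\<^sup>+x. ennreal ((u x - avg n c)\<^sup>2) * indicator (cell n c) x \<partial>\<mu>)
          \<le> set_energy \<mu> u (cell n c) (cell n c)"
        unfolding avg_def using c u_integrable
        by (intro \<mu>.deviation_from_average_le) (auto simp: measure_cell intro: cell_in_sets)
      then have "ennreal (21 ^ n) * (ennreal (1 / 21 ^ n) * (\<integral>\<^sup>+x. ennreal ((u x - avg n c)\<^sup>2) * indicator (cell n c) x \<partial>\<mu>))
          \<le> ennreal (21 ^ n) * set_energy \<mu> u (cell n c) (cell n c)"
        unfolding measure_cell[OF c] by (intro mult_left_mono) auto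
      then show "(\<integral>\<^sup>+x. ennreal ((u x - avg n c)\<^sup>2) * indicator (cell n c) x \<partial>\<mu>)
          \<le> ennreal (21 ^ n) * set_energy \<mu> u (cell n c) (cell n c)"
        by (simp add: mult.assoc[symmetric] ennreal_mult[symmetric])
      show "emeasure \<mu> (cell n c) \<le> ennreal (1 / 21 ^ n)" using emeasure_cell[OF c] by simp
    qed auto
    also have "\<dots> = 2 * (ennreal (21 ^ n) * (\<Sum>c\<in>cs n. set_energy \<mu> u (cell n c) (cell n c)))
        + of_nat (21 ^ n) * (ennreal (32 * B\<^sup>2 * q ^ n) * ennreal (1 / 21 ^ n))"
      by (simp add: sum.distrib sum_distrib_left card_cs)
    also have "\<dots> \<le> 2 * (ennreal (21 ^ n) * ennreal (C * q ^ n / 441 ^ n))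
        + of_nat (21 ^ n) * (ennreal (32 * B\<^sup>2 * q ^ n) * ennreal (1 / 21 ^ n))"
    proof (intro add_mono mult_left_mono order_refl)
      have "(\<Sum>c\<in>cs n. set_energy \<mu> u (cell n c) (cell n c)) \<le> ball_energy \<mu> u (6 / 9 ^ n)"
        by (rule sum_set_energy_le_ball_energy) (auto intro: cell_in_sets cells_in_ball)
      then show "(\<Sum>c\<in>cs n. set_energy \<mu> u (cell n c) (cell n c)) \<le> ennreal (C * q ^ n / 441 ^ n)"
        using energy[OF n] by (rule order_trans)
    qed auto
    also have "\<dots> = ennreal (2 * (21 ^ n * (C * q ^ n / 441 ^ n)) + 32 * B\<^sup>2 * q ^ n)"
      using C_nonneg q
      by (simp add: ennreal_of_nat_eq_real_of_nat ennreal_mult[symmetric] ennreal_plus[symmetric]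
        del: ennreal_plus flip: ennreal_numeral)
    also have "\<dots> \<le> ennreal (2 * C * q ^ n + 32 * B\<^sup>2 * q ^ n)"
    proof (intro ennreal_leI add_mono order_refl)
      have "21 ^ n * (C * q ^ n / 441 ^ n) \<le> C * q ^ n"
        using C_nonneg q mult_left_mono[OF power_mono[of 21 "441::real" n], of "C * q ^ n"]
        by (simp add: field_simps)
      then show "2 * (21 ^ n * (C * q ^ n / 441 ^ n)) \<le> 2 * C * q ^ n" by simp
    qed
    finally show ?thesis .
  qed
  moreover have "(\<lambda>n. ennreal (2 * C * q ^ n + 32 * B\<^sup>2 * q ^ n)) \<longlonglongrightarrow> ennreal (2 * C * 0 + 32 * B\<^sup>2 * 0)"
    using q by (intro tendsto_ennrealI tendsto_intros LIMSEQ_power_zero) auto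
  ultimately have "(\<integral>\<^sup>+x. ennreal ((u x - v x)\<^sup>2) \<partial>\<mu>) \<le> ennreal (2 * C * 0 + 32 * B\<^sup>2 * 0)"
    by (intro LIMSEQ_le_const) auto
  then have "(\<integral>\<^sup>+x. ennreal ((u x - v x)\<^sup>2) \<partial>\<mu>) = 0" by simp
  then have "AE x in \<mu>. ennreal ((u x - v x)\<^sup>2) = 0" by (subst (asm) nn_integral_0_iff_AE) auto
  then have "AE x in \<mu>. u x = v x" by eventually_elim (simp add: ennreal_eq_0_iff)
  then show ?thesis using cont by (auto simp: continuous_representative_def)
qed

end

section \<open>Resistance of the eyebolted arms\<close>

text \<open>The function \<open>h\<close> lives on the vertices of the children of one cell, in
  coordinates in which the child \<open>i\<close> has its centre at \<open>2 * i\<close> and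
  its vertex \<open>e\<close> at \<open>2 * i + e\<close>. The corners of the parent are then
  the points \<open>9 * e\<close>.\<close>

definition main_form :: "(int \<times> int \<Rightarrow> real) \<Rightarrow> int \<times> int \<Rightarrow> real" where
  "main_form h i = (\<Sum>e\<in>main_ends. (h (2 * fst i + fst e, 2 * snd i + snd e) - h (2 * fst i, 2 * snd i))\<^sup>2)"

definition anti_form :: "(int \<times> int \<Rightarrow> real) \<Rightarrow> int \<times> int \<Rightarrow> real" where
  "anti_form h i = (\<Sum>e\<in>anti_ends. (h (2 * fst i + fst e, 2 * snd i + snd e) - h (2 * fst i, 2 * snd i))\<^sup>2)"

lemma main_form_eq: "main_form h (i, j) = (h (2 * i + 1, 2 * j + 1) - h (2 * i, 2 * j))\<^sup>2 + (h (2 * i - 1, 2 * j - 1) - h (2 * i, 2 * j))\<^sup>2"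
  and anti_form_eq: "anti_form h (i, j) = (h (2 * i + 1, 2 * j - 1) - h (2 * i, 2 * j))\<^sup>2 + (h (2 * i - 1, 2 * j + 1) - h (2 * i, 2 * j))\<^sup>2"
  by (simp_all add: main_form_def anti_form_def main_ends_def anti_ends_def)

lemma main_form_nonneg: "0 \<le> main_form h i" and anti_form_nonneg: "0 \<le> anti_form h i"
  by (simp_all add: main_form_def anti_form_def sum_nonneg)

lemma square_sum_list: "(sum_list xs)\<^sup>2 \<le> real (length xs) * (\<Sum>x\<leftarrow>xs. x\<^sup>2)" for xs :: "real list"
proof (induction xs)
  case (Cons x xs)
  let ?n = "real (length xs)" and ?S = "sum_list xs" and ?Q = "\<Sum>x\<leftarrow>xs. x\<^sup>2"
  have "0 \<le> ?Q" by (intro sum_list_nonneg) auto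
  have "2 * x * ?S \<le> ?n * x\<^sup>2 + ?Q"
  proof (cases "?n = 0")
    case False
    then have n: "0 < ?n" by simp
    have "0 \<le> (?n * x - ?S)\<^sup>2" by simp
    then have "?n * (2 * x * ?S) \<le> ?n * (?n * x\<^sup>2) + ?S\<^sup>2" by (simp add: power2_eq_square algebra_simps)
    also have "\<dots> \<le> ?n * (?n * x\<^sup>2) + ?n * ?Q" using Cons by simp
    also have "\<dots> = ?n * (?n * x\<^sup>2 + ?Q)" by (simp add: algebra_simps)
    finally show ?thesis using n by (simp only: mult_le_cancel_left_pos)
  qed simp
  then show ?case using Cons by (simp add: power2_eq_square algebra_simps)
qed simp

lemma main_arm:
  "(h (9, 9) - h (0, 0))\<^sup>2 \<le> 9 * ((h (1, 1) - h (0, 0))\<^sup>2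
    + main_form h (1, 1) + main_form h (2, 2) + main_form h (3, 3) + main_form h (4, 4))"
  using square_sum_list[of "[h (1, 1) - h (0, 0), h (2, 2) - h (1, 1), h (3, 3) - h (2, 2), h (4, 4) - h (3, 3),
      h (5, 5) - h (4, 4), h (6, 6) - h (5, 5), h (7, 7) - h (6, 6), h (8, 8) - h (7, 7), h (9, 9) - h (8, 8)]"]
  by (simp add: main_form_eq power2_commute[of "h (1, 1)" "h (2, 2)"] power2_commute[of "h (3, 3)" "h (4, 4)"]
      power2_commute[of "h (5, 5)" "h (6, 6)"] power2_commute[of "h (7, 7)" "h (8, 8)"])

text \<open>Along the anti-diagonal seven half cells of conductance \<open>\<kappa>\<close> are in series with two more
  that have the eyebolt in parallel. The eyebolt has conductance at least \<open>1 / 6\<close>, and this raises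
  the conductance of the arm by a fixed amount.\<close>

lemma parallel_gain:
  fixes d t k :: real
  assumes "1 \<le> k"
  shows "(k + 1 / 20) * t\<^sup>2 \<le> 9 * (k * ((t - d)\<^sup>2 / 7) + k * (d\<^sup>2 / 2) + d\<^sup>2 / 6)"
proof -
  \<comment> \<open>The minimum over the drop \<open>d\<close> across the bypassed piece is \<open>a * b / (a + b) * t\<^sup>2\<close>.\<close>
  define a b where "a = 9 * k / 7" and "b = 9 * (3 * k + 1) / 6"
  have ab: "0 < a" "0 < b" using assms by (simp_all add: a_def b_def)
  have "(k + 1 / 20) * (a + b) \<le> a * b"
  proof -
    have "0 \<le> k * k - k" using assms by (simp add: mult_left_mono)
    then show ?thesis using assms by (simp add: a_def b_def field_simps)
  qed
  then have "(k + 1 / 20) * t\<^sup>2 * (a + b) \<le> a * b * t\<^sup>2"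
    using mult_right_mono[of "(k + 1 / 20) * (a + b)" "a * b" "t\<^sup>2"] by (simp add: mult_ac)
  also have "\<dots> \<le> a * b * t\<^sup>2 + ((a + b) * d - a * t)\<^sup>2" by simp
  also have "\<dots> = (a * (t - d)\<^sup>2 + b * d\<^sup>2) * (a + b)" by (simp add: power2_eq_square algebra_simps)
  finally have "(k + 1 / 20) * t\<^sup>2 \<le> a * (t - d)\<^sup>2 + b * d\<^sup>2" using ab by (simp add: mult_le_cancel_right)
  also have "\<dots> = 9 * (k * ((t - d)\<^sup>2 / 7) + k * (d\<^sup>2 / 2) + d\<^sup>2 / 6)"
    by (simp add: a_def b_def field_simps)
  finally show ?thesis .
qed

text \<open>The bypass leads from the centre of the cell \<open>(2, -2)\<close> to the centre of the
  cell \<open>(3, -3)\<close> through six half diagonals, of which two are halves of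
  anti-diagonals of eyebolt cells.\<close>

lemma anti_arm:
  fixes s :: int
  assumes "1 \<le> k" and "s = 1 \<or> s = -1"
  shows "(k + 1 / 20) * (h (9, -9) - h (0, 0))\<^sup>2 \<le> 9 * (k * (h (1, -1) - h (0, 0))\<^sup>2
    + k * (anti_form h (1, -1) + anti_form h (2, -2) + anti_form h (3, -3) + anti_form h (4, -4))
    + main_form h (2, -2) + main_form h (3, -3)
    + main_form h (s + 2, s - 2) + main_form h (s + 3, s - 3)
    + k * (anti_form h (s + 2, s - 2) + anti_form h (s + 3, s - 3)))"
proof -
  let ?t = "h (9, -9) - h (0, 0)" and ?d = "h (6, -6) - h (4, -4)"
  define P where "P = (h (1, -1) - h (0, 0))\<^sup>2 + (h (2, -2) - h (1, -1))\<^sup>2 + (h (3, -3) - h (2, -2))\<^sup>2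
    + (h (4, -4) - h (3, -3))\<^sup>2 + (h (7, -7) - h (6, -6))\<^sup>2 + (h (8, -8) - h (7, -7))\<^sup>2 + (h (9, -9) - h (8, -8))\<^sup>2"
  define Q where "Q = (h (5, -5) - h (4, -4))\<^sup>2 + (h (6, -6) - h (5, -5))\<^sup>2"
  define R where "R = main_form h (2, -2) + main_form h (3, -3)
    + main_form h (s + 2, s - 2) + main_form h (s + 3, s - 3)
    + (anti_form h (s + 2, s - 2) + anti_form h (s + 3, s - 3))"
  have P: "(?t - ?d)\<^sup>2 \<le> 7 * P"
  proof -
    let ?xs = "[h (1, -1) - h (0, 0), h (2, -2) - h (1, -1), h (3, -3) - h (2, -2),
      h (4, -4) - h (3, -3), h (7, -7) - h (6, -6), h (8, -8) - h (7, -7), h (9, -9) - h (8, -8)]"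
    have "sum_list ?xs = ?t - ?d" "(\<Sum>x\<leftarrow>?xs. x\<^sup>2) = P" "real (length ?xs) = 7" by (simp_all add: P_def)
    then show ?thesis using square_sum_list[of ?xs] by (simp only:)
  qed
  have Q: "?d\<^sup>2 \<le> 2 * Q"
    using square_sum_list[of "[h (5, -5) - h (4, -4), h (6, -6) - h (5, -5)]"] by (simp add: Q_def)
  have R: "?d\<^sup>2 \<le> 6 * R"
  proof (cases "s = 1")
    case True
    have "?d\<^sup>2 \<le> 6 * ((h (5, -3) - h (4, -4))\<^sup>2 + (h (6, -2) - h (5, -3))\<^sup>2 + (h (7, -3) - h (6, -2))\<^sup>2
      + (h (8, -4) - h (7, -3))\<^sup>2 + (h (7, -5) - h (8, -4))\<^sup>2 + (h (6, -6) - h (7, -5))\<^sup>2)"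
      using square_sum_list[of "[h (5, -3) - h (4, -4), h (6, -2) - h (5, -3), h (7, -3) - h (6, -2),
        h (8, -4) - h (7, -3), h (7, -5) - h (8, -4), h (6, -6) - h (7, -5)]"] by simp
    also have "\<dots> \<le> 6 * R"
      unfolding R_def True by (simp add: main_form_eq anti_form_eq power2_commute)
    finally show ?thesis .
  next
    case False
    then have s: "s = -1" using assms by blast
    have "?d\<^sup>2 \<le> 6 * ((h (3, -5) - h (4, -4))\<^sup>2 + (h (2, -6) - h (3, -5))\<^sup>2 + (h (3, -7) - h (2, -6))\<^sup>2
      + (h (4, -8) - h (3, -7))\<^sup>2 + (h (5, -7) - h (4, -8))\<^sup>2 + (h (6, -6) - h (5, -7))\<^sup>2)"
      using square_sum_list[of "[h (3, -5) - h (4, -4), h (2, -6) - h (3, -5), h (3, -7) - h (2, -6),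
        h (4, -8) - h (3, -7), h (5, -7) - h (4, -8), h (6, -6) - h (5, -7)]"] by simp
    also have "\<dots> \<le> 6 * R"
      unfolding R_def s by (simp add: main_form_eq anti_form_eq power2_commute)
    finally show ?thesis .
  qed
  have "(k + 1 / 20) * ?t\<^sup>2 \<le> 9 * (k * ((?t - ?d)\<^sup>2 / 7) + k * (?d\<^sup>2 / 2) + ?d\<^sup>2 / 6)"
    by (rule parallel_gain[OF assms(1)])
  also have "\<dots> \<le> 9 * (k * P + k * Q + R)"
    using P Q R assms(1) by (intro mult_left_mono add_mono) auto
  also have "k * P + k * Q = k * (h (1, -1) - h (0, 0))\<^sup>2
    + k * (anti_form h (1, -1) + anti_form h (2, -2) + anti_form h (3, -3) + anti_form h (4, -4))"
    by (simp add: P_def Q_def anti_form_eq power2_commute algebra_simps)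
  also have "R \<le> main_form h (2, -2) + main_form h (3, -3)
    + main_form h (s + 2, s - 2) + main_form h (s + 3, s - 3)
    + k * (anti_form h (s + 2, s - 2) + anti_form h (s + 3, s - 3))"
    using mult_right_mono[OF assms(1), of "anti_form h (s + 2, s - 2) + anti_form h (s + 3, s - 3)"]
      anti_form_nonneg[of h] by (simp add: R_def)
  finally show ?thesis by (simp add: add.assoc)
qed

context eyebolted_cross
begin

text \<open>The other eyebolt is the image of the first under the reflection in the origin.\<close>

lemma resistance_step:
  assumes "1 \<le> k"
  shows "(\<Sum>e\<in>main_ends. (h (9 * fst e, 9 * snd e) - h (0, 0))\<^sup>2)
    + (k + 1 / 20) * (\<Sum>e\<in>anti_ends. (h (9 * fst e, 9 * snd e) - h (0, 0))\<^sup>2)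
    \<le> 9 * (\<Sum>i\<in>D. main_form h i + k * anti_form h i)"
proof (rule D_explicit)
  fix s s' :: int
  assume s: "s = 1 \<or> s = -1" "s' = 1 \<or> s' = -1" and D: "D = {(0,0), (1,1), (2,2), (3,3), (4,4), (-1,-1), (-2,-2), (-3,-3), (-4,-4),
          (1,-1), (2,-2), (3,-3), (4,-4), (-1,1), (-2,2), (-3,3), (-4,4),
          (s + 2, s - 2), (s + 3, s - 3), (s' - 2, s' + 2), (s' - 3, s' + 3)}"
  define g where "g p = h (- fst p, - snd p)" for p
  have mg: "main_form g (i, j) = main_form h (- i, - j)" and ag: "anti_form g (i, j) = anti_form h (- i, - j)" for i j
  proof -
    have "- (2 * t + 1) = 2 * (- t) - 1" "- (2 * t - 1) = 2 * (- t) + 1" "- (2 * t) = 2 * (- t)" for t :: int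
      by simp_all
    then show "main_form g (i, j) = main_form h (- i, - j)" "anti_form g (i, j) = anti_form h (- i, - j)"
      by (simp_all only: main_form_eq anti_form_eq g_def fst_conv snd_conv add.commute)
  qed
  let ?f = "\<lambda>i. main_form h i + k * anti_form h i"
  have sum: "(\<Sum>i\<in>D. ?f i) = ?f (0,0) + ?f (1,1) + ?f (2,2) + ?f (3,3) + ?f (4,4)
      + ?f (-1,-1) + ?f (-2,-2) + ?f (-3,-3) + ?f (-4,-4)
      + ?f (1,-1) + ?f (2,-2) + ?f (3,-3) + ?f (4,-4) + ?f (-1,1) + ?f (-2,2) + ?f (-3,3) + ?f (-4,4)
      + ?f (s + 2, s - 2) + ?f (s + 3, s - 3) + ?f (s' - 2, s' + 2) + ?f (s' - 3, s' + 3)"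
    unfolding D using s by (elim disjE) simp_all
  have c0: "main_form h (0,0) = (h (1,1) - h (0,0))\<^sup>2 + (h (-1,-1) - h (0,0))\<^sup>2"
    "anti_form h (0,0) = (h (1,-1) - h (0,0))\<^sup>2 + (h (-1,1) - h (0,0))\<^sup>2"
    by (simp_all add: main_form_eq anti_form_eq)
  have m1: "(h (9, 9) - h (0, 0))\<^sup>2 \<le> 9 * ((h (1, 1) - h (0, 0))\<^sup>2
    + main_form h (1, 1) + main_form h (2, 2) + main_form h (3, 3) + main_form h (4, 4))" by (rule main_arm)
  have m2: "(h (-9, -9) - h (0, 0))\<^sup>2 \<le> 9 * ((h (-1, -1) - h (0, 0))\<^sup>2
    + main_form h (-1, -1) + main_form h (-2, -2) + main_form h (-3, -3) + main_form h (-4, -4))"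
    using main_arm[of g] unfolding mg by (simp add: g_def)
  have a1: "(k + 1 / 20) * (h (9, -9) - h (0, 0))\<^sup>2 \<le> 9 * (k * (h (1, -1) - h (0, 0))\<^sup>2
    + k * (anti_form h (1, -1) + anti_form h (2, -2) + anti_form h (3, -3) + anti_form h (4, -4))
    + main_form h (2, -2) + main_form h (3, -3)
    + main_form h (s + 2, s - 2) + main_form h (s + 3, s - 3)
    + k * (anti_form h (s + 2, s - 2) + anti_form h (s + 3, s - 3)))" by (rule anti_arm[OF assms s(1)])
  have "- s' = 1 \<or> - s' = -1" using s(2) by auto
  from anti_arm[OF assms this, of g]
  have a2: "(k + 1 / 20) * (h (-9, 9) - h (0, 0))\<^sup>2 \<le> 9 * (k * (h (-1, 1) - h (0, 0))\<^sup>2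
    + k * (anti_form h (-1, 1) + anti_form h (-2, 2) + anti_form h (-3, 3) + anti_form h (-4, 4))
    + main_form h (-2, 2) + main_form h (-3, 3)
    + main_form h (s' - 2, s' + 2) + main_form h (s' - 3, s' + 3)
    + k * (anti_form h (s' - 2, s' + 2) + anti_form h (s' - 3, s' + 3)))"
    unfolding mg ag by (simp add: g_def algebra_simps)
  have nn: "0 \<le> main_form h i" "0 \<le> k * anti_form h i" for i
    using main_form_nonneg anti_form_nonneg assms by simp_all
  have lhs: "(\<Sum>e\<in>main_ends. (h (9 * fst e, 9 * snd e) - h (0, 0))\<^sup>2)
    + (k + 1 / 20) * (\<Sum>e\<in>anti_ends. (h (9 * fst e, 9 * snd e) - h (0, 0))\<^sup>2)
    = (h (9, 9) - h (0, 0))\<^sup>2 + (h (-9, -9) - h (0, 0))\<^sup>2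
      + ((k + 1 / 20) * (h (9, -9) - h (0, 0))\<^sup>2 + (k + 1 / 20) * (h (-9, 9) - h (0, 0))\<^sup>2)"
    by (simp add: main_ends_def anti_ends_def distrib_left)
  show ?thesis
    unfolding lhs sum
    using m1 m2 a1 a2 c0 nn[of "(1,1)"] nn[of "(2,2)"] nn[of "(3,3)"] nn[of "(4,4)"]
      nn[of "(-1,-1)"] nn[of "(-2,-2)"] nn[of "(-3,-3)"] nn[of "(-4,-4)"]
      nn[of "(1,-1)"] nn[of "(2,-2)"] nn[of "(3,-3)"] nn[of "(4,-4)"]
      nn[of "(-1,1)"] nn[of "(-2,2)"] nn[of "(-3,3)"] nn[of "(-4,4)"]
      arg_cong[OF c0(2), of "\<lambda>t. k * t"]
    unfolding distrib_left by linarith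
qed

definition main_energy :: "(real \<times> real \<Rightarrow> real) \<Rightarrow> nat \<Rightarrow> int \<times> int \<Rightarrow> real" where
  "main_energy v n c = (\<Sum>e\<in>main_ends. (v (vertex n c e) - v (vertex n c (0, 0)))\<^sup>2)"

definition anti_energy :: "(real \<times> real \<Rightarrow> real) \<Rightarrow> nat \<Rightarrow> int \<times> int \<Rightarrow> real" where
  "anti_energy v n c = (\<Sum>e\<in>anti_ends. (v (vertex n c e) - v (vertex n c (0, 0)))\<^sup>2)"

lemma energy_nonneg: "0 \<le> main_energy v n c" "0 \<le> anti_energy v n c"
  by (simp_all add: main_energy_def anti_energy_def sum_nonneg)

lemma energy_step:
  assumes "1 \<le> k"
  shows "main_energy v n c + (k + 1 / 20) * anti_energy v n c
    \<le> 9 * (\<Sum>i\<in>D. main_energy v (Suc n) (child c i) + k * anti_energy v (Suc n) (child c i))"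
proof -
  define h where "h p = v ((of_int (fst p) / 2 + 9 * of_int (fst c)) / 9 ^ Suc n,
    (of_int (snd p) / 2 + 9 * of_int (snd c)) / 9 ^ Suc n)" for p
  have parent: "v (vertex n c e) = h (9 * fst e, 9 * snd e)" for e
    unfolding h_def by (intro arg_cong[of _ _ v] prod_eqI) (simp_all add: fst_vertex snd_vertex field_simps)
  have child: "v (vertex (Suc n) (child c i) e) = h (2 * fst i + fst e, 2 * snd i + snd e)" for i e
    unfolding h_def by (intro arg_cong[of _ _ v] prod_eqI) (simp_all add: fst_vertex snd_vertex field_simps)
  show ?thesis
    using resistance_step[OF assms, of h]
    unfolding main_energy_def anti_energy_def parent child main_form_def anti_form_def by simp
qed

lemma total_energy_step:
  assumes "1 \<le> k"
  shows "(\<Sum>c\<in>cs n. main_energy v n c + (k + 1 / 20) * anti_energy v n c)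
    \<le> 9 * (\<Sum>c\<in>cs (Suc n). main_energy v (Suc n) c + k * anti_energy v (Suc n) c)"
  unfolding sum_cs_Suc sum_distrib_left[of 9 _ "cs n"] using energy_step[OF assms] by (intro sum_mono)

text \<open>Each level contributes \<open>1 / 20\<close> to the conductance along the anti-diagonals.\<close>

lemma total_energy_growth:
  "(\<Sum>c\<in>cs n. main_energy v n c + (1 + real j / 20) * anti_energy v n c)
    \<le> 9 ^ j * (\<Sum>c\<in>cs (n + j). main_energy v (n + j) c + anti_energy v (n + j) c)"
proof (induction j arbitrary: n)
  case (Suc j)
  have "(\<Sum>c\<in>cs n. main_energy v n c + (1 + real j / 20 + 1 / 20) * anti_energy v n c)
    \<le> 9 * (\<Sum>c\<in>cs (Suc n). main_energy v (Suc n) c + (1 + real j / 20) * anti_energy v (Suc n) c)"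
    by (rule total_energy_step) simp
  also have "\<dots> \<le> 9 * (9 ^ j * (\<Sum>c\<in>cs (Suc n + j). main_energy v (Suc n + j) c + anti_energy v (Suc n + j) c))"
    using Suc.IH[of "Suc n"] by (rule mult_left_mono) simp
  finally show ?case by (simp add: add_divide_distrib add.assoc mult.assoc del: cells.simps) 
qed simp

end

section \<open>Constancy along the anti-diagonal\<close>

primrec corner_descendant :: "nat \<Rightarrow> int \<times> int \<Rightarrow> int \<times> int \<Rightarrow> int \<times> int" where
  "corner_descendant 0 e c = c"
| "corner_descendant (Suc k) e c = corner_descendant k e (child c (4 * fst e, 4 * snd e))"

lemma vertex_corner_child: "vertex (Suc n) (child c (4 * fst e, 4 * snd e)) e = vertex n c e"
  by (rule prod_eqI) (simp_all add: fst_vertex snd_vertex field_simps)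

lemma vertex_corner_descendant: "vertex (n + k) (corner_descendant k e c) e = vertex n c e"
proof (induction k arbitrary: n c)
  case (Suc k)
  show ?case using Suc[of "Suc n" "child c (4 * fst e, 4 * snd e)"] vertex_corner_child[of n c e] by simp
qed simp

context eyebolted_cross
begin

lemma corner_digit: "e \<in> insert (0, 0) corners \<Longrightarrow> (4 * fst e, 4 * snd e) \<in> D"
  using D_corner D_diagonal[of 0] by auto

lemma corner_descendant_in_cs:
  assumes "e \<in> insert (0, 0) corners"
  shows "c \<in> cs n \<Longrightarrow> corner_descendant k e c \<in> cs (n + k)"
proof (induction k arbitrary: n c)
  case (Suc k)
  show ?case using Suc.IH[OF child_in_cs[OF Suc.prems corner_digit[OF assms]]] by simp
qed simp

end

locale finite_energy_representative = finite_energy +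
  fixes v :: "real \<times> real \<Rightarrow> real"
  assumes rep: "continuous_representative K \<mu> u v"
begin

lemma v_continuous: "continuous_on K v"
  and v_AE: "AE x in \<mu>. u x = v x"
  using rep by (simp_all add: continuous_representative_def)

lemma avg_near:
  assumes "c \<in> cs n" and near: "\<And>x. x \<in> cell n c \<Longrightarrow> \<bar>v x - t\<bar> \<le> e" and "0 \<le> e"
  shows "\<bar>avg n c - t\<bar> \<le> e"
proof -
  have [measurable]: "cell n c \<in> sets \<mu>" using assms(1) by (rule cell_in_sets)
  have "ennreal (measure \<mu> (cell n c) * (avg n c - t)\<^sup>2) \<le> (\<integral>\<^sup>+x. ennreal ((u x - t)\<^sup>2) * indicator (cell n c) x \<partial>\<mu>)"
    unfolding avg_def using assms(1) u_integrable
    by (intro \<mu>.average_deviation_le) (simp_all add: measure_cell)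
  also have "\<dots> \<le> (\<integral>\<^sup>+x. ennreal (e\<^sup>2) * indicator (cell n c) x \<partial>\<mu>)"
  proof (rule nn_integral_mono_AE)
    show "AE x in \<mu>. ennreal ((u x - t)\<^sup>2) * indicator (cell n c) x \<le> ennreal (e\<^sup>2) * indicator (cell n c) x"
      using v_AE
    proof eventually_elim
      case (elim x)
      show ?case
      proof (cases "x \<in> cell n c")
        case True
        then have "(v x - t)\<^sup>2 \<le> e\<^sup>2" using near assms(3) abs_le_square_iff[of "v x - t" e] by simp
        then show ?thesis using elim by (simp add: True ennreal_leI)
      qed simp
    qed
  qed
  also have "\<dots> = ennreal (e\<^sup>2 * (1 / 21 ^ n))"
    using emeasure_cell[OF assms(1)] by (simp add: nn_integral_cmult_indicator ennreal_mult[symmetric])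
  finally have "1 / 21 ^ n * (avg n c - t)\<^sup>2 \<le> e\<^sup>2 * (1 / 21 ^ n)"
    using measure_cell[OF assms(1)] by (simp add: ennreal_le_iff)
  then have "(avg n c - t)\<^sup>2 \<le> e\<^sup>2" by (simp add: field_simps)
  then show ?thesis using assms(3) abs_le_square_iff[of "avg n c - t" e] by simp
qed

lemma two_nine_powers_small:
  assumes "0 < d" shows "\<forall>\<^sub>F k in sequentially. M / 9 ^ (n + k) < (d :: real)"
proof -
  have "(\<lambda>k. (M / 9 ^ n) * (1 / 9) ^ k) \<longlonglongrightarrow> (M / 9 ^ n) * 0"
    by (intro tendsto_mult_left LIMSEQ_power_zero) simp
  then have "(\<lambda>k. M / 9 ^ (n + k)) \<longlonglongrightarrow> 0" by (simp add: power_add power_divide)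
  then show ?thesis using assms by (rule order_tendstoD)
qed

lemma avg_tendsto:
  assumes c: "\<And>k. c k \<in> cs (n + k)" "\<And>k. p \<in> cell (n + k) (c k)"
  shows "(\<lambda>k. avg (n + k) (c k)) \<longlonglongrightarrow> v p"
proof (rule tendstoI)
  fix e :: real assume "0 < e"
  have p: "p \<in> K" using c cell_subset_K by blast
  obtain d where d: "0 < d" "\<And>x. x \<in> K \<Longrightarrow> dist x p < d \<Longrightarrow> dist (v x) (v p) < e / 2"
    using v_continuous p \<open>0 < e\<close> unfolding continuous_on_iff by (meson half_gt_zero)
  show "\<forall>\<^sub>F k in sequentially. dist (avg (n + k) (c k)) (v p) < e"
    using two_nine_powers_small[OF d(1), of 2 n]
  proof eventually_elim
    case (elim k)
    have "\<bar>avg (n + k) (c k) - v p\<bar> \<le> e / 2"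
    proof (rule avg_near[OF c(1)])
      fix x assume x: "x \<in> cell (n + k) (c k)"
      have "dist x p < d" using cell_diameter[OF x c(2)] elim by simp
      moreover have "x \<in> K" using x cell_subset_K[OF c(1)] by blast
      ultimately show "\<bar>v x - v p\<bar> \<le> e / 2" using d(2)[of x] by (simp add: dist_real_def)
    qed (use \<open>0 < e\<close> in simp)
    then show ?case using \<open>0 < e\<close> by (simp add: dist_real_def)
  qed
qed

text \<open>The constant solves the recursion \<open>2 * a / 9 + 42 \<le> a\<close> that arises when one
  step towards the corner is split off.\<close>

lemma sum_avg_corner_descendant:
  assumes "e \<in> insert (0, 0) corners"
  shows "1 \<le> n \<Longrightarrow> (\<Sum>c\<in>cs n. (avg (n + k) (corner_descendant k e c) - avg n c)\<^sup>2) \<le> 54 * C * q ^ n"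
proof (induction k arbitrary: n)
  case 0
  then show ?case using C_nonneg q by simp
next
  case (Suc k)
  let ?i = "(4 * fst e, 4 * snd e)"
  have i: "?i \<in> D" using assms by (rule corner_digit)
  let ?g = "\<lambda>c. (avg (Suc n + k) (corner_descendant k e c) - avg (Suc n) c)\<^sup>2"
  have "(\<Sum>c\<in>cs n. (avg (n + Suc k) (corner_descendant (Suc k) e c) - avg n c)\<^sup>2)
      \<le> (\<Sum>c\<in>cs n. 2 * ?g (child c ?i) + 2 * (avg n c - avg (Suc n) (child c ?i))\<^sup>2)"
  proof (rule sum_mono)
    fix c
    show "(avg (n + Suc k) (corner_descendant (Suc k) e c) - avg n c)\<^sup>2
      \<le> 2 * ?g (child c ?i) + 2 * (avg n c - avg (Suc n) (child c ?i))\<^sup>2"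
      using square_sum_le[of "avg (Suc n + k) (corner_descendant k e (child c ?i)) - avg (Suc n) (child c ?i)"
        "avg (Suc n) (child c ?i) - avg n c"] by (simp add: power2_commute[of "avg n c"])
  qed
  also have "\<dots> = 2 * (\<Sum>c\<in>cs n. ?g (child c ?i)) + 2 * (\<Sum>c\<in>cs n. (avg n c - avg (Suc n) (child c ?i))\<^sup>2)"
    by (simp only: sum.distrib sum_distrib_left)
  also have "\<dots> \<le> 2 * (54 * C * q ^ Suc n) + 2 * (21 * C * q ^ n)"
  proof (intro add_mono mult_left_mono)
    have "(\<Sum>c\<in>cs n. ?g (child c ?i)) \<le> (\<Sum>c\<in>cs n. \<Sum>i\<in>D. ?g (child c i))"
    proof (rule sum_mono)
      fix c
      show "?g (child c ?i) \<le> (\<Sum>i\<in>D. ?g (child c i))"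
        by (rule member_le_sum[OF i, of "\<lambda>i. ?g (child c i)"]) simp_all
    qed
    also have "\<dots> = (\<Sum>c\<in>cs (Suc n). ?g c)" by (rule sum_cs_Suc[symmetric])
    also have "\<dots> \<le> 54 * C * q ^ Suc n" by (rule Suc.IH) simp
    finally show "(\<Sum>c\<in>cs n. ?g (child c ?i)) \<le> 54 * C * q ^ Suc n" .
    show "(\<Sum>c\<in>cs n. (avg n c - avg (Suc n) (child c ?i))\<^sup>2) \<le> 21 * C * q ^ n"
      by (rule sum_avg_child[OF Suc.prems i])
  qed simp_all
  also have "\<dots> = (108 * q + 42) * (C * q ^ n)" by (simp add: algebra_simps)
  also have "\<dots> \<le> 54 * (C * q ^ n)" using q C_nonneg by (intro mult_right_mono) auto
  finally show ?case by simp
qed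

lemma sum_vertex_avg:
  assumes e: "e \<in> insert (0, 0) corners" and "1 \<le> n"
  shows "(\<Sum>c\<in>cs n. (v (vertex n c e) - avg n c)\<^sup>2) \<le> 54 * C * q ^ n"
proof (rule LIMSEQ_le_const2)
  show "(\<lambda>k. \<Sum>c\<in>cs n. (avg (n + k) (corner_descendant k e c) - avg n c)\<^sup>2)
    \<longlonglongrightarrow> (\<Sum>c\<in>cs n. (v (vertex n c e) - avg n c)\<^sup>2)"
  proof (intro tendsto_sum tendsto_power tendsto_diff tendsto_const avg_tendsto)
    fix c k assume "c \<in> cs n"
    then show "corner_descendant k e c \<in> cs (n + k)" by (rule corner_descendant_in_cs[OF e])
    show "vertex n c e \<in> cell (n + k) (corner_descendant k e c)"
      using vertex_in_cell[OF e, of "n + k" "corner_descendant k e c"] by (simp only: vertex_corner_descendant)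
  qed
  show "\<exists>N. \<forall>k\<ge>N. (\<Sum>c\<in>cs n. (avg (n + k) (corner_descendant k e c) - avg n c)\<^sup>2) \<le> 54 * C * q ^ n"
    using sum_avg_corner_descendant[OF assms] by blast
qed

lemma sum_half_diagonal:
  assumes e: "e \<in> corners" and "1 \<le> n"
  shows "(\<Sum>c\<in>cs n. (v (vertex n c e) - v (vertex n c (0, 0)))\<^sup>2) \<le> 216 * C * q ^ n"
proof -
  have "(\<Sum>c\<in>cs n. (v (vertex n c e) - v (vertex n c (0, 0)))\<^sup>2)
    \<le> (\<Sum>c\<in>cs n. 2 * (v (vertex n c e) - avg n c)\<^sup>2 + 2 * (v (vertex n c (0, 0)) - avg n c)\<^sup>2)"
  proof (rule sum_mono)
    fix c
    show "(v (vertex n c e) - v (vertex n c (0, 0)))\<^sup>2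
      \<le> 2 * (v (vertex n c e) - avg n c)\<^sup>2 + 2 * (v (vertex n c (0, 0)) - avg n c)\<^sup>2"
      using square_sum_le[of "v (vertex n c e) - avg n c" "avg n c - v (vertex n c (0, 0))"]
      by (simp add: power2_commute[of "avg n c"])
  qed
  also have "\<dots> = 2 * (\<Sum>c\<in>cs n. (v (vertex n c e) - avg n c)\<^sup>2) + 2 * (\<Sum>c\<in>cs n. (v (vertex n c (0, 0)) - avg n c)\<^sup>2)"
    by (simp only: sum.distrib sum_distrib_left)
  also have "\<dots> \<le> 2 * (54 * C * q ^ n) + 2 * (54 * C * q ^ n)"
    using e assms(2) by (intro add_mono mult_left_mono sum_vertex_avg) auto
  finally show ?thesis by simp
qed

lemma total_energy_bound:
  assumes "1 \<le> n"
  shows "(\<Sum>c\<in>cs n. main_energy v n c + anti_energy v n c) \<le> 864 * C * q ^ n"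
proof -
  let ?d = "\<lambda>e c. (v (vertex n c e) - v (vertex n c (0, 0)))\<^sup>2"
  have "(\<Sum>c\<in>cs n. main_energy v n c + anti_energy v n c)
    = (\<Sum>c\<in>cs n. ?d (1, 1) c) + (\<Sum>c\<in>cs n. ?d (-1, -1) c) + ((\<Sum>c\<in>cs n. ?d (1, -1) c) + (\<Sum>c\<in>cs n. ?d (-1, 1) c))"
    by (simp add: main_energy_def anti_energy_def main_ends_def anti_ends_def sum.distrib)
  also have "\<dots> \<le> 216 * C * q ^ n + 216 * C * q ^ n + (216 * C * q ^ n + 216 * C * q ^ n)"
    using assms by (intro add_mono sum_half_diagonal) (simp_all add: corners_iff)
  finally show ?thesis by simp
qed

lemma energy_bound_all_scales:
  assumes "c \<in> cs n"
  shows "main_energy v n c + (1 + real (Suc j) / 20) * anti_energy v n c \<le> 864 * C * q ^ n * (9 * q) ^ Suc j"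
proof -
  let ?f = "\<lambda>c. main_energy v n c + (1 + real (Suc j) / 20) * anti_energy v n c"
  have "?f c \<le> (\<Sum>c\<in>cs n. ?f c)"
    by (rule member_le_sum[OF assms]) (simp_all add: energy_nonneg)
  also have "\<dots> \<le> 9 ^ Suc j * (\<Sum>c\<in>cs (n + Suc j). main_energy v (n + Suc j) c + anti_energy v (n + Suc j) c)"
    by (rule total_energy_growth)
  also have "\<dots> \<le> 9 ^ Suc j * (864 * C * q ^ (n + Suc j))"
    by (intro mult_left_mono total_energy_bound) auto
  also have "\<dots> = 864 * C * q ^ n * (9 * q) ^ Suc j" by (simp add: power_add power_mult_distrib)
  finally show ?thesis .
qed

text \<open>The bound does not depend on the depth \<open>j\<close>, while the weight of the energy
  along the anti-diagonals grows linearly in \<open>j\<close>.\<close>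

lemma anti_energy_zero:
  assumes "c \<in> cs n" shows "anti_energy v n c = 0"
proof (rule ccontr)
  assume "anti_energy v n c \<noteq> 0"
  then have pos: "0 < anti_energy v n c" using energy_nonneg(2)[of v n c] by linarith
  let ?M = "864 * C * q ^ n"
  obtain j where j: "20 * ?M / anti_energy v n c < real j" using reals_Archimedean2 by blast
  have "(1 + real (Suc j) / 20) * anti_energy v n c \<le> ?M * (9 * q) ^ Suc j"
    using energy_bound_all_scales[OF assms, of j] energy_nonneg(1)[of v n c] by linarith
  also have "\<dots> \<le> ?M * 1"
    using C_nonneg q by (intro mult_left_mono power_le_one) auto
  finally have "(1 + real (Suc j) / 20) * anti_energy v n c \<le> ?M" by simp
  moreover have "?M < real j / 20 * anti_energy v n c" using j pos by (simp add: field_simps)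
  moreover have "real j / 20 * anti_energy v n c \<le> (1 + real (Suc j) / 20) * anti_energy v n c"
    using pos by (intro mult_right_mono) (simp_all add: add_divide_distrib)
  ultimately show False by linarith
qed

lemma main_energy_zero:
  assumes "q < 1 / 9" and "c \<in> cs n" shows "main_energy v n c = 0"
proof -
  have "(\<lambda>j. 864 * C * q ^ n * (9 * q) ^ Suc j) \<longlonglongrightarrow> 864 * C * q ^ n * 0"
    using q assms(1) by (intro tendsto_mult_left LIMSEQ_power_zero[THEN LIMSEQ_Suc]) auto
  moreover have "main_energy v n c \<le> 864 * C * q ^ n * (9 * q) ^ Suc j" for j
    using energy_bound_all_scales[OF assms(2), of j] by (simp add: anti_energy_zero[OF assms(2)])
  ultimately have "main_energy v n c \<le> 864 * C * q ^ n * 0" using LIMSEQ_le_const by blast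
  then show ?thesis using energy_nonneg(1)[of v n c] by simp
qed

lemma anti_vertex_eq:
  assumes "c \<in> cs n" "e \<in> anti_ends" shows "v (vertex n c e) = v (vertex n c (0, 0))"
  using anti_energy_zero[OF assms(1)] assms(2)
  by (auto simp: anti_energy_def anti_ends_def sum_nonneg_eq_0_iff)

lemma main_vertex_eq:
  assumes "q < 1 / 9" "c \<in> cs n" "e \<in> main_ends" shows "v (vertex n c e) = v (vertex n c (0, 0))"
  using main_energy_zero[OF assms(1,2)] assms(3)
  by (auto simp: main_energy_def main_ends_def sum_nonneg_eq_0_iff)

text \<open>A line of slope \<open>-1\<close> that stays in the cells of one level over a full cell width runs along
  their diagonals: beside a diagonal it would have to leave the cells of the checkerboard colour.\<close>

lemma anti_line_cell:
  fixes j :: int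
  assumes inK: "\<And>X. lo \<le> X \<Longrightarrow> X \<le> hi \<Longrightarrow> (X, S - X) \<in> K"
    and j: "9 ^ n * lo \<le> of_int j - 1 / 2" "of_int j + 1 / 2 \<le> 9 ^ n * hi"
  obtains i where "of_int i = 9 ^ n * S - of_int j" "(j, i) \<in> cs n"
proof -
  have find: "\<exists>c\<in>cs n. \<bar>t - of_int (fst c)\<bar> \<le> 1 / 2 \<and> \<bar>9 ^ n * S - t - of_int (snd c)\<bar> \<le> 1 / 2"
    if "9 ^ n * lo \<le> t" "t \<le> 9 ^ n * hi" for t
  proof -
    have "lo \<le> t / 9 ^ n" "t / 9 ^ n \<le> hi" using that by (simp_all add: field_simps)
    then have "(t / 9 ^ n, S - t / 9 ^ n) \<in> K" by (rule inK)
    then obtain c where "c \<in> cs n" "(t / 9 ^ n, S - t / 9 ^ n) \<in> cell n c" by (elim K_cellE)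
    then show ?thesis using cell_square[of "(t / 9 ^ n, S - t / 9 ^ n)" n c]
      by (intro bexI[of _ c]) (simp_all add: right_diff_distrib)
  qed
  obtain c where c: "c \<in> cs n" "\<bar>of_int j - of_int (fst c)\<bar> \<le> (1 / 2 :: real)"
    "\<bar>9 ^ n * S - of_int j - of_int (snd c)\<bar> \<le> 1 / 2"
    using find[of "of_int j"] j by auto
  have fc: "fst c = j" using c(2) by linarith
  define w where "w = 9 ^ n * S - of_int j - of_int (snd c)"
  have w: "\<bar>w\<bar> \<le> 1 / 2" using c(3) by (simp add: w_def)
  have "w = 0"
  proof (rule ccontr)
    assume "w \<noteq> 0"
    \<comment> \<open>Close to the side of the strip on which the line leaves the square of \<open>c\<close>, the next cell of the
      same strip would have an index of the wrong parity.\<close>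
    define \<epsilon> where "\<epsilon> = \<bar>w\<bar> / 2"
    have \<epsilon>: "0 < \<epsilon>" "\<epsilon> < \<bar>w\<bar>" "\<epsilon> \<le> 1 / 4" using \<open>w \<noteq> 0\<close> w by (simp_all add: \<epsilon>_def)
    show False
    proof (cases "0 < w")
      case True
      obtain c' where c': "c' \<in> cs n" "\<bar>of_int j - 1 / 2 + \<epsilon> - of_int (fst c')\<bar> \<le> 1 / 2"
        "\<bar>9 ^ n * S - (of_int j - 1 / 2 + \<epsilon>) - of_int (snd c')\<bar> \<le> 1 / 2"
        using find[of "of_int j - 1 / 2 + \<epsilon>"] j \<epsilon> by auto
      have "fst c' = j" using c'(2) \<epsilon> by linarith
      moreover have "snd c' = snd c + 1" using c'(3) \<epsilon> w True unfolding w_def by linarith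
      ultimately show False using cs_even[OF c(1)] cs_even[OF c'(1)] fc by simp
    next
      case False
      obtain c' where c': "c' \<in> cs n" "\<bar>of_int j + 1 / 2 - \<epsilon> - of_int (fst c')\<bar> \<le> 1 / 2"
        "\<bar>9 ^ n * S - (of_int j + 1 / 2 - \<epsilon>) - of_int (snd c')\<bar> \<le> 1 / 2"
        using find[of "of_int j + 1 / 2 - \<epsilon>"] j \<epsilon> by auto
      have "fst c' = j" using c'(2) \<epsilon> by linarith
      moreover have "snd c = snd c' + 1" using c'(3) \<epsilon> w False unfolding w_def by linarith
      ultimately show False using cs_even[OF c(1)] cs_even[OF c'(1)] fc by simp
    qed
  qed
  then show ?thesis using that[of "snd c"] c(1) fc by (metis diff_eq_diff_eq diff_zero prod.collapse w_def)
qed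

text \<open>Diagonals of consecutive cells share a corner, so the function takes one value at all their
  centres. The centres become dense in the segment as the level grows.\<close>

lemma anti_line_constant:
  assumes "lo < hi" and inK: "\<And>X. lo \<le> X \<Longrightarrow> X \<le> hi \<Longrightarrow> (X, S - X) \<in> K"
    and X: "lo \<le> X" "X \<le> hi" and Y: "lo \<le> Y" "Y \<le> hi"
  shows "v (X, S - X) = v (Y, S - Y)"
proof -
  define w where "w t = v (t, S - t)" for t
  have step: "w (of_int j / 9 ^ n) = w ((of_int j + 1 / 2) / 9 ^ n) \<and> w (of_int j / 9 ^ n) = w ((of_int j - 1 / 2) / 9 ^ n)"
    if h: "9 ^ n * lo \<le> of_int j - 1 / 2" "of_int j + 1 / 2 \<le> 9 ^ n * hi" for n and j :: int
  proof -
    obtain i where i: "of_int i = 9 ^ n * S - of_int j" "(j, i) \<in> cs n"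
      using anti_line_cell[OF inK h] by blast
    have "v (vertex n (j, i) (1, -1)) = v (vertex n (j, i) (0, 0))" "v (vertex n (j, i) (-1, 1)) = v (vertex n (j, i) (0, 0))"
      using i(2) by (intro anti_vertex_eq; simp add: anti_ends_def)+
    moreover have "vertex n (j, i) (0, 0) = (of_int j / 9 ^ n, S - of_int j / 9 ^ n)"
      "vertex n (j, i) (1, -1) = ((of_int j + 1 / 2) / 9 ^ n, S - (of_int j + 1 / 2) / 9 ^ n)"
      "vertex n (j, i) (-1, 1) = ((of_int j - 1 / 2) / 9 ^ n, S - (of_int j - 1 / 2) / 9 ^ n)"
      by (intro prod_eqI; simp add: fst_vertex snd_vertex i(1) field_simps)+
    ultimately show ?thesis by (simp add: w_def)
  qed
  have chain: "w (of_int j / 9 ^ n) = w (of_int (j + int m) / 9 ^ n)"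
    if "9 ^ n * lo \<le> of_int j - 1 / 2" "of_int (j + int m) + 1 / 2 \<le> 9 ^ n * hi" for n m and j :: int
    using that(2)
  proof (induction m)
    case (Suc m)
    have "w (of_int (j + int m) / 9 ^ n) = w ((of_int (j + int m) + 1 / 2) / 9 ^ n)"
      using step[of n "j + int m"] that(1) Suc.prems by simp
    moreover have "w (of_int (j + int (Suc m)) / 9 ^ n) = w ((of_int (j + int (Suc m)) - 1 / 2) / 9 ^ n)"
      using step[of n "j + int (Suc m)"] that(1) Suc.prems by simp
    moreover have "(of_int (j + int m) + 1 / 2 :: real) = of_int (j + int (Suc m)) - 1 / 2" by simp
    moreover have "w (of_int j / 9 ^ n) = w (of_int (j + int m) / 9 ^ n)"
      using Suc.prems by (intro Suc.IH) simp
    ultimately show ?case by metis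
  qed simp
  have conn: "w (of_int j / 9 ^ n) = w (of_int j' / 9 ^ n)"
    if "9 ^ n * lo \<le> of_int j - 1 / 2" "of_int j + 1 / 2 \<le> 9 ^ n * hi"
      "9 ^ n * lo \<le> of_int j' - 1 / 2" "of_int j' + 1 / 2 \<le> 9 ^ n * hi" for n and j j' :: int
  proof (cases "j \<le> j'")
    case True
    then have "j' = j + int (nat (j' - j))" by simp
    then show ?thesis using chain[of n j "nat (j' - j)"] that by metis
  next
    case False
    then have "j = j' + int (nat (j - j'))" by simp
    then show ?thesis using chain[of n j' "nat (j - j')"] that by metis
  qed
  have near: "\<exists>j::int. 9 ^ n * lo \<le> of_int j - 1 / 2 \<and> of_int j + 1 / 2 \<le> 9 ^ n * hi \<and> \<bar>of_int j - 9 ^ n * t\<bar> \<le> 2"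
    if "4 / 9 ^ n < hi - lo" "lo \<le> t" "t \<le> hi" for n t
  proof -
    have len: "9 ^ n * lo + 4 < 9 ^ n * hi" using that(1) by (simp add: field_simps)
    have t: "9 ^ n * lo \<le> 9 ^ n * t" "9 ^ n * t \<le> 9 ^ n * hi" using that by simp_all
    show ?thesis
    proof (cases "9 ^ n * t < 9 ^ n * lo + 2")
      case True
      show ?thesis by (rule exI[of _ "\<lceil>9 ^ n * lo + 1 / 2\<rceil>"]) (use True len t in \<open>intro conjI; linarith\<close>)
    next
      case False
      show ?thesis by (rule exI[of _ "\<lfloor>9 ^ n * t - 1 / 2\<rfloor>"]) (use False len t in \<open>intro conjI; linarith\<close>)
    qed
  qed
  have wc: "\<exists>d>0. \<forall>t. lo \<le> t \<and> t \<le> hi \<and> \<bar>t - z\<bar> < d \<longrightarrow> \<bar>w t - w z\<bar> < e" if z: "lo \<le> z" "z \<le> hi" "0 < e" for z e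
  proof -
    obtain d where d: "0 < d" "\<And>x. x \<in> K \<Longrightarrow> dist x (z, S - z) < d \<Longrightarrow> dist (v x) (v (z, S - z)) < e"
      using v_continuous inK[OF z(1,2)] z(3) unfolding continuous_on_iff by meson
    show ?thesis
    proof (intro exI[of _ "d / 2"] conjI allI impI)
      fix t assume t: "lo \<le> t \<and> t \<le> hi \<and> \<bar>t - z\<bar> < d / 2"
      have "dist (t, S - t) (z, S - z) \<le> \<bar>t - z\<bar> + \<bar>t - z\<bar>"
        using dist_le_coordinates[of "(t, S - t)" "(z, S - z)"] by (simp add: abs_minus_commute)
      then have "dist (v (t, S - t)) (v (z, S - z)) < e" using t inK by (intro d(2)) auto
      then show "\<bar>w t - w z\<bar> < e" by (simp add: w_def dist_real_def)
    qed (use d in simp)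
  qed
  have "\<bar>w X - w Y\<bar> \<le> 0"
  proof (rule field_le_epsilon)
    fix e :: real assume "0 < e"
    obtain d1 where d1: "0 < d1" "\<And>t. lo \<le> t \<Longrightarrow> t \<le> hi \<Longrightarrow> \<bar>t - X\<bar> < d1 \<Longrightarrow> \<bar>w t - w X\<bar> < e / 2"
      using wc[OF X, of "e / 2"] \<open>0 < e\<close> by auto
    obtain d2 where d2: "0 < d2" "\<And>t. lo \<le> t \<Longrightarrow> t \<le> hi \<Longrightarrow> \<bar>t - Y\<bar> < d2 \<Longrightarrow> \<bar>w t - w Y\<bar> < e / 2"
      using wc[OF Y, of "e / 2"] \<open>0 < e\<close> by auto
    have "0 < min (hi - lo) (min d1 d2)" using assms(1) d1 d2 by simp
    from two_nine_powers_small[OF this, of 4 0]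
    obtain n where n: "4 / 9 ^ n < min (hi - lo) (min d1 d2)"
      using eventually_happens'[OF sequentially_bot] by fastforce
    obtain j where j: "9 ^ n * lo \<le> of_int j - 1 / 2" "of_int j + 1 / 2 \<le> 9 ^ n * hi" "\<bar>of_int j - 9 ^ n * X\<bar> \<le> 2"
      using near[of n X] n X by auto
    obtain j' where j': "9 ^ n * lo \<le> of_int j' - 1 / 2" "of_int j' + 1 / 2 \<le> 9 ^ n * hi" "\<bar>of_int j' - 9 ^ n * Y\<bar> \<le> 2"
      using near[of n Y] n Y by auto
    have close: "lo \<le> of_int i / 9 ^ n \<and> of_int i / 9 ^ n \<le> hi \<and> \<bar>of_int i / 9 ^ n - t\<bar> \<le> 2 / 9 ^ n"
      if "9 ^ n * lo \<le> of_int i - 1 / 2" "of_int i + 1 / 2 \<le> 9 ^ n * hi" "\<bar>of_int i - 9 ^ n * t\<bar> \<le> 2" for t :: real and i :: int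
    proof -
      have "of_int i / 9 ^ n - t = (of_int i - 9 ^ n * t) / 9 ^ n" by (simp add: field_simps)
      then have "\<bar>of_int i / 9 ^ n - t\<bar> = \<bar>of_int i - 9 ^ n * t\<bar> / 9 ^ n" by simp
      then have "\<bar>of_int i / 9 ^ n - t\<bar> \<le> 2 / 9 ^ n" using that(3) by (simp add: divide_right_mono)
      moreover have "9 ^ n * lo \<le> of_int i" "of_int i \<le> 9 ^ n * hi" using that(1,2) by linarith+
      ultimately show ?thesis by (simp add: field_simps)
    qed
    have "(2::real) / 9 ^ n < 4 / 9 ^ n" by (simp add: field_simps)
    then have "2 / 9 ^ n < d1" "2 / 9 ^ n < d2" using n by auto
    then have "\<bar>w (of_int j / 9 ^ n) - w X\<bar> < e / 2" "\<bar>w (of_int j' / 9 ^ n) - w Y\<bar> < e / 2"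
      using close[OF j] close[OF j'] by (intro d1 d2; simp)+
    then show "\<bar>w X - w Y\<bar> \<le> 0 + e" using conn[OF j(1,2) j'(1,2)] by linarith
  qed
  then show ?thesis by (simp add: w_def)
qed

lemma constant_on_anti_segment:
  assumes "closed_segment a b \<subseteq> K" and ab: "b - a = t *\<^sub>R (p4 - p2)"
  shows "v constant_on closed_segment a b"
proof (cases "t = 0")
  case True
  then have "b = a" using ab by simp
  then show ?thesis by (simp add: constant_on_def)
next
  case False
  have b: "b = (fst a - t, snd a + t)"
    using ab by (simp add: p2_def p4_def prod_eq_iff algebra_simps)
  define S where "S = fst a + snd a"
  define lo where "lo = min (fst a) (fst a - t)" define hi where "hi = max (fst a) (fst a - t)"
  have "lo < hi" using False by (auto simp: lo_def hi_def)
  have on: "x \<in> closed_segment a b \<Longrightarrow> lo \<le> fst x \<and> fst x \<le> hi \<and> x = (fst x, S - fst x)" for x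
  proof -
    assume "x \<in> closed_segment a b"
    then obtain r where r: "0 \<le> r" "r \<le> 1" "x = (1 - r) *\<^sub>R a + r *\<^sub>R b" by (auto simp: in_segment)
    then have "fst x = (1 - r) * fst a + r * fst b" "snd x = (1 - r) * snd a + r * snd b" by simp_all
    then have f: "fst x = fst a - r * t" "snd x = snd a + r * t" by (simp_all add: b algebra_simps)
    have "r * t \<le> max 0 t" "min 0 t \<le> r * t"
      using r(1,2) by (auto simp: max_def min_def mult_left_le_one_le mult_le_0_iff zero_le_mult_iff
        intro: mult_left_le_one_le)
    then show "lo \<le> fst x \<and> fst x \<le> hi \<and> x = (fst x, S - fst x)"
      by (auto simp: f lo_def hi_def S_def prod_eq_iff)
  qed
  have inK: "(X, S - X) \<in> K" if "lo \<le> X" "X \<le> hi" for X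
  proof -
    define r where "r = (fst a - X) / t"
    have rt: "r * t = fst a - X" using False by (simp add: r_def)
    have "0 \<le> r" "r \<le> 1" using that False
      by (auto simp: r_def lo_def hi_def min_def max_def field_simps split: if_splits)
    moreover have "(X, S - X) = (1 - r) *\<^sub>R a + r *\<^sub>R b"
      using rt by (simp add: b S_def prod_eq_iff algebra_simps)
    ultimately have "(X, S - X) \<in> closed_segment a b" unfolding in_segment by blast
    then show ?thesis using assms(1) by blast
  qed
  have "v x = v a" if x: "x \<in> closed_segment a b" for x
  proof -
    have "lo \<le> fst a" "fst a \<le> hi" by (simp_all add: lo_def hi_def)
    then have "v (fst x, S - fst x) = v (fst a, S - fst a)"
      using on[OF x] by (intro anti_line_constant[OF \<open>lo < hi\<close> inK]) auto
    moreover have "(fst x, S - fst x) = x" "(fst a, S - fst a) = a"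
      using on[OF x] by (simp_all add: S_def)
    ultimately show ?thesis by simp
  qed
  then show ?thesis unfolding constant_on_def by blast
qed

text \<open>The children of a cell are connected through shared corners.\<close>

lemma centres_in_parent_equal:
  assumes "q < 1 / 9" "c \<in> cs n" "i \<in> D"
  shows "v (vertex (Suc n) (child c i) (0, 0)) = v (vertex n c (0, 0))"
proof -
  define g where "g i = v (vertex (Suc n) (child c i) (0, 0))" for i
  have vert: "v (vertex (Suc n) (child c i) e) = g i" if "i \<in> D" "e \<in> corners" for i e
    using that anti_vertex_eq main_vertex_eq[OF assms(1)] child_in_cs[OF assms(2)]
    unfolding g_def corners_def by blast
  have adj: "g (i + e) = g i" if "i \<in> D" "i + e \<in> D" "e \<in> corners" for i e
  proof -
    have "child c (i + e) = child c i + e" by (simp add: prod_eq_iff)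
    then have "v (vertex (Suc n) (child c (i + e)) (- e)) = v (vertex (Suc n) (child c i) e)"
      by (simp only: vertex_shared[of "Suc n" "child c i" e, symmetric])
    then show ?thesis using vert that uminus_corners by metis
  qed
  have k: "(1, 1) \<in> corners" "(-1, -1) \<in> corners" "(1, -1) \<in> corners" "(-1, 1) \<in> corners"
    by (simp_all add: corners_iff)
  have "g i = g (0, 0)"
  proof (rule D_explicit)
    fix s s' :: int
    assume s: "s = 1 \<or> s = -1" "s' = 1 \<or> s' = -1" and D: "D = {(0,0), (1,1), (2,2), (3,3), (4,4), (-1,-1), (-2,-2), (-3,-3), (-4,-4),
          (1,-1), (2,-2), (3,-3), (4,-4), (-1,1), (-2,2), (-3,3), (-4,4),
          (s + 2, s - 2), (s + 3, s - 3), (s' - 2, s' + 2), (s' - 3, s' + 3)}"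
    have a: "g (i1 + e1, i2 + e2) = g (i1, i2)" if "(i1, i2) \<in> D" "(i1 + e1, i2 + e2) \<in> D" "(e1, e2) \<in> corners" for i1 i2 e1 e2
      using adj[of "(i1, i2)" "(e1, e2)"] that by simp
    have d: "g (1,1) = g (0,0)" "g (2,2) = g (1,1)" "g (3,3) = g (2,2)" "g (4,4) = g (3,3)"
      "g (-1,-1) = g (0,0)" "g (-2,-2) = g (-1,-1)" "g (-3,-3) = g (-2,-2)" "g (-4,-4) = g (-3,-3)"
      "g (1,-1) = g (0,0)" "g (2,-2) = g (1,-1)" "g (3,-3) = g (2,-2)" "g (4,-4) = g (3,-3)"
      "g (-1,1) = g (0,0)" "g (-2,2) = g (-1,1)" "g (-3,3) = g (-2,2)" "g (-4,4) = g (-3,3)"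
      using a[of 0 0 1 1] a[of 1 1 1 1] a[of 2 2 1 1] a[of 3 3 1 1]
        a[of 0 0 "-1" "-1"] a[of "-1" "-1" "-1" "-1"] a[of "-2" "-2" "-1" "-1"] a[of "-3" "-3" "-1" "-1"]
        a[of 0 0 1 "-1"] a[of 1 "-1" 1 "-1"] a[of 2 "-2" 1 "-1"] a[of 3 "-3" 1 "-1"]
        a[of 0 0 "-1" 1] a[of "-1" 1 "-1" 1] a[of "-2" 2 "-1" 1] a[of "-3" 3 "-1" 1]
      by (simp_all add: D k)
    have ss: "(s, s) \<in> corners" "(s', s') \<in> corners" using s k by auto
    have e: "g (s + 2, s - 2) = g (2, -2)" "g (s + 3, s - 3) = g (3, -3)"
      "g (s' - 2, s' + 2) = g (-2, 2)" "g (s' - 3, s' + 3) = g (-3, 3)"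
      using a[of 2 "-2" s s] a[of 3 "-3" s s] a[of "-2" 2 s' s'] a[of "-3" 3 s' s'] ss
      by (simp_all add: D add.commute)
    show ?thesis using assms(3) d e unfolding D by (elim insertE emptyE) simp_all
  qed
  moreover have "g (0, 0) = v (vertex n c (0, 0))"
    unfolding g_def using vertex_corner_child[of n c "(0, 0)"] by simp
  ultimately show ?thesis by (simp add: g_def)
qed

lemma constant_above_critical:
  assumes "q < 1 / 9" "x \<in> K" shows "v x = v (0, 0)"
proof -
  have centre: "v (vertex n c (0, 0)) = v (0, 0)" if "c \<in> cs n" for n c
    using that
  proof (induction n arbitrary: c)
    case 0
    then have "vertex 0 c (0, 0) = (0, 0)" by (intro prod_eqI) (simp_all add: fst_vertex snd_vertex)
    then show ?case by simp
  next
    case (Suc n)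
    then obtain a i where a: "a \<in> cs n" "i \<in> D" "c = child a i" by (elim cs_SucE)
    then show ?case using centres_in_parent_equal[OF assms(1) a(1,2)] Suc.IH[OF a(1)] by simp
  qed
  have "\<bar>v x - v (0, 0)\<bar> \<le> 0"
  proof (rule field_le_epsilon)
    fix e :: real assume "0 < e"
    obtain d where d: "0 < d" "\<And>y. y \<in> K \<Longrightarrow> dist y x < d \<Longrightarrow> dist (v y) (v x) < e"
      using v_continuous assms(2) \<open>0 < e\<close> unfolding continuous_on_iff by meson
    obtain n where n: "2 / 9 ^ n < d"
      using eventually_happens'[OF sequentially_bot two_nine_powers_small[OF d(1), of 2 0]] by auto
    obtain c where c: "c \<in> cs n" "x \<in> cell n c" using assms(2) by (elim K_cellE)
    have "vertex n c (0, 0) \<in> cell n c" by (rule vertex_in_cell) simp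
    then have "dist (v (vertex n c (0, 0))) (v x) < e"
      using cell_diameter[of "vertex n c (0, 0)" n c x] c vertex_in_K'[OF c(1), of "(0, 0)"] n by (intro d(2)) auto
    then show "\<bar>v x - v (0, 0)\<bar> \<le> 0 + e" unfolding centre[OF c(1)] by (simp add: dist_real_def)
  qed
  then show ?thesis by simp
qed

end

context eyebolted_cross
begin

text \<open>The rate is \<open>q = 9 powr (hdim - 2 * \<sigma>)\<close>, because the seminorm carries
  the exponent \<open>hdim + 2 * \<sigma>\<close> and \<open>9 powr (2 * hdim) = 441\<close>.\<close>

lemma besov_finite_energy:
  assumes u: "u \<in> besov \<mu> hdim \<sigma>" and \<sigma>: "(1 + hdim) / 2 \<le> \<sigma>"
  obtains C q where "finite_energy L U K u C q" "(1 + hdim) / 2 < \<sigma> \<Longrightarrow> q < 1 / 9"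
proof -
  define S where "S = enn2real (besov_seminorm_sq \<mu> hdim \<sigma> u)"
  have fin: "besov_seminorm_sq \<mu> hdim \<sigma> u < \<infinity>" and L2: "u \<in> L2_space \<mu>" using u by (simp_all add: besov_def)
  have S: "besov_seminorm_sq \<mu> hdim \<sigma> u = ennreal S" "0 \<le> S" using fin by (simp_all add: S_def less_top)
  define \<beta> where "\<beta> = hdim + 2 * \<sigma>"
  define q where "q = 441 * 9 powr (- \<beta>)"
  have "9 powr (- 2 * hdim) = 1 / 441"
  proof -
    have "9 powr (- 2 * hdim) = (9 powr hdim) powr (- 2)" by (simp add: powr_powr mult.commute)
    also have "9 powr hdim = 21" using nine_powr_hdim(1)[of 1] by simp
    also have "(21::real) powr (- 2) = 1 / 441" by (simp add: powr_minus_divide)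
    finally show ?thesis .
  qed
  moreover have "9 powr (- \<beta>) = 9 powr (- 2 * hdim) * 9 powr (hdim - 2 * \<sigma>)"
    by (simp add: \<beta>_def flip: powr_add)
  ultimately have q: "q = 9 powr (hdim - 2 * \<sigma>)" by (simp add: q_def)
  have q9: "9 powr (-1) = (1 / 9 :: real)" by (simp add: powr_minus_divide)
  have "q \<le> 1 / 9" unfolding q q9[symmetric] using \<sigma> by (intro powr_mono) auto
  have "q < 1 / 9" if "(1 + hdim) / 2 < \<sigma>" unfolding q q9[symmetric] using that by (intro powr_less_mono) auto
  moreover have "finite_energy L U K u (S * 6 powr \<beta>) q"
  proof
    show "u \<in> L2_space \<mu>" by (rule L2)
    show "0 \<le> S * 6 powr \<beta>" using S by simp
    show "0 < q" by (simp add: q)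
    show "q \<le> 1 / 9" by fact
    fix n :: nat assume n: "1 \<le> n"
    let ?r = "6 / 9 ^ n :: real"
    have "(9::real) ^ 1 \<le> 9 ^ n" using n by (intro power_increasing) auto
    then have r: "0 < ?r" "?r < 1" by (simp_all add: field_simps)
    have "ennreal (?r powr (- hdim - 2 * \<sigma>)) * ball_energy \<mu> u ?r \<le> ennreal S"
      unfolding S(1)[symmetric] besov_seminorm_sq_def ball_energy_def using r by (intro SUP_upper) auto
    then have "ennreal (?r powr \<beta>) * (ennreal (?r powr (- hdim - 2 * \<sigma>)) * ball_energy \<mu> u ?r) \<le> ennreal (?r powr \<beta>) * ennreal S"
      by (intro mult_left_mono) auto
    moreover have "?r powr \<beta> * ?r powr (- hdim - 2 * \<sigma>) = 1"
      using r unfolding powr_add[symmetric] by (simp add: \<beta>_def)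
    ultimately have "ball_energy \<mu> u ?r \<le> ennreal (?r powr \<beta> * S)"
      using S(2) by (simp add: mult.assoc[symmetric] ennreal_mult[symmetric])
    also have "?r powr \<beta> * S = S * 6 powr \<beta> * q ^ n / 441 ^ n"
    proof -
      have "?r powr \<beta> = 6 powr \<beta> * (9 powr (- \<beta>)) ^ n"
        by (simp add: powr_divide powr_minus_divide power_divide powr_power mult.commute flip: powr_realpow powr_powr)
           (simp add: powr_powr mult.commute)
      then show ?thesis by (simp add: q_def power_mult_distrib)
    qed
    finally show "ball_energy \<mu> u ?r \<le> ennreal (S * 6 powr \<beta> * q ^ n / 441 ^ n)" .
  qed
  ultimately show ?thesis using that by blast
qed

section \<open>Membership in Besov spaces\<close>

lemma continuous_imp_L2:
  assumes "continuous_on K u" shows "u \<in> L2_space \<mu>"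
proof -
  have m: "u \<in> borel_measurable \<mu>"
    using borel_measurable_continuous_on_restrict[OF assms] measurable_cong_sets[OF sets_\<mu> refl] by blast
  have "bounded (u ` K)"
    using compact_continuous_image[OF assms K_props(2)] by (rule compact_imp_bounded)
  then obtain B where B: "\<And>x. x \<in> K \<Longrightarrow> \<bar>u x\<bar> \<le> B" unfolding bounded_iff by auto
  have "integrable \<mu> (\<lambda>x. (u x)\<^sup>2)"
  proof (rule \<mu>.integrable_const_bound[where B = "B\<^sup>2"])
    show "AE x in \<mu>. norm ((u x)\<^sup>2) \<le> B\<^sup>2"
    proof (rule AE_I2)
      fix x assume "x \<in> space \<mu>"
      then show "norm ((u x)\<^sup>2) \<le> B\<^sup>2" using B[of x] power_mono[of "\<bar>u x\<bar>" B 2] by simp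
    qed
    show "(\<lambda>x. (u x)\<^sup>2) \<in> borel_measurable \<mu>" using m by measurable
  qed
  then show ?thesis using m by (simp add: L2_space_def)
qed

text \<open>Two points closer than the side of a cell lie in one cell or in two cells with a common
  corner. Hence their difference is bounded by two oscillations, and each cell has at most
  five partners.\<close>

lemma ball_energy_le:
  assumes osc: "\<And>c x y. c \<in> cs n \<Longrightarrow> x \<in> cell n c \<Longrightarrow> y \<in> cell n c \<Longrightarrow> (u x - u y)\<^sup>2 \<le> osc c"
    and r: "r \<le> 1 / 9 ^ n"
  shows "ball_energy \<mu> u r \<le> ennreal (20 * (\<Sum>c\<in>cs n. osc c) / 441 ^ n)"
proof -
  let ?V = "insert (0, 0) corners"
  define P where "P = {(c, e). c \<in> cs n \<and> e \<in> ?V \<and> c + e \<in> cs n}"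
  have fV: "finite ?V" by (simp add: corners_def main_ends_def anti_ends_def)
  have cV: "card ?V = 5" by (simp add: corners_def main_ends_def anti_ends_def)
  have "P \<subseteq> cs n \<times> ?V" by (auto simp: P_def)
  then have fP: "finite P" using fV finite_cs finite_subset by blast
  have nn: "0 \<le> osc c" if "c \<in> cs n" for c
    using osc[OF that] cell_nonempty[of n c] by (metis ex_in_conv order_trans zero_le_power2)
  define w where "w p = 2 * (osc (fst p) + osc (fst p + snd p))" for p
  have wnn: "0 \<le> w p" if "p \<in> P" for p using that nn by (auto simp: w_def P_def)
  have ms: "cell n (fst p) \<in> sets \<mu>" "cell n (fst p + snd p) \<in> sets \<mu>" if "p \<in> P" for p
    using that by (auto simp: P_def intro: cell_in_sets)
  have pt: "ennreal (\<bar>u x - u y\<bar>\<^sup>2) * indicator (ball x r) y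
      \<le> (\<Sum>p\<in>P. ennreal (w p) * indicator (cell n (fst p)) x * indicator (cell n (fst p + snd p)) y)"
    if x: "x \<in> K" and y: "y \<in> K" for x y
  proof (cases "dist x y < r")
    case False
    then show ?thesis by simp
  next
    case True
    obtain c where c: "c \<in> cs n" "x \<in> cell n c" using x by (elim K_cellE)
    obtain c' where c': "c' \<in> cs n" "y \<in> cell n c'" using y by (elim K_cellE)
    define e where "e = c' - c"
    have e: "e \<in> ?V" "c' = c + e"
    proof -
      have "c' = c \<or> c' - c \<in> corners" using True r by (intro close_cells[OF c(1) c'(1) c(2) c'(2)]) simp
      moreover have "(0, 0) = (0 :: int \<times> int)" by (simp add: zero_prod_def)
      ultimately show "e \<in> ?V" by (auto simp: e_def)
      show "c' = c + e" by (simp add: e_def)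
    qed
    have p: "(c, e) \<in> P" using c c' e by (simp add: P_def)
    have "(u x - u y)\<^sup>2 \<le> w (c, e)"
    proof (cases "e = (0, 0)")
      case True
      then have "c' = c" using e(2) by (simp add: prod_eq_iff)
      then have "(u x - u y)\<^sup>2 \<le> osc c" using osc[OF c] c' by simp
      then show ?thesis using nn[OF c(1)] \<open>c' = c\<close> e(2) by (simp add: w_def)
    next
      case False
      define z where "z = vertex n c e"
      have z: "z \<in> cell n c" using e(1) unfolding z_def by (rule vertex_in_cell)
      have "z = vertex n c' (- e)" unfolding z_def e(2) by (rule vertex_shared)
      moreover have "- e \<in> ?V" using False e(1) uminus_corners by blast
      ultimately have z': "z \<in> cell n c'" by (simp only: vertex_in_cell)
      have "(u x - u y)\<^sup>2 \<le> 2 * (u x - u z)\<^sup>2 + 2 * (u z - u y)\<^sup>2"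
        using square_sum_le[of "u x - u z" "u z - u y"] by simp
      also have "\<dots> \<le> 2 * osc c + 2 * osc c'"
        by (intro add_mono mult_left_mono osc c c' z z') simp_all
      finally show ?thesis by (simp add: w_def e(2))
    qed
    then have "ennreal (\<bar>u x - u y\<bar>\<^sup>2) * indicator (ball x r) y
        \<le> ennreal (w (c, e)) * indicator (cell n (fst (c, e))) x * indicator (cell n (fst (c, e) + snd (c, e))) y"
      using True c c' e(2) by (simp add: ennreal_leI)
    also have "\<dots> \<le> (\<Sum>p\<in>P. ennreal (w p) * indicator (cell n (fst p)) x * indicator (cell n (fst p + snd p)) y)"
      by (rule member_le_sum[OF p, of "\<lambda>p. ennreal (w p) * indicator (cell n (fst p)) x * indicator (cell n (fst p + snd p)) y"])
        (simp_all add: fP)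
    finally show ?thesis .
  qed
  have "ball_energy \<mu> u r \<le> (\<integral>\<^sup>+x. (\<integral>\<^sup>+y. (\<Sum>p\<in>P. ennreal (w p) * indicator (cell n (fst p)) x * indicator (cell n (fst p + snd p)) y) \<partial>\<mu>) \<partial>\<mu>)"
    unfolding ball_energy_def using pt by (intro nn_integral_mono) simp
  also have "\<dots> = (\<integral>\<^sup>+x. (\<Sum>p\<in>P. ennreal (w p) * indicator (cell n (fst p)) x * emeasure \<mu> (cell n (fst p + snd p))) \<partial>\<mu>)"
    using ms by (intro nn_integral_cong, subst nn_integral_sum) (auto simp: nn_integral_cmult_indicator intro!: sum.cong)
  also have "\<dots> = (\<Sum>p\<in>P. ennreal (w p) * emeasure \<mu> (cell n (fst p)) * emeasure \<mu> (cell n (fst p + snd p)))"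
    using ms by (subst nn_integral_sum) (auto simp: nn_integral_cmult_indicator nn_integral_multc intro!: sum.cong)
  also have "\<dots> = (\<Sum>p\<in>P. ennreal (w p / 441 ^ n))"
  proof (rule sum.cong[OF refl])
    fix p assume "p \<in> P"
    then have "fst p \<in> cs n" "fst p + snd p \<in> cs n" by (auto simp: P_def)
    moreover have "(441::real) ^ n = 21 ^ n * 21 ^ n" by (simp add: power_mult_distrib[symmetric])
    ultimately show "ennreal (w p) * emeasure \<mu> (cell n (fst p)) * emeasure \<mu> (cell n (fst p + snd p)) = ennreal (w p / 441 ^ n)"
      using wnn[OF \<open>p \<in> P\<close>] by (simp add: emeasure_cell ennreal_mult[symmetric])
  qed
  also have "\<dots> = ennreal ((\<Sum>p\<in>P. w p) / 441 ^ n)"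
    using wnn by (simp add: sum_ennreal sum_divide_distrib)
  also have "\<dots> \<le> ennreal (20 * (\<Sum>c\<in>cs n. osc c) / 441 ^ n)"
  proof (intro ennreal_leI divide_right_mono)
    let ?O = "\<Sum>c\<in>cs n. osc c"
    have P_eq: "P = (SIGMA c:cs n. {e \<in> ?V. c + e \<in> cs n})" by (auto simp: P_def)
    have "(\<Sum>p\<in>P. osc (fst p)) \<le> 5 * ?O"
    proof -
      have "(\<Sum>p\<in>P. osc (fst p)) = (\<Sum>c\<in>cs n. \<Sum>e\<in>{e \<in> ?V. c + e \<in> cs n}. osc c)"
        unfolding P_eq using fV by (subst sum.Sigma) (auto simp: case_prod_unfold)
      also have "\<dots> \<le> (\<Sum>c\<in>cs n. 5 * osc c)"
      proof (rule sum_mono)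
        fix c assume c: "c \<in> cs n"
        have "card {e \<in> ?V. c + e \<in> cs n} \<le> 5" using card_mono[OF fV, of "{e \<in> ?V. c + e \<in> cs n}"] cV by auto
        then show "(\<Sum>e\<in>{e \<in> ?V. c + e \<in> cs n}. osc c) \<le> 5 * osc c"
          using nn[OF c] by (simp add: mult_right_mono)
      qed
      finally show ?thesis by (simp add: sum_distrib_left)
    qed
    moreover have "(\<Sum>p\<in>P. osc (fst p + snd p)) \<le> 5 * ?O"
    proof -
      have inj: "inj_on (\<lambda>p. (fst p + snd p, snd p)) P"
        by (intro inj_onI) (auto simp: prod_eq_iff)
      have "(\<Sum>p\<in>P. osc (fst p + snd p)) = (\<Sum>p\<in>(\<lambda>p. (fst p + snd p, snd p)) ` P. osc (fst p))"
        by (subst sum.reindex[OF inj]) simp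
      also have "\<dots> \<le> (\<Sum>p\<in>cs n \<times> ?V. osc (fst p))"
        using fV nn by (intro sum_mono2) (auto simp: P_def)
      also have "\<dots> = (\<Sum>c\<in>cs n. \<Sum>e\<in>?V. osc c)"
        by (subst sum.cartesian_product) (simp add: case_prod_unfold)
      also have "\<dots> = 5 * ?O" by (simp add: cV sum_distrib_left del: insert_iff card_insert_disjoint)
      finally show ?thesis .
    qed
    ultimately show "(\<Sum>p\<in>P. w p) \<le> 20 * ?O"
      by (simp add: w_def sum.distrib sum_distrib_left[symmetric])
  qed simp
  finally show ?thesis .
qed

text \<open>A radius between \<open>1 / 9 ^ (n + 1)\<close> and \<open>1 / 9 ^ n\<close> is compared
  with the level \<open>n\<close>; larger radii are harmless because the function is bounded.\<close>

lemma besov_memberI: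
  assumes cont: "continuous_on K u"
    and osc: "\<And>n c x y. N \<le> n \<Longrightarrow> c \<in> cs n \<Longrightarrow> x \<in> cell n c \<Longrightarrow> y \<in> cell n c \<Longrightarrow> (u x - u y)\<^sup>2 \<le> osc n c"
    and sum_osc: "\<And>n. N \<le> n \<Longrightarrow> (\<Sum>c\<in>cs n. osc n c) \<le> A * \<tau> ^ n"
    and A: "0 \<le> A" and \<tau>: "0 < \<tau>" "\<tau> * 9 powr (hdim + 2 * \<sigma>) \<le> 441" and \<sigma>: "0 \<le> \<sigma>"
  shows "u \<in> besov \<mu> hdim \<sigma>"
proof -
  define \<beta> where "\<beta> = hdim + 2 * \<sigma>"
  have \<beta>: "0 < \<beta>" using hdim_pos \<sigma> by (simp add: \<beta>_def)
  have "bounded (u ` K)"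
    using compact_continuous_image[OF cont K_props(2)] by (rule compact_imp_bounded)
  then obtain B where B: "\<And>x. x \<in> K \<Longrightarrow> \<bar>u x\<bar> \<le> B" unfolding bounded_iff by auto
  define M where "M = max ((9 ^ N) powr \<beta> * (4 * B\<^sup>2)) (9 powr \<beta> * (20 * A))"
  have "besov_seminorm_sq \<mu> hdim \<sigma> u \<le> ennreal M"
    unfolding besov_seminorm_sq_def ball_energy_def[symmetric]
  proof (rule SUP_least)
    fix r :: real assume "r \<in> {0<..<1}"
    then have r: "0 < r" "r < 1" by simp_all
    have exp: "- hdim - 2 * \<sigma> = - \<beta>" by (simp add: \<beta>_def)
    show "ennreal (r powr (- hdim - 2 * \<sigma>)) * ball_energy \<mu> u r \<le> ennreal M"
    proof (cases "1 / 9 ^ N \<le> r")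
      case True
      have "ball_energy \<mu> u r \<le> (\<integral>\<^sup>+x. (\<integral>\<^sup>+y. ennreal (4 * B\<^sup>2) \<partial>\<mu>) \<partial>\<mu>)"
        unfolding ball_energy_def
      proof (intro nn_integral_mono)
        fix x y assume "x \<in> space \<mu>" "y \<in> space \<mu>"
        then have "\<bar>u x - u y\<bar> \<le> 2 * B" using B[of x] B[of y] by simp
        then have "\<bar>u x - u y\<bar>\<^sup>2 \<le> (2 * B)\<^sup>2" by (intro power_mono) auto
        then have "ennreal (\<bar>u x - u y\<bar>\<^sup>2) \<le> ennreal (4 * B\<^sup>2)" by (intro ennreal_leI) (simp add: power_mult_distrib)
        then show "ennreal (\<bar>u x - u y\<bar>\<^sup>2) * indicator (ball x r) y \<le> ennreal (4 * B\<^sup>2)"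
          by (auto split: split_indicator)
      qed
      also have "\<dots> = ennreal (4 * B\<^sup>2)" by (simp add: emeasure_\<mu>_K)
      finally have b: "ball_energy \<mu> u r \<le> ennreal (4 * B\<^sup>2)" .
      have "r powr (- \<beta>) \<le> (1 / 9 ^ N) powr (- \<beta>)"
        using True r \<beta> by (intro powr_mono2') auto
      also have "\<dots> = (9 ^ N) powr \<beta>" by (simp add: powr_minus powr_divide)
      finally have "ennreal (r powr (- \<beta>)) * ball_energy \<mu> u r \<le> ennreal ((9 ^ N) powr \<beta>) * ennreal (4 * B\<^sup>2)"
        using b by (intro mult_mono ennreal_leI) auto
      also have "\<dots> = ennreal ((9 ^ N) powr \<beta> * (4 * B\<^sup>2))" by (simp add: ennreal_mult)
      also have "\<dots> \<le> ennreal M" by (intro ennreal_leI) (simp add: M_def)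
      finally show ?thesis by (simp add: exp)
    next
      case False
      obtain m where "(1 / 9) ^ m < r" using real_arch_pow_inv[of r "1 / 9"] r by auto
      then have ex: "1 / 9 ^ m \<le> r" by (simp add: power_divide)
      define m0 where "m0 = (LEAST m. 1 / 9 ^ m \<le> r)"
      have m0: "1 / 9 ^ m0 \<le> r" unfolding m0_def using ex by (rule LeastI)
      have "m0 \<noteq> 0" using m0 r by (intro notI) simp
      then obtain n where n: "m0 = Suc n" using not0_implies_Suc by blast
      have rn: "r < 1 / 9 ^ n" using not_less_Least[of n "\<lambda>m. 1 / 9 ^ m \<le> r"] n m0_def by simp
      have "N \<le> n"
      proof (rule ccontr)
        assume "\<not> N \<le> n"
        then have "m0 \<le> N" using n by simp
        then have "(1::real) / 9 ^ N \<le> 1 / 9 ^ m0" by (intro divide_left_mono power_increasing) auto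
        then show False using m0 False by simp
      qed
      have "ball_energy \<mu> u r \<le> ennreal (20 * (\<Sum>c\<in>cs n. osc n c) / 441 ^ n)"
        using osc[OF \<open>N \<le> n\<close>] rn by (intro ball_energy_le) auto
      also have "\<dots> \<le> ennreal (20 * (A * \<tau> ^ n) / 441 ^ n)"
        using sum_osc[OF \<open>N \<le> n\<close>] by (intro ennreal_leI divide_right_mono mult_left_mono) auto
      finally have b: "ball_energy \<mu> u r \<le> ennreal (20 * (A * \<tau> ^ n) / 441 ^ n)" .
      have "r powr (- \<beta>) \<le> (1 / 9 ^ m0) powr (- \<beta>)"
        using m0 r \<beta> by (intro powr_mono2') auto
      also have "\<dots> = (9 ^ m0) powr \<beta>" by (simp add: powr_minus powr_divide)
      also have "\<dots> = (9 powr \<beta>) ^ m0"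
        by (simp add: powr_powr mult.commute flip: powr_realpow) 
      finally have "ennreal (r powr (- \<beta>)) * ball_energy \<mu> u r
          \<le> ennreal ((9 powr \<beta>) ^ m0) * ennreal (20 * (A * \<tau> ^ n) / 441 ^ n)"
        using b by (intro mult_mono ennreal_leI) auto
      also have "\<dots> = ennreal ((9 powr \<beta>) ^ m0 * (20 * (A * \<tau> ^ n) / 441 ^ n))"
        using A \<tau> by (intro ennreal_mult[symmetric]) auto
      also have "(9 powr \<beta>) ^ m0 * (20 * (A * \<tau> ^ n) / 441 ^ n) = 9 powr \<beta> * (20 * A) * (\<tau> * 9 powr \<beta> / 441) ^ n"
        by (simp add: n power_mult_distrib power_divide)
      also have "ennreal \<dots> \<le> ennreal M"
      proof (rule ennreal_leI)
        have "(\<tau> * 9 powr \<beta> / 441) ^ n \<le> 1" using \<tau> by (intro power_le_one) (auto simp: \<beta>_def)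
        then have "9 powr \<beta> * (20 * A) * (\<tau> * 9 powr \<beta> / 441) ^ n \<le> 9 powr \<beta> * (20 * A) * 1"
          using A by (intro mult_left_mono) auto
        also have "\<dots> \<le> M" by (simp add: M_def)
        finally show "9 powr \<beta> * (20 * A) * (\<tau> * 9 powr \<beta> / 441) ^ n \<le> M" .
      qed
      finally show ?thesis by (simp add: exp)
    qed
  qed
  then have "besov_seminorm_sq \<mu> hdim \<sigma> u < \<infinity>" using order_le_less_trans[of _ "ennreal M" \<infinity>] by simp
  then show ?thesis using continuous_imp_L2[OF cont] by (simp add: besov_def)
qed

end

section \<open>Extension of vertex values\<close>

definition arm :: "(int \<times> int \<Rightarrow> real) \<Rightarrow> int \<times> int \<Rightarrow> real \<Rightarrow> real" where
  "arm d e t = d (0, 0) + t * (d e - d (0, 0))"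

definition main_value :: "(int \<times> int \<Rightarrow> real) \<Rightarrow> int \<Rightarrow> real" where
  "main_value d s = (if 0 \<le> s then arm d (1, 1) (of_int s / 9) else arm d (-1, -1) (of_int (- s) / 9))"

definition anti_value :: "(int \<times> int \<Rightarrow> real) \<Rightarrow> real \<Rightarrow> real" where
  "anti_value d r = (if 0 \<le> r then arm d (1, -1) (r / 9) else arm d (-1, 1) (- r / 9))"

text \<open>In the coordinates \<open>s\<close> along and \<open>r\<close> across the main diagonal, a vertex off the main
  diagonal takes the value of the arm at the position below. In an eyebolt, between the positions
  4 and 6, the whole drop is placed on the halves of cells that are parallel to the main diagonal.\<close>

definition arm_position :: "int \<Rightarrow> int \<Rightarrow> real" where
  "arm_position s r = (if 2 \<le> \<bar>s\<bar> then 5 * of_int (sgn r)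
     else if \<bar>s\<bar> = 1 \<and> (\<bar>r\<bar> = 4 \<or> \<bar>r\<bar> = 6) then (of_int r + 5 * of_int (sgn r)) / 2 else of_int r)"

definition extend :: "(int \<times> int \<Rightarrow> real) \<Rightarrow> int \<times> int \<Rightarrow> real" where
  "extend d p = (let s = (fst p + snd p) div 2; r = (fst p - snd p) div 2 in
     if s \<noteq> 0 \<and> \<bar>r\<bar> \<le> 1 then main_value d s else anti_value d (arm_position s r))"

lemma arm_zero: "arm d e 0 = d (0, 0)"
  and arm_diff: "arm d e t - arm d e t' = (t - t') * (d e - d (0, 0))"
  and arm_diff_centre: "arm d e t - d (0, 0) = t * (d e - d (0, 0))"
  by (simp_all add: arm_def algebra_simps)

lemma extend_corner:
  assumes "e \<in> corners" shows "extend d (9 * fst e, 9 * snd e) = d e"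
  using assms by (elim corners_cases) (simp_all add: extend_def main_value_def anti_value_def arm_position_def arm_def)

lemma extend_between:
  assumes d: "\<And>e. e \<in> insert (0, 0) corners \<Longrightarrow> lo \<le> d e \<and> d e \<le> hi"
    and p: "\<bar>fst p\<bar> \<le> 9" "\<bar>snd p\<bar> \<le> 9"
  shows "lo \<le> extend d p \<and> extend d p \<le> hi"
proof -
  have arm: "lo \<le> arm d e t \<and> arm d e t \<le> hi" if "e \<in> corners" "0 \<le> t" "t \<le> 1" for e t
  proof -
    have "arm d e t = (1 - t) * d (0, 0) + t * d e" by (simp add: arm_def algebra_simps)
    moreover have "(1 - t) * lo + t * lo \<le> (1 - t) * d (0, 0) + t * d e"
      using d[of "(0, 0)"] d[of e] that by (intro add_mono mult_left_mono) auto
    moreover have "(1 - t) * d (0, 0) + t * d e \<le> (1 - t) * hi + t * hi"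
      using d[of "(0, 0)"] d[of e] that by (intro add_mono mult_left_mono) auto
    ultimately show ?thesis by (simp add: algebra_simps)
  qed
  define s where "s = (fst p + snd p) div 2" define r where "r = (fst p - snd p) div 2"
  have s: "\<bar>s\<bar> \<le> 9" and r: "\<bar>r\<bar> \<le> 9" using p unfolding s_def r_def by linarith+
  have "\<bar>arm_position s r\<bar> \<le> 9"
  proof -
    define x where "x = real_of_int r"
    define y where "y = real_of_int (sgn r)"
    have "- 1 \<le> y" "y \<le> 1" "- 9 \<le> x" "x \<le> 9" using r by (simp_all add: x_def y_def sgn_if)
    then have "\<bar>(x + 5 * y) / 2\<bar> \<le> 9" "\<bar>5 * y\<bar> \<le> 9" "\<bar>x\<bar> \<le> 9"
      by (auto simp: abs_le_iff)
    then show ?thesis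
      unfolding arm_position_def x_def[symmetric] y_def[symmetric] by auto
  qed
  then have "lo \<le> anti_value d (arm_position s r) \<and> anti_value d (arm_position s r) \<le> hi"
    using arm[of "(1, -1)" "arm_position s r / 9"] arm[of "(-1, 1)" "- arm_position s r / 9"]
    by (simp add: anti_value_def corners_iff abs_le_iff)
  moreover have "lo \<le> main_value d s \<and> main_value d s \<le> hi"
    using s arm[of "(1, 1)" "of_int s / 9"] arm[of "(-1, -1)" "of_int (- s) / 9"]
    by (simp add: main_value_def corners_iff abs_le_iff)
  ultimately show ?thesis by (simp add: extend_def Let_def s_def r_def)
qed

text \<open>Every half cell of an arm carries one ninth of the drop \<open>d e - d (0, 0)\<close>. In an
  eyebolt the drop of two halves is shared by four halves, so each of these carries one
  eighteenth.\<close>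

lemma extend_forms:
  fixes d :: "int \<times> int \<Rightarrow> real"
  defines "a1 \<equiv> (d (1, 1) - d (0, 0))\<^sup>2" and "a2 \<equiv> (d (-1, -1) - d (0, 0))\<^sup>2"
    and "b1 \<equiv> (d (1, -1) - d (0, 0))\<^sup>2" and "b2 \<equiv> (d (-1, 1) - d (0, 0))\<^sup>2"
  shows "main_form (extend d) (0,0) = (a1 + a2) / 81" "anti_form (extend d) (0,0) = (b1 + b2) / 81"
    "main_form (extend d) (1,1) = 2 / 81 * a1" "anti_form (extend d) (1,1) = 0"
    "main_form (extend d) (2,2) = 2 / 81 * a1" "anti_form (extend d) (2,2) = 0"
    "main_form (extend d) (3,3) = 2 / 81 * a1" "anti_form (extend d) (3,3) = 0"
    "main_form (extend d) (4,4) = 2 / 81 * a1" "anti_form (extend d) (4,4) = 0"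
    "main_form (extend d) (-1,-1) = 2 / 81 * a2" "anti_form (extend d) (-1,-1) = 0"
    "main_form (extend d) (-2,-2) = 2 / 81 * a2" "anti_form (extend d) (-2,-2) = 0"
    "main_form (extend d) (-3,-3) = 2 / 81 * a2" "anti_form (extend d) (-3,-3) = 0"
    "main_form (extend d) (-4,-4) = 2 / 81 * a2" "anti_form (extend d) (-4,-4) = 0"
    "main_form (extend d) (1,-1) = 0" "anti_form (extend d) (1,-1) = 2 / 81 * b1"
    "main_form (extend d) (2,-2) = 2 / 324 * b1" "anti_form (extend d) (2,-2) = 2 / 81 * b1"
    "main_form (extend d) (3,-3) = 2 / 324 * b1" "anti_form (extend d) (3,-3) = 2 / 81 * b1"
    "main_form (extend d) (4,-4) = 0" "anti_form (extend d) (4,-4) = 2 / 81 * b1"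
    "main_form (extend d) (-1,1) = 0" "anti_form (extend d) (-1,1) = 2 / 81 * b2"
    "main_form (extend d) (-2,2) = 2 / 324 * b2" "anti_form (extend d) (-2,2) = 2 / 81 * b2"
    "main_form (extend d) (-3,3) = 2 / 324 * b2" "anti_form (extend d) (-3,3) = 2 / 81 * b2"
    "main_form (extend d) (-4,4) = 0" "anti_form (extend d) (-4,4) = 2 / 81 * b2"
  by (simp_all add: main_form_eq anti_form_eq extend_def main_value_def anti_value_def arm_position_def
      arm_zero arm_diff arm_diff_centre power_mult_distrib power_divide Let_def
      a1_def[symmetric] a2_def[symmetric] b1_def[symmetric] b2_def[symmetric] add_divide_distrib)

lemma extend_forms_eyebolt:
  fixes d :: "int \<times> int \<Rightarrow> real"
  defines "b1 \<equiv> (d (1, -1) - d (0, 0))\<^sup>2" and "b2 \<equiv> (d (-1, 1) - d (0, 0))\<^sup>2"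
  assumes "s = 1 \<or> s = (-1::int)"
  shows "main_form (extend d) (s + 2, s - 2) = b1 / 324" "anti_form (extend d) (s + 2, s - 2) = 0"
    "main_form (extend d) (s + 3, s - 3) = b1 / 324" "anti_form (extend d) (s + 3, s - 3) = 0"
    "main_form (extend d) (s - 2, s + 2) = b2 / 324" "anti_form (extend d) (s - 2, s + 2) = 0"
    "main_form (extend d) (s - 3, s + 3) = b2 / 324" "anti_form (extend d) (s - 3, s + 3) = 0"
  using assms(3) by (auto simp: main_form_eq anti_form_eq extend_def main_value_def anti_value_def arm_position_def
      arm_zero arm_diff arm_diff_centre power_mult_distrib power_divide Let_def
      b1_def[symmetric] b2_def[symmetric] add_divide_distrib)

context eyebolted_cross
begin

text \<open>The energy along anti-diagonals scales exactly, and the eyebolts feed a fixed fraction of it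
  into the energy along main diagonals. With the weight \<open>9 ^ n\<close> the total
  therefore grows linearly.\<close>

lemma sum_extend_forms:
  shows "(\<Sum>i\<in>D. main_form (extend d) i) = (\<Sum>e\<in>main_ends. (d e - d (0, 0))\<^sup>2) / 9 + (\<Sum>e\<in>anti_ends. (d e - d (0, 0))\<^sup>2) / 54"
    "(\<Sum>i\<in>D. anti_form (extend d) i) = (\<Sum>e\<in>anti_ends. (d e - d (0, 0))\<^sup>2) / 9"
proof -
  have "(\<Sum>i\<in>D. main_form (extend d) i) = (\<Sum>e\<in>main_ends. (d e - d (0, 0))\<^sup>2) / 9 + (\<Sum>e\<in>anti_ends. (d e - d (0, 0))\<^sup>2) / 54
    \<and> (\<Sum>i\<in>D. anti_form (extend d) i) = (\<Sum>e\<in>anti_ends. (d e - d (0, 0))\<^sup>2) / 9"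
  proof (rule D_explicit)
    fix s s' :: int
    assume s: "s = 1 \<or> s = -1" "s' = 1 \<or> s' = -1" and D: "D = {(0,0), (1,1), (2,2), (3,3), (4,4), (-1,-1), (-2,-2), (-3,-3), (-4,-4),
          (1,-1), (2,-2), (3,-3), (4,-4), (-1,1), (-2,2), (-3,3), (-4,4),
          (s + 2, s - 2), (s + 3, s - 3), (s' - 2, s' + 2), (s' - 3, s' + 3)}"
    have sum: "(\<Sum>i\<in>D. f i) = f (0,0) + f (1,1) + f (2,2) + f (3,3) + f (4,4)
      + f (-1,-1) + f (-2,-2) + f (-3,-3) + f (-4,-4)
      + f (1,-1) + f (2,-2) + f (3,-3) + f (4,-4) + f (-1,1) + f (-2,2) + f (-3,3) + f (-4,4)
      + f (s + 2, s - 2) + f (s + 3, s - 3) + f (s' - 2, s' + 2) + f (s' - 3, s' + 3)" for f :: "int \<times> int \<Rightarrow> real"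
      unfolding D using s by (elim disjE) simp_all
    show ?thesis
      unfolding sum by (simp add: extend_forms extend_forms_eyebolt[OF s(1)] extend_forms_eyebolt[OF s(2)]
        main_ends_def anti_ends_def field_simps)
  qed
  then show "(\<Sum>i\<in>D. main_form (extend d) i) = (\<Sum>e\<in>main_ends. (d e - d (0, 0))\<^sup>2) / 9 + (\<Sum>e\<in>anti_ends. (d e - d (0, 0))\<^sup>2) / 54"
    "(\<Sum>i\<in>D. anti_form (extend d) i) = (\<Sum>e\<in>anti_ends. (d e - d (0, 0))\<^sup>2) / 9" by blast+
qed

end

definition parent :: "int \<times> int \<Rightarrow> int \<times> int" where
  "parent c = ((fst c + 4) div 9, (snd c + 4) div 9)"

definition digit :: "int \<times> int \<Rightarrow> int \<times> int" where
  "digit c = (fst c - 9 * fst (parent c), snd c - 9 * snd (parent c))"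

lemma parent_child_bounds:
  assumes "\<bar>fst i\<bar> \<le> 4" "\<bar>snd i\<bar> \<le> 4"
  shows "parent (child c i) = c \<and> digit (child c i) = i"
proof -
  have "(9 * a + b + 4) div 9 = a" if "\<bar>b\<bar> \<le> 4" for a b :: int
    by (rule int_div_pos_eq[of _ 9 _ "b + 4"]) (use that in linarith)+
  then have "parent (child c i) = c" using assms by (simp add: parent_def prod_eq_iff)
  then show ?thesis by (simp add: digit_def prod_eq_iff)
qed

text \<open>The values at the vertices of the cells of level \<open>N + k\<close> that result from the values of
  \<open>g\<close> at the vertices of level \<open>N\<close>.\<close>

primrec node :: "nat \<Rightarrow> (real \<times> real \<Rightarrow> real) \<Rightarrow> nat \<Rightarrow> int \<times> int \<Rightarrow> int \<times> int \<Rightarrow> real" where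
  "node N g 0 = (\<lambda>c e. g (vertex N c e))"
| "node N g (Suc k) = (\<lambda>c e. extend (node N g k (parent c)) (2 * fst (digit c) + fst e, 2 * snd (digit c) + snd e))"

definition node_main :: "nat \<Rightarrow> (real \<times> real \<Rightarrow> real) \<Rightarrow> nat \<Rightarrow> int \<times> int \<Rightarrow> real" where
  "node_main N g k c = (\<Sum>e\<in>main_ends. (node N g k c e - node N g k c (0, 0))\<^sup>2)"

definition node_anti :: "nat \<Rightarrow> (real \<times> real \<Rightarrow> real) \<Rightarrow> nat \<Rightarrow> int \<times> int \<Rightarrow> real" where
  "node_anti N g k c = (\<Sum>e\<in>anti_ends. (node N g k c e - node N g k c (0, 0))\<^sup>2)"

lemma node_energy_nonneg: "0 \<le> node_main N g k c" "0 \<le> node_anti N g k c"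
  by (simp_all add: node_main_def node_anti_def sum_nonneg)

context eyebolted_cross
begin

lemma parent_child: assumes "i \<in> D" shows "parent (child c i) = c" "digit (child c i) = i"
  using parent_child_bounds[of i c] D_bounds[OF assms] by blast+

lemma node_child:
  assumes "i \<in> D"
  shows "node N g (Suc k) (child c i) e = extend (node N g k c) (2 * fst i + fst e, 2 * snd i + snd e)"
  by (simp only: node.simps parent_child[OF assms])

text \<open>Cells with different parents touch only in a corner of both parents, where the extension
  reproduces the values of the parents.\<close>

lemma node_shared:
  assumes "e \<in> corners"
  shows "c \<in> cs (N + k) \<Longrightarrow> c + e \<in> cs (N + k) \<Longrightarrow> node N g k c e = node N g k (c + e) (- e)"
proof (induction k arbitrary: c)
  case 0
  then show ?case using vertex_shared[of N c e] by simp
next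
  case (Suc k)
  obtain a i where a: "a \<in> cs (N + k)" "i \<in> D" "c = child a i"
    using Suc.prems(1) unfolding add_Suc_right by (elim cs_SucE)
  obtain b j where b: "b \<in> cs (N + k)" "j \<in> D" "c + e = child b j"
    using Suc.prems(2) unfolding add_Suc_right by (elim cs_SucE)
  have eq: "9 * fst b + fst j = 9 * fst a + fst i + fst e" "9 * snd b + snd j = 9 * snd a + snd i + snd e"
    using a(3) b(3) by (simp_all add: prod_eq_iff)
  have e1: "\<bar>fst e\<bar> = 1" "\<bar>snd e\<bar> = 1" using assms by (simp_all add: corners_iff)
  have comp: "b' = a' \<and> j' = i' + e' \<or> b' = a' + e' \<and> i' = 4 * e' \<and> j' = - 4 * e'"
    if "9 * b' + j' = 9 * a' + i' + e'" "\<bar>e'\<bar> = 1" "\<bar>i'\<bar> \<le> 4" "\<bar>j'\<bar> \<le> 4" for a' b' i' j' e' :: int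
  proof -
    have e': "e' = 1 \<or> e' = -1" using that(2) by arith
    have "b' - a' \<le> 1" "- 1 \<le> b' - a'" using that by linarith+
    then consider "b' = a'" | "b' = a' + 1" | "b' = a' - 1" by fastforce
    then show ?thesis
    proof cases
      case 1
      then show ?thesis using that(1) by simp
    next
      case 2
      then have "i' = 4" "j' = - 4" "e' = 1" using that e' by linarith+
      then show ?thesis using 2 by simp
    next
      case 3
      then have "i' = - 4" "j' = 4" "e' = - 1" using that e' by linarith+
      then show ?thesis using 3 by simp
    qed
  qed
  have c1: "fst b = fst a \<and> fst j = fst i + fst e \<or> fst b = fst a + fst e \<and> fst i = 4 * fst e \<and> fst j = - 4 * fst e"
    by (rule comp) (use eq e1 D_bounds[OF a(2)] D_bounds[OF b(2)] in simp_all)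
  have c2: "snd b = snd a \<and> snd j = snd i + snd e \<or> snd b = snd a + snd e \<and> snd i = 4 * snd e \<and> snd j = - 4 * snd e"
    by (rule comp) (use eq e1 D_bounds[OF a(2)] D_bounds[OF b(2)] in simp_all)
  have par: "even (fst a + snd a)" "even (fst b + snd b)" using cs_even a(1) b(1) by blast+
  have odd: "odd (fst e)" "odd (snd e)" using e1 by presburger+
  consider "fst b = fst a \<and> fst j = fst i + fst e \<and> snd b = snd a \<and> snd j = snd i + snd e"
    | "fst b = fst a + fst e \<and> fst i = 4 * fst e \<and> fst j = - 4 * fst e \<and> snd b = snd a + snd e \<and> snd i = 4 * snd e \<and> snd j = - 4 * snd e"
    using c1 c2 par odd by (metis even_add)
  then show ?case
  proof cases
    case 1
    then have "b = a" by (simp add: prod_eq_iff)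
    have "node N g (Suc k) (child a j) (- e) = node N g (Suc k) (child a i) e"
      unfolding node_child[OF a(2)] node_child[OF b(2)] using 1 by (simp add: algebra_simps)
    then show ?thesis unfolding a(3)[symmetric] b(3) \<open>b = a\<close> by simp
  next
    case 2
    then have b_eq: "b = a + e" by (simp add: prod_eq_iff)
    have "node N g (Suc k) c e = extend (node N g k a) (9 * fst e, 9 * snd e)"
      unfolding a(3) node_child[OF a(2)] using 2 by simp
    also have "\<dots> = node N g k a e" by (rule extend_corner[OF assms])
    also have "\<dots> = node N g k b (- e)" using Suc.IH[OF a(1)] b(1) by (simp only: b_eq)
    also have "\<dots> = extend (node N g k b) (9 * fst (- e), 9 * snd (- e))"
      by (rule extend_corner[OF uminus_corners[OF assms], symmetric])
    also have "\<dots> = node N g (Suc k) (child b j) (- e)"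
      unfolding node_child[OF b(2)] using 2 by simp
    finally show ?thesis unfolding b(3) .
  qed
qed

lemma sum_node_children:
  "(\<Sum>i\<in>D. node_main N g (Suc k) (child c i)) = node_main N g k c / 9 + node_anti N g k c / 54"
  "(\<Sum>i\<in>D. node_anti N g (Suc k) (child c i)) = node_anti N g k c / 9"
proof -
  have m: "node_main N g (Suc k) (child c i) = main_form (extend (node N g k c)) i" if "i \<in> D" for i
    unfolding node_main_def node_child[OF that] main_form_def by simp
  have a: "node_anti N g (Suc k) (child c i) = anti_form (extend (node N g k c)) i" if "i \<in> D" for i
    unfolding node_anti_def node_child[OF that] anti_form_def by simp
  have "(\<Sum>i\<in>D. node_main N g (Suc k) (child c i)) = (\<Sum>i\<in>D. main_form (extend (node N g k c)) i)"
    by (rule sum.cong[OF refl m])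
  then show "(\<Sum>i\<in>D. node_main N g (Suc k) (child c i)) = node_main N g k c / 9 + node_anti N g k c / 54"
    by (simp only: sum_extend_forms(1) node_main_def[of N g k] node_anti_def[of N g k])
  have "(\<Sum>i\<in>D. node_anti N g (Suc k) (child c i)) = (\<Sum>i\<in>D. anti_form (extend (node N g k c)) i)"
    by (rule sum.cong[OF refl a])
  then show "(\<Sum>i\<in>D. node_anti N g (Suc k) (child c i)) = node_anti N g k c / 9"
    by (simp only: sum_extend_forms(2) node_anti_def[of N g k])
qed

definition total_main :: "nat \<Rightarrow> (real \<times> real \<Rightarrow> real) \<Rightarrow> nat \<Rightarrow> real" where
  "total_main N g k = (\<Sum>c\<in>cs (N + k). node_main N g k c)"

definition total_anti :: "nat \<Rightarrow> (real \<times> real \<Rightarrow> real) \<Rightarrow> nat \<Rightarrow> real" where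
  "total_anti N g k = (\<Sum>c\<in>cs (N + k). node_anti N g k c)"

lemma total_nonneg: "0 \<le> total_main N g k" "0 \<le> total_anti N g k"
  by (simp_all add: total_main_def total_anti_def sum_nonneg node_energy_nonneg)

lemma total_Suc:
  "total_main N g (Suc k) = total_main N g k / 9 + total_anti N g k / 54"
  "total_anti N g (Suc k) = total_anti N g k / 9"
  unfolding total_main_def total_anti_def add_Suc_right sum_cs_Suc sum_node_children
  by (simp_all add: sum.distrib sum_divide_distrib)

lemma total_eq:
  "total_anti N g k = total_anti N g 0 / 9 ^ k"
  "total_main N g k = (total_main N g 0 + real k * total_anti N g 0 / 6) / 9 ^ k"
proof -
  show a: "total_anti N g k = total_anti N g 0 / 9 ^ k" for k
    by (induction k) (simp_all add: total_Suc)
  show "total_main N g k = (total_main N g 0 + real k * total_anti N g 0 / 6) / 9 ^ k"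
  proof (induction k)
    case (Suc k)
    show ?case unfolding total_Suc(1) Suc a[of k] by (simp add: field_simps)
  qed simp
qed

text \<open>A bound for all differences between centre and corner values at depth \<open>k\<close>. The
  unweighted energy is divided by at least 4 from one level to the next; any factor above 1
  would make the widths tend to 0.\<close>

definition width :: "nat \<Rightarrow> (real \<times> real \<Rightarrow> real) \<Rightarrow> nat \<Rightarrow> real" where
  "width N g k = sqrt ((total_main N g 0 + total_anti N g 0) / 4 ^ k)"

lemma width_nonneg: "0 \<le> width N g k"
  using total_nonneg[of N g 0] by (simp add: width_def)

lemma width_antimono: assumes "k \<le> m" shows "width N g m \<le> width N g k"
proof -
  have "(4::real) ^ k \<le> 4 ^ m" using assms by (intro power_increasing) auto
  then show ?thesis unfolding width_def using total_nonneg[of N g 0]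
    by (intro real_sqrt_le_mono divide_left_mono) auto
qed

lemma width_tendsto_0: "width N g \<longlonglongrightarrow> 0"
proof -
  have "(\<lambda>k. sqrt ((total_main N g 0 + total_anti N g 0) * (1 / 4) ^ k)) \<longlonglongrightarrow> sqrt ((total_main N g 0 + total_anti N g 0) * 0)"
    by (intro tendsto_real_sqrt tendsto_mult_left LIMSEQ_power_zero) simp
  then show ?thesis unfolding width_def by (simp add: power_divide)
qed

lemma total_decay: "total_main N g k + total_anti N g k \<le> (total_main N g 0 + total_anti N g 0) / 4 ^ k"
proof (induction k)
  case (Suc k)
  have "total_main N g (Suc k) + total_anti N g (Suc k) \<le> (total_main N g k + total_anti N g k) / 4"
    unfolding total_Suc using total_nonneg[of N g k] by simp
  also have "\<dots> \<le> (total_main N g 0 + total_anti N g 0) / 4 ^ k / 4" using Suc by (intro divide_right_mono) auto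
  finally show ?case by (simp add: mult.commute)
qed simp

lemma node_square_le:
  assumes "e \<in> insert (0, 0) corners"
  shows "(node N g k c e - node N g k c (0, 0))\<^sup>2 \<le> node_main N g k c + node_anti N g k c"
proof -
  let ?f = "\<lambda>e. (node N g k c e - node N g k c (0, 0))\<^sup>2"
  have m: "?f (1, 1) + ?f (-1, -1) = node_main N g k c" "?f (1, -1) + ?f (-1, 1) = node_anti N g k c"
    by (simp_all add: node_main_def node_anti_def main_ends_def anti_ends_def)
  have nn: "0 \<le> ?f (1, 1)" "0 \<le> ?f (-1, -1)" "0 \<le> ?f (1, -1)" "0 \<le> ?f (-1, 1)" by simp_all
  show ?thesis
  proof (cases "e = (0, 0)")
    case True
    then show ?thesis using node_energy_nonneg[of N g k c] by simp
  next
    case False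
    then have "e \<in> corners" using assms by simp
    then show ?thesis
    proof (cases rule: corners_cases)
      case 1 show ?thesis unfolding 1 using m nn by linarith
    next
      case 2 show ?thesis unfolding 2 using m nn by linarith
    next
      case 3 show ?thesis unfolding 3 using m nn by linarith
    next
      case 4 show ?thesis unfolding 4 using m nn by linarith
    qed
  qed
qed

lemma node_width:
  assumes "c \<in> cs (N + k)" "e \<in> insert (0, 0) corners"
  shows "\<bar>node N g k c e - node N g k c (0, 0)\<bar> \<le> width N g k"
proof -
  have "node_main N g k c \<le> total_main N g k" unfolding total_main_def
    by (rule member_le_sum[OF assms(1)]) (simp_all add: node_energy_nonneg)
  moreover have "node_anti N g k c \<le> total_anti N g k" unfolding total_anti_def
    by (rule member_le_sum[OF assms(1)]) (simp_all add: node_energy_nonneg)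
  ultimately have "(node N g k c e - node N g k c (0, 0))\<^sup>2 \<le> (total_main N g 0 + total_anti N g 0) / 4 ^ k"
    using node_square_le[OF assms(2), of N g k c] total_decay[of N g k] by linarith
  from real_sqrt_le_mono[OF this] show ?thesis by (simp add: width_def)
qed

lemma node_neighbour:
  assumes "c \<in> cs (N + k)" "c' \<in> cs (N + k)" "c' = c \<or> c' - c \<in> corners"
  shows "\<bar>node N g k c (0, 0) - node N g k c' (0, 0)\<bar> \<le> 2 * width N g k"
proof (cases "c' = c")
  case True
  then show ?thesis using width_nonneg[of N g k] by simp
next
  case False
  define e where "e = c' - c"
  have e: "e \<in> corners" "c' = c + e" using False assms(3) by (simp_all add: e_def)
  have "node N g k c e = node N g k c' (- e)" using node_shared[OF e(1), of c N k g] assms e(2) by simp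
  moreover have "\<bar>node N g k c e - node N g k c (0, 0)\<bar> \<le> width N g k"
    using e by (intro node_width[OF assms(1)]) simp
  moreover have "\<bar>node N g k c' (- e) - node N g k c' (0, 0)\<bar> \<le> width N g k"
    using e uminus_corners by (intro node_width[OF assms(2)]) simp
  ultimately show ?thesis by linarith
qed

lemma node_descendant_between:
  assumes range: "\<And>e. e \<in> insert (0, 0) corners \<Longrightarrow> lo \<le> node N g k c e \<and> node N g k c e \<le> hi"
  shows "t \<in> cs m \<Longrightarrow> e \<in> insert (0, 0) corners \<Longrightarrow>
    lo \<le> node N g (k + m) (shift m c t) e \<and> node N g (k + m) (shift m c t) e \<le> hi"
proof (induction m arbitrary: t e)
  case 0
  then have "shift 0 c t = c" by (simp add: prod_eq_iff)
  then show ?case using range[OF 0(2)] by simp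
next
  case (Suc m)
  obtain t' i where t: "t' \<in> cs m" "i \<in> D" "t = child t' i" using Suc.prems(1) by (elim cs_SucE)
  have "\<bar>fst e\<bar> \<le> 1 \<and> \<bar>snd e\<bar> \<le> 1" using Suc.prems(2) by (auto simp: corners_iff)
  then have p: "\<bar>2 * fst i + fst e\<bar> \<le> 9" "\<bar>2 * snd i + snd e\<bar> \<le> 9" using D_bounds[OF t(2)] by linarith+
  have "node N g (k + Suc m) (shift (Suc m) c t) e
      = extend (node N g (k + m) (shift m c t')) (2 * fst i + fst e, 2 * snd i + snd e)"
    unfolding t(3) shift_child[symmetric] add_Suc_right by (rule node_child[OF t(2)])
  then show ?case using extend_between[OF Suc.IH[OF t(1)]] p by simp
qed

lemma shift_in_cs: "c \<in> cs n \<Longrightarrow> t \<in> cs m \<Longrightarrow> shift m c t \<in> cs (n + m)"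
proof (induction m arbitrary: t)
  case 0
  then have "shift 0 c t = c" by (simp add: prod_eq_iff)
  then show ?case using 0 by simp
next
  case (Suc m)
  obtain t' i where t: "t' \<in> cs m" "i \<in> D" "t = child t' i" using Suc.prems(2) by (elim cs_SucE)
  show ?case unfolding t(3) shift_child[symmetric] add_Suc_right
    by (rule child_in_cs[OF Suc.IH[OF Suc.prems(1) t(1)] t(2)])
qed

lemma cell_descendantE:
  assumes "x \<in> cell n c" obtains t where "t \<in> cs m" "x \<in> cell (n + m) (shift m c t)"
proof -
  obtain y where y: "y \<in> K" "x = place n c y" using assms unfolding cell_def by blast
  obtain t where t: "t \<in> cs m" "y \<in> cell m t" using y(1) by (elim K_cellE)
  then obtain z where "z \<in> K" "y = place m t z" unfolding cell_def by blast
  then have "x \<in> cell (n + m) (shift m c t)" using y(2) unfolding cell_def by (simp add: place_shift)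
  then show ?thesis using that t(1) by blast
qed

definition vertex_extension :: "nat \<Rightarrow> (real \<times> real \<Rightarrow> real) \<Rightarrow> real \<times> real \<Rightarrow> real" where
  "vertex_extension N g x = lim (\<lambda>k. node N g k (code (N + k) x) (0, 0))"

text \<open>The chosen cell of level \<open>N + m\<close> need not descend from \<open>c\<close>, but it
  shares a vertex with a descendant of \<open>c\<close> that contains the point.\<close>

lemma node_code_between:
  assumes c: "c \<in> cs (N + k)" "x \<in> cell (N + k) c" and "k \<le> m"
    and range: "\<And>e. e \<in> insert (0, 0) corners \<Longrightarrow> lo \<le> node N g k c e \<and> node N g k c e \<le> hi"
  shows "lo - 2 * width N g m \<le> node N g m (code (N + m) x) (0, 0)"
    "node N g m (code (N + m) x) (0, 0) \<le> hi + 2 * width N g m"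
proof -
  obtain j where j: "m = k + j" using \<open>k \<le> m\<close> le_Suc_ex by blast
  obtain t where t: "t \<in> cs j" "x \<in> cell (N + m) (shift j c t)"
    using cell_descendantE[OF c(2), of j] unfolding j by (metis add.assoc)
  have s: "shift j c t \<in> cs (N + m)" using shift_in_cs[OF c(1) t(1)] by (simp add: j add.assoc)
  have x: "x \<in> K" using c cell_subset_K by blast
  have "code (N + m) x = shift j c t \<or> code (N + m) x - shift j c t \<in> corners"
    using close_cells[OF s code(1)[OF x] t(2) code(2)[OF x]] by simp
  from node_neighbour[OF s code(1)[OF x] this, of g]
  have "\<bar>node N g m (shift j c t) (0, 0) - node N g m (code (N + m) x) (0, 0)\<bar> \<le> 2 * width N g m" .
  moreover have "lo \<le> node N g m (shift j c t) (0, 0) \<and> node N g m (shift j c t) (0, 0) \<le> hi"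
    unfolding j by (rule node_descendant_between[OF range t(1)]) simp_all
  ultimately show "lo - 2 * width N g m \<le> node N g m (code (N + m) x) (0, 0)"
    "node N g m (code (N + m) x) (0, 0) \<le> hi + 2 * width N g m" by linarith+
qed

lemma node_code_tendsto:
  assumes "x \<in> K"
  shows "(\<lambda>k. node N g k (code (N + k) x) (0, 0)) \<longlonglongrightarrow> vertex_extension N g x"
proof -
  let ?a = "\<lambda>k. node N g k (code (N + k) x) (0, 0)"
  have b: "\<bar>?a m - ?a k\<bar> \<le> 3 * width N g k" if "k \<le> m" for k m
  proof -
    have r: "?a k - width N g k \<le> node N g k (code (N + k) x) e \<and> node N g k (code (N + k) x) e \<le> ?a k + width N g k"
      if "e \<in> insert (0, 0) corners" for e
      using node_width[OF code(1)[OF assms, of "N + k"] that, where g = g] by linarith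
    show ?thesis using node_code_between[OF code[OF assms, of "N + k"] \<open>k \<le> m\<close> r] width_antimono[OF \<open>k \<le> m\<close>, of N g] by linarith
  qed
  have "Cauchy ?a"
  proof (rule CauchyI')
    fix e :: real assume "0 < e"
    have "(\<lambda>k. 3 * width N g k) \<longlonglongrightarrow> 3 * 0" by (intro tendsto_mult_left width_tendsto_0)
    then have "\<forall>\<^sub>F k in sequentially. 3 * width N g k < e" using \<open>0 < e\<close> by (intro order_tendstoD(2)) auto
    then obtain n0 where n0: "\<And>k. n0 \<le> k \<Longrightarrow> 3 * width N g k < e" unfolding eventually_sequentially by blast
    have "norm (?a m - ?a n) < e" if "n0 \<le> m" "m < n" for m n
      using b[of m n] n0[OF that(1)] that(2) unfolding real_norm_def by linarith
    then show "\<exists>M. \<forall>m\<ge>M. \<forall>n>m. dist (?a m) (?a n) < e" unfolding dist_norm by blast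
  qed
  then have "convergent ?a" by (simp add: Cauchy_convergent_iff)
  then show ?thesis unfolding vertex_extension_def by (simp add: convergent_LIMSEQ_iff)
qed

lemma vertex_extension_between:
  assumes c: "c \<in> cs (N + k)" "x \<in> cell (N + k) c"
    and range: "\<And>e. e \<in> insert (0, 0) corners \<Longrightarrow> lo \<le> node N g k c e \<and> node N g k c e \<le> hi"
  shows "lo \<le> vertex_extension N g x \<and> vertex_extension N g x \<le> hi"
proof
  have x: "x \<in> K" using c cell_subset_K by blast
  have l: "(\<lambda>m. lo - 2 * width N g m) \<longlonglongrightarrow> lo - 2 * 0"
    and h: "(\<lambda>m. hi + 2 * width N g m) \<longlonglongrightarrow> hi + 2 * 0"
    by (intro tendsto_intros width_tendsto_0)+
  have "lo - 2 * 0 \<le> vertex_extension N g x"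
    by (rule LIMSEQ_le[OF l node_code_tendsto[OF x]]) (use node_code_between(1)[OF c _ range] in blast)
  then show "lo \<le> vertex_extension N g x" by simp
  have "vertex_extension N g x \<le> hi + 2 * 0"
    by (rule LIMSEQ_le[OF node_code_tendsto[OF x] h]) (use node_code_between(2)[OF c _ range] in blast)
  then show "vertex_extension N g x \<le> hi" by simp
qed

lemma vertex_extension_near:
  assumes c: "c \<in> cs (N + k)" "x \<in> cell (N + k) c"
  shows "\<bar>vertex_extension N g x - node N g k c (0, 0)\<bar> \<le> sqrt (node_main N g k c + node_anti N g k c)"
    "\<bar>vertex_extension N g x - node N g k c (0, 0)\<bar> \<le> width N g k"
proof -
  have *: "\<bar>vertex_extension N g x - node N g k c (0, 0)\<bar> \<le> w"
    if "\<And>e. e \<in> insert (0, 0) corners \<Longrightarrow> \<bar>node N g k c e - node N g k c (0, 0)\<bar> \<le> w" for w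
  proof -
    have "node N g k c (0, 0) - w \<le> node N g k c e \<and> node N g k c e \<le> node N g k c (0, 0) + w"
      if "e \<in> insert (0, 0) corners" for e using \<open>\<And>e. e \<in> insert (0, 0) corners \<Longrightarrow> _\<close>[OF that] by linarith
    from vertex_extension_between[OF c this] show ?thesis by linarith
  qed
  show "\<bar>vertex_extension N g x - node N g k c (0, 0)\<bar> \<le> sqrt (node_main N g k c + node_anti N g k c)"
    using real_sqrt_le_mono[OF node_square_le[of _ N g k c]] by (intro *) simp
  show "\<bar>vertex_extension N g x - node N g k c (0, 0)\<bar> \<le> width N g k"
    using node_width[OF c(1)] by (intro *)
qed

lemma vertex_extension_oscillation:
  assumes "c \<in> cs (N + k)" "x \<in> cell (N + k) c" "y \<in> cell (N + k) c"
  shows "(vertex_extension N g x - vertex_extension N g y)\<^sup>2 \<le> 4 * (node_main N g k c + node_anti N g k c)"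
proof -
  let ?s = "sqrt (node_main N g k c + node_anti N g k c)"
  have "\<bar>vertex_extension N g x - vertex_extension N g y\<bar> \<le> 2 * ?s"
    using vertex_extension_near(1)[OF assms(1,2), of g] vertex_extension_near(1)[OF assms(1,3), of g] by linarith
  then have "(vertex_extension N g x - vertex_extension N g y)\<^sup>2 \<le> (2 * ?s)\<^sup>2"
    by (metis abs_ge_zero power2_abs power_mono)
  then show ?thesis using node_energy_nonneg[of N g k c] by (simp add: power_mult_distrib)
qed

lemma vertex_extension_continuous: "continuous_on K (vertex_extension N g)"
  unfolding continuous_on_iff
proof (intro ballI allI impI)
  fix x and e :: real assume x: "x \<in> K" and "0 < e"
  have "(\<lambda>k. 4 * width N g k) \<longlonglongrightarrow> 4 * 0" by (intro tendsto_mult_left width_tendsto_0)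
  then have "\<forall>\<^sub>F k in sequentially. 4 * width N g k < e" using \<open>0 < e\<close> by (intro order_tendstoD(2)) auto
  then obtain k where k: "4 * width N g k < e" using eventually_happens'[OF sequentially_bot] by blast
  show "\<exists>d>0. \<forall>y\<in>K. dist y x < d \<longrightarrow> dist (vertex_extension N g y) (vertex_extension N g x) < e"
  proof (intro exI[of _ "1 / 9 ^ (N + k)"] conjI ballI impI)
    fix y assume y: "y \<in> K" "dist y x < 1 / 9 ^ (N + k)"
    obtain c where c: "c \<in> cs (N + k)" "x \<in> cell (N + k) c" using x by (elim K_cellE)
    obtain c' where c': "c' \<in> cs (N + k)" "y \<in> cell (N + k) c'" using y(1) by (elim K_cellE)
    have "c = c' \<or> c - c' \<in> corners" by (rule close_cells[OF c'(1) c(1) c'(2) c(2) y(2)])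
    from node_neighbour[OF c'(1) c(1) this, of g] vertex_extension_near(2)[OF c, of g] vertex_extension_near(2)[OF c', of g]
    have "\<bar>vertex_extension N g y - vertex_extension N g x\<bar> \<le> 4 * width N g k" by linarith
    then show "dist (vertex_extension N g y) (vertex_extension N g x) < e" using k by (simp add: dist_real_def)
  qed simp
qed

text \<open>Oscillation over the cells of level \<open>n\<close> of total square at most a constant times
  \<open>\<tau> ^ n\<close>, from some level on.\<close>

definition oscillation_decay :: "real \<Rightarrow> (real \<times> real \<Rightarrow> real) \<Rightarrow> bool" where
  "oscillation_decay \<tau> u \<longleftrightarrow> continuous_on K u \<and> (\<exists>N A osc. 0 \<le> A \<and>
     (\<forall>n\<ge>N. \<forall>c\<in>cs n. \<forall>x\<in>cell n c. \<forall>y\<in>cell n c. (u x - u y)\<^sup>2 \<le> osc n c) \<and>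
     (\<forall>n\<ge>N. (\<Sum>c\<in>cs n. osc n c) \<le> A * \<tau> ^ n))"

lemma oscillation_decay_besov:
  assumes "oscillation_decay \<tau> u" and "0 < \<tau>" "\<tau> * 9 powr (hdim + 2 * \<sigma>) \<le> 441" and "0 \<le> \<sigma>"
  shows "u \<in> besov \<mu> hdim \<sigma>"
proof -
  obtain N A osc where *: "continuous_on K u" "0 \<le> A"
    "\<forall>n\<ge>N. \<forall>c\<in>cs n. \<forall>x\<in>cell n c. \<forall>y\<in>cell n c. (u x - u y)\<^sup>2 \<le> osc n c"
    "\<forall>n\<ge>N. (\<Sum>c\<in>cs n. osc n c) \<le> A * \<tau> ^ n"
    using assms(1) unfolding oscillation_decay_def by blast
  show ?thesis
    by (rule besov_memberI[where N = N and osc = osc and A = A and \<tau> = \<tau>]) (use * assms in blast)+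
qed

lemma vertex_extension_decay:
  assumes "0 \<le> A" and decay: "\<And>k. 4 * (total_main N g k + total_anti N g k) \<le> A * \<tau> ^ k" and \<tau>: "0 < \<tau>"
  shows "oscillation_decay \<tau> (vertex_extension N g)"
proof -
  let ?osc = "\<lambda>n c. 4 * (node_main N g (n - N) c + node_anti N g (n - N) c)"
  have "(vertex_extension N g x - vertex_extension N g y)\<^sup>2 \<le> ?osc n c"
    if "N \<le> n" "c \<in> cs n" "x \<in> cell n c" "y \<in> cell n c" for n c x y
    using vertex_extension_oscillation[of c N "n - N" x y g] that by simp
  moreover have "(\<Sum>c\<in>cs n. ?osc n c) \<le> A / \<tau> ^ N * \<tau> ^ n" if "N \<le> n" for n
  proof -
    have n: "N + (n - N) = n" using that by simp
    have "(\<Sum>c\<in>cs n. ?osc n c) = 4 * (total_main N g (n - N) + total_anti N g (n - N))"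
      unfolding total_main_def total_anti_def n by (simp add: sum_distrib_left[symmetric] sum.distrib)
    also have "\<dots> \<le> A * \<tau> ^ (n - N)" by (rule decay)
    also have "\<dots> = A / \<tau> ^ N * \<tau> ^ n" using \<tau> that by (simp add: power_diff)
    finally show ?thesis .
  qed
  moreover have "0 \<le> A / \<tau> ^ N" using assms(1) \<tau> by simp
  ultimately show ?thesis
    unfolding oscillation_decay_def
    by (intro conjI exI[of _ N] exI[of _ "A / \<tau> ^ N"] exI[of _ ?osc] ballI allI impI vertex_extension_continuous)
qed

lemma nine_powr_exponent: "9 powr (hdim + 2 * \<sigma>) = 441 * 9 powr (2 * \<sigma> - hdim)"
proof -
  have "9 powr hdim = 21" using nine_powr_hdim(1)[of 1] by simp
  then have "9 powr (hdim + hdim) = 441" unfolding powr_add by simp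
  moreover have "9 powr (hdim + 2 * \<sigma>) = 9 powr (hdim + hdim) * 9 powr (2 * \<sigma> - hdim)"
    unfolding powr_add[symmetric] by (rule arg_cong[of _ _ "\<lambda>t. 9 powr t"]) simp
  ultimately show ?thesis by simp
qed

lemma critical_decay_besov:
  assumes "oscillation_decay (1 / 9) u" shows "u \<in> besov \<mu> hdim ((1 + hdim) / 2)"
proof (rule oscillation_decay_besov[OF assms])
  show "1 / 9 * 9 powr (hdim + 2 * ((1 + hdim) / 2)) \<le> 441"
    unfolding nine_powr_exponent by (simp add: add_divide_distrib)
qed (use hdim_pos in simp_all)

lemma vertex_extension_critical:
  assumes "total_anti N g 0 = 0"
  shows "oscillation_decay (1 / 9) (vertex_extension N g)"
proof (rule vertex_extension_decay)
  show "0 \<le> 4 * total_main N g 0" using total_nonneg by simp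
  show "4 * (total_main N g k + total_anti N g k) \<le> 4 * total_main N g 0 * (1 / 9) ^ k" for k
    unfolding total_eq[of N g k] assms by (simp add: power_divide)
qed simp

text \<open>Linear growth of the weighted energy is dominated by any exponential.\<close>

lemma vertex_extension_subcritical:
  assumes "0 \<le> \<sigma>" "\<sigma> < (1 + hdim) / 2"
  shows "vertex_extension N g \<in> besov \<mu> hdim \<sigma>"
proof -
  define \<tau> where "\<tau> = 9 powr (hdim - 2 * \<sigma>)"
  have "9 powr (-1) < \<tau>" unfolding \<tau>_def using assms by (intro powr_less_mono) auto
  then have \<tau>: "1 / 9 < \<tau>" by (simp add: powr_minus_divide)
  define \<rho> where "\<rho> = 1 / 9 / \<tau>"
  have \<rho>: "0 < \<rho>" "\<rho> < 1" using \<tau> by (simp_all add: \<rho>_def field_simps)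
  have "(\<lambda>k. real k * \<rho> ^ k) \<longlonglongrightarrow> 0" using \<rho> by (intro powser_times_n_limit_0) simp
  then have "Bseq (\<lambda>k. real k * \<rho> ^ k)" using convergent_imp_Bseq convergent_def by blast
  then obtain M where M: "0 < M" "\<And>k. norm (real k * \<rho> ^ k) \<le> M" unfolding Bseq_def by blast
  let ?m = "total_main N g 0" and ?a = "total_anti N g 0"
  have "oscillation_decay \<tau> (vertex_extension N g)"
  proof (rule vertex_extension_decay)
    show "0 \<le> 4 * (?m + ?a + M * ?a / 6)" using total_nonneg[of N g 0] M by simp
    show "0 < \<tau>" using \<tau> by simp
    fix k
    have t: "(1 / 9) ^ k = \<rho> ^ k * \<tau> ^ k" using \<tau> by (simp add: \<rho>_def power_divide)
    have "4 * (total_main N g k + total_anti N g k) = 4 * (?m + ?a + real k * ?a / 6) * (1 / 9) ^ k"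
      unfolding total_eq[of N g k] by (simp add: power_divide add_divide_distrib algebra_simps)
    also have "\<dots> = 4 * ((?m + ?a) * \<rho> ^ k + real k * \<rho> ^ k * ?a / 6) * \<tau> ^ k"
      unfolding t by (simp add: algebra_simps)
    also have "\<dots> \<le> 4 * ((?m + ?a) * 1 + M * ?a / 6) * \<tau> ^ k"
    proof (intro mult_right_mono mult_left_mono add_mono divide_right_mono)
      show "\<rho> ^ k \<le> 1" using \<rho> by (intro power_le_one) auto
      show "real k * \<rho> ^ k \<le> M" using M(2)[of k] \<rho> by simp
    qed (use total_nonneg[of N g 0] \<tau> in auto)
    finally show "4 * (total_main N g k + total_anti N g k) \<le> 4 * (?m + ?a + M * ?a / 6) * \<tau> ^ k" by simp
  qed
  moreover have "\<tau> * 9 powr (hdim + 2 * \<sigma>) \<le> 441"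
    unfolding nine_powr_exponent \<tau>_def by (simp flip: powr_add)
  ultimately show ?thesis using \<tau> assms(1) by (intro oscillation_decay_besov) auto
qed

lemma dense_in_C_subcritical:
  assumes "0 \<le> \<sigma>" "\<sigma> < (1 + hdim) / 2"
  shows "dense_in_C K (besov \<mu> hdim \<sigma>)"
  unfolding dense_in_C_def
proof (intro allI impI)
  fix f :: "real \<times> real \<Rightarrow> real" and \<epsilon> :: real assume f: "continuous_on K f" and "0 < \<epsilon>"
  have "uniformly_continuous_on K f" using compact_uniformly_continuous[OF f K_props(2)] .
  then obtain d where d: "0 < d" "\<And>x y. x \<in> K \<Longrightarrow> y \<in> K \<Longrightarrow> dist y x < d \<Longrightarrow> dist (f y) (f x) < \<epsilon> / 2"
    using \<open>0 < \<epsilon>\<close> unfolding uniformly_continuous_on_def by (meson half_gt_zero)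
  have "\<exists>N. (1 / 9) ^ N < d / 2" using d(1) by (intro real_arch_pow_inv) auto
  then obtain N where N: "2 / 9 ^ N < d" by (auto simp: power_divide field_simps)
  let ?u = "vertex_extension N f"
  have "\<bar>f x - ?u x\<bar> < \<epsilon>" if x: "x \<in> K" for x
  proof -
    obtain c where c: "c \<in> cs (N + 0)" "x \<in> cell (N + 0) c" using x by (elim K_cellE)
    have "f x - \<epsilon> / 2 \<le> node N f 0 c e \<and> node N f 0 c e \<le> f x + \<epsilon> / 2" if e: "e \<in> insert (0, 0) corners" for e
    proof -
      have "vertex N c e \<in> cell N c" using e by (rule vertex_in_cell)
      then have "dist (vertex N c e) x < d" using cell_diameter[of "vertex N c e" N c x] c N by simp
      then have "dist (f (vertex N c e)) (f x) < \<epsilon> / 2"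
        using x vertex_in_K'[of c N e] c e by (intro d(2)) simp_all
      then have "\<bar>f (vertex N c e) - f x\<bar> < \<epsilon> / 2" by (simp only: dist_real_def)
      then show ?thesis unfolding node.simps by linarith
    qed
    from vertex_extension_between[OF c this] show ?thesis using \<open>0 < \<epsilon>\<close> by linarith
  qed
  then show "\<exists>u\<in>besov \<mu> hdim \<sigma>. continuous_on K u \<and> (\<forall>x\<in>K. \<bar>f x - u x\<bar> < \<epsilon>)"
    using vertex_extension_subcritical[OF assms] vertex_extension_continuous by blast
qed

end

section \<open>Density in the Lebesgue space\<close>

context finite_measure
begin

lemma L2_lincomb:
  assumes f: "f \<in> L2_space M" and g: "g \<in> L2_space M"
  shows "(\<lambda>x. f x + a * g x) \<in> L2_space M"
proof -
  have [measurable]: "f \<in> borel_measurable M" "g \<in> borel_measurable M"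
    and i: "integrable M (\<lambda>x. (f x)\<^sup>2)" "integrable M (\<lambda>x. (g x)\<^sup>2)"
    using f g by (simp_all add: L2_space_def)
  have "integrable M (\<lambda>x. (f x + a * g x)\<^sup>2)"
  proof (rule Bochner_Integration.integrable_bound)
    show "integrable M (\<lambda>x. 2 * (f x)\<^sup>2 + 2 * a\<^sup>2 * (g x)\<^sup>2)" using i by simp
    show "AE x in M. norm ((f x + a * g x)\<^sup>2) \<le> norm (2 * (f x)\<^sup>2 + 2 * a\<^sup>2 * (g x)\<^sup>2)"
      using square_sum_le[of "f _" "a * g _"] by (simp add: power_mult_distrib mult.assoc)
  qed measurable
  then show ?thesis by (simp add: L2_space_def)
qed

lemma L2_diff: "f \<in> L2_space M \<Longrightarrow> g \<in> L2_space M \<Longrightarrow> (\<lambda>x. f x - g x) \<in> L2_space M"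
  using L2_lincomb[of f g "-1"] by simp

lemma L2_integrable: "f \<in> L2_space M \<Longrightarrow> integrable M (\<lambda>x. (f x)\<^sup>2)"
  by (simp add: L2_space_def)

lemma L2_indicator: assumes "A \<inter> space M \<in> sets M" shows "(\<lambda>x. indicator A x :: real) \<in> L2_space M"
proof -
  have m: "(\<lambda>x. indicator A x :: real) \<in> borel_measurable M" using assms by (simp add: borel_measurable_indicator_iff)
  moreover have "integrable M (\<lambda>x. (indicator A x :: real)\<^sup>2)"
    by (rule integrable_const_bound[where B = 1]) (use m in \<open>auto simp: indicator_def\<close>)
  ultimately show ?thesis by (simp add: L2_space_def)
qed

lemma L2_distance_triangle:
  assumes "f \<in> L2_space M" "g \<in> L2_space M" "h \<in> L2_space M"
  shows "(\<integral>x. (f x - h x)\<^sup>2 \<partial>M) \<le> 2 * (\<integral>x. (f x - g x)\<^sup>2 \<partial>M) + 2 * (\<integral>x. (g x - h x)\<^sup>2 \<partial>M)"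
proof -
  have i: "integrable M (\<lambda>x. (f x - h x)\<^sup>2)" "integrable M (\<lambda>x. (f x - g x)\<^sup>2)" "integrable M (\<lambda>x. (g x - h x)\<^sup>2)"
    using assms L2_diff L2_integrable by blast+
  have "(\<integral>x. (f x - h x)\<^sup>2 \<partial>M) \<le> (\<integral>x. 2 * (f x - g x)\<^sup>2 + 2 * (g x - h x)\<^sup>2 \<partial>M)"
  proof (rule integral_mono)
    fix x show "(f x - h x)\<^sup>2 \<le> 2 * (f x - g x)\<^sup>2 + 2 * (g x - h x)\<^sup>2"
      using square_sum_le[of "f x - g x" "g x - h x"] by simp
  qed (use i in simp_all)
  then show ?thesis using i by simp
qed

end

context eyebolted_cross
begin

lemma oscillation_decay_lincomb:
  assumes u: "oscillation_decay \<tau> u" and v: "oscillation_decay \<tau> v" and "0 < \<tau>"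
  shows "oscillation_decay \<tau> (\<lambda>x. u x + a * v x)"
proof -
  obtain N A p where u': "continuous_on K u" "0 \<le> A"
    "\<And>n c x y. N \<le> n \<Longrightarrow> c \<in> cs n \<Longrightarrow> x \<in> cell n c \<Longrightarrow> y \<in> cell n c \<Longrightarrow> (u x - u y)\<^sup>2 \<le> p n c"
    "\<And>n. N \<le> n \<Longrightarrow> (\<Sum>c\<in>cs n. p n c) \<le> A * \<tau> ^ n"
    using u unfolding oscillation_decay_def by metis
  obtain N' A' p' where v': "continuous_on K v" "0 \<le> A'"
    "\<And>n c x y. N' \<le> n \<Longrightarrow> c \<in> cs n \<Longrightarrow> x \<in> cell n c \<Longrightarrow> y \<in> cell n c \<Longrightarrow> (v x - v y)\<^sup>2 \<le> p' n c"
    "\<And>n. N' \<le> n \<Longrightarrow> (\<Sum>c\<in>cs n. p' n c) \<le> A' * \<tau> ^ n"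
    using v unfolding oscillation_decay_def by metis
  let ?osc = "\<lambda>n c. 2 * p n c + 2 * a\<^sup>2 * p' n c"
  show ?thesis
    unfolding oscillation_decay_def
  proof (intro conjI exI[of _ "max N N'"] exI[of _ "2 * A + 2 * a\<^sup>2 * A'"] exI[of _ ?osc] ballI allI impI)
    show "continuous_on K (\<lambda>x. u x + a * v x)" using u'(1) v'(1) by (intro continuous_intros)
    show "0 \<le> 2 * A + 2 * a\<^sup>2 * A'" using u'(2) v'(2) by simp
    fix n assume n: "max N N' \<le> n"
    have "(\<Sum>c\<in>cs n. ?osc n c) = 2 * (\<Sum>c\<in>cs n. p n c) + 2 * a\<^sup>2 * (\<Sum>c\<in>cs n. p' n c)"
      by (simp add: sum.distrib sum_distrib_left)
    also have "\<dots> \<le> 2 * (A * \<tau> ^ n) + 2 * a\<^sup>2 * (A' * \<tau> ^ n)"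
      using u'(4)[of n] v'(4)[of n] n by (intro add_mono mult_left_mono) auto
    finally show "(\<Sum>c\<in>cs n. ?osc n c) \<le> (2 * A + 2 * a\<^sup>2 * A') * \<tau> ^ n" by (simp add: algebra_simps)
    fix c x y assume c: "c \<in> cs n" "x \<in> cell n c" "y \<in> cell n c"
    have "(u x + a * v x - (u y + a * v y))\<^sup>2 \<le> 2 * (u x - u y)\<^sup>2 + 2 * (a * (v x - v y))\<^sup>2"
      using square_sum_le[of "u x - u y" "a * (v x - v y)"] by (simp add: algebra_simps)
    also have "\<dots> = 2 * (u x - u y)\<^sup>2 + 2 * a\<^sup>2 * (v x - v y)\<^sup>2" by (simp add: power_mult_distrib)
    also have "\<dots> \<le> ?osc n c"
      using u'(3)[OF _ c] v'(3)[OF _ c] n by (intro add_mono mult_left_mono) auto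
    finally show "(u x + a * v x - (u y + a * v y))\<^sup>2 \<le> ?osc n c" .
  qed
qed

lemma oscillation_decay_const: "oscillation_decay \<tau> (\<lambda>_. k)"
  unfolding oscillation_decay_def
  by (intro conjI exI[of _ 0] exI[of _ "\<lambda>_ _. 0"]) simp_all

text \<open>The closure in \<open>L\<^sup>2\<close> of the continuous functions whose squared
  oscillations decay at the critical rate.\<close>

definition approximable :: "(real \<times> real \<Rightarrow> real) \<Rightarrow> bool" where
  "approximable f \<longleftrightarrow> f \<in> L2_space \<mu> \<and>
    (\<forall>\<epsilon>>0. \<exists>u. oscillation_decay (1 / 9) u \<and> (\<integral>x. (f x - u x)\<^sup>2 \<partial>\<mu>) < \<epsilon>)"

lemma decay_L2: "oscillation_decay \<tau> u \<Longrightarrow> u \<in> L2_space \<mu>"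
  unfolding oscillation_decay_def using continuous_imp_L2 by blast

lemma approximable_decay: "oscillation_decay (1 / 9) u \<Longrightarrow> approximable u"
  unfolding approximable_def using decay_L2 by fastforce

lemma approximable_lincomb:
  assumes f: "approximable f" and g: "approximable g"
  shows "approximable (\<lambda>x. f x + a * g x)"
  unfolding approximable_def
proof (intro conjI allI impI)
  have f2: "f \<in> L2_space \<mu>" and g2: "g \<in> L2_space \<mu>" using f g by (simp_all add: approximable_def)
  then show "(\<lambda>x. f x + a * g x) \<in> L2_space \<mu>" by (rule \<mu>.L2_lincomb)
  fix \<epsilon> :: real assume "0 < \<epsilon>"
  define \<delta> where "\<delta> = \<epsilon> / (4 * (a\<^sup>2 + 1))"
  have p: "0 < a\<^sup>2 + 1" by (simp add: add_nonneg_pos)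
  then have "0 < \<delta>" using \<open>0 < \<epsilon>\<close> by (simp add: \<delta>_def)
  obtain u where u: "oscillation_decay (1 / 9) u" "(\<integral>x. (f x - u x)\<^sup>2 \<partial>\<mu>) < \<epsilon> / 4"
    using f \<open>0 < \<epsilon>\<close> unfolding approximable_def by (meson divide_pos_pos zero_less_numeral)
  obtain v where v: "oscillation_decay (1 / 9) v" "(\<integral>x. (g x - v x)\<^sup>2 \<partial>\<mu>) < \<delta>"
    using g \<open>0 < \<delta>\<close> unfolding approximable_def by blast
  have u2: "u \<in> L2_space \<mu>" and v2: "v \<in> L2_space \<mu>" using u(1) v(1) by (simp_all add: decay_L2)
  have i1: "integrable \<mu> (\<lambda>x. (f x - u x)\<^sup>2)" by (rule \<mu>.L2_integrable[OF \<mu>.L2_diff[OF f2 u2]])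
  have i2: "integrable \<mu> (\<lambda>x. (g x - v x)\<^sup>2)" by (rule \<mu>.L2_integrable[OF \<mu>.L2_diff[OF g2 v2]])
  have i3: "integrable \<mu> (\<lambda>x. (f x + a * g x - (u x + a * v x))\<^sup>2)"
    by (rule \<mu>.L2_integrable[OF \<mu>.L2_diff[OF \<mu>.L2_lincomb[OF f2 g2] \<mu>.L2_lincomb[OF u2 v2]]])
  note i = i1 i2 i3
  have "(\<integral>x. (f x + a * g x - (u x + a * v x))\<^sup>2 \<partial>\<mu>) \<le> (\<integral>x. 2 * (f x - u x)\<^sup>2 + 2 * a\<^sup>2 * (g x - v x)\<^sup>2 \<partial>\<mu>)"
  proof (rule integral_mono)
    fix x
    have "(f x + a * g x - (u x + a * v x))\<^sup>2 \<le> 2 * (f x - u x)\<^sup>2 + 2 * (a * (g x - v x))\<^sup>2"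
      using square_sum_le[of "f x - u x" "a * (g x - v x)"] by (simp add: algebra_simps)
    then show "(f x + a * g x - (u x + a * v x))\<^sup>2 \<le> 2 * (f x - u x)\<^sup>2 + 2 * a\<^sup>2 * (g x - v x)\<^sup>2"
      by (simp add: power_mult_distrib)
  qed (use i in simp_all)
  also have "\<dots> = 2 * (\<integral>x. (f x - u x)\<^sup>2 \<partial>\<mu>) + 2 * a\<^sup>2 * (\<integral>x. (g x - v x)\<^sup>2 \<partial>\<mu>)" using i by simp
  also have "\<dots> < \<epsilon>"
  proof -
    have "2 * a\<^sup>2 * (\<integral>x. (g x - v x)\<^sup>2 \<partial>\<mu>) \<le> 2 * (a\<^sup>2 + 1) * \<delta>"
      using v(2) by (intro mult_mono) auto
    also have "\<dots> = \<epsilon> / 2"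
    proof -
      have "2 * w * (\<epsilon> / (4 * w)) = \<epsilon> / 2" if "0 < w" for w using that by (simp add: field_simps)
      from this[OF p] show ?thesis unfolding \<delta>_def .
    qed
    finally show ?thesis using u(2) by linarith
  qed
  finally show "\<exists>w. oscillation_decay (1 / 9) w \<and> (\<integral>x. (f x + a * g x - w x)\<^sup>2 \<partial>\<mu>) < \<epsilon>"
    using oscillation_decay_lincomb[OF u(1) v(1), of a] by auto
qed

lemma approximable_const: "approximable (\<lambda>_. k)"
  by (intro approximable_decay oscillation_decay_const)

lemma approximable_sum:
  assumes "finite I" "\<And>i. i \<in> I \<Longrightarrow> approximable (f i)"
  shows "approximable (\<lambda>x. \<Sum>i\<in>I. f i x)"
  using assms
proof (induction I rule: finite_induct)
  case empty
  then show ?case using approximable_const[of 0] by simp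
next
  case (insert i I)
  then show ?case using approximable_lincomb[of "\<lambda>x. \<Sum>i\<in>I. f i x" "f i" 1] by (simp add: add.commute)
qed

lemma approximable_scale: "approximable f \<Longrightarrow> approximable (\<lambda>x. a * f x)"
  using approximable_lincomb[OF approximable_const[of 0], of f a] by simp

lemma approximable_limit:
  assumes f: "f \<in> L2_space \<mu>" and lim: "\<And>\<epsilon>. 0 < \<epsilon> \<Longrightarrow> \<exists>g. approximable g \<and> (\<integral>x. (f x - g x)\<^sup>2 \<partial>\<mu>) < \<epsilon>"
  shows "approximable f"
  unfolding approximable_def
proof (intro conjI f allI impI)
  fix \<epsilon> :: real assume "0 < \<epsilon>"
  then have e: "0 < \<epsilon> / 4" by simp
  obtain g where g: "approximable g" "(\<integral>x. (f x - g x)\<^sup>2 \<partial>\<mu>) < \<epsilon> / 4" using lim[OF e] by blast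
  obtain u where u: "oscillation_decay (1 / 9) u" "(\<integral>x. (g x - u x)\<^sup>2 \<partial>\<mu>) < \<epsilon> / 4"
    using g(1) e unfolding approximable_def by blast
  have "(\<integral>x. (f x - u x)\<^sup>2 \<partial>\<mu>) \<le> 2 * (\<integral>x. (f x - g x)\<^sup>2 \<partial>\<mu>) + 2 * (\<integral>x. (g x - u x)\<^sup>2 \<partial>\<mu>)"
    using f g(1) decay_L2[OF u(1)] by (intro \<mu>.L2_distance_triangle) (simp_all add: approximable_def)
  then show "\<exists>u. oscillation_decay (1 / 9) u \<and> (\<integral>x. (f x - u x)\<^sup>2 \<partial>\<mu>) < \<epsilon>"
    using u g(2) by (intro exI[of _ u]) linarith
qed

lemma approximable_sequence:
  assumes f: "f \<in> L2_space \<mu>" and s: "\<And>n. approximable (s n)"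
    and lim: "AE x in \<mu>. (\<lambda>n. s n x) \<longlonglongrightarrow> f x"
    and w: "integrable \<mu> w" "\<And>n. AE x in \<mu>. (f x - s n x)\<^sup>2 \<le> w x"
  shows "approximable f"
proof (rule approximable_limit[OF f])
  fix \<epsilon> :: real assume "0 < \<epsilon>"
  have s2: "s n \<in> L2_space \<mu>" for n using s by (simp add: approximable_def)
  have [measurable]: "f \<in> borel_measurable \<mu>" "\<And>n. s n \<in> borel_measurable \<mu>"
    using f s2 by (simp_all add: L2_space_def)
  have "(\<lambda>n. \<integral>x. (f x - s n x)\<^sup>2 \<partial>\<mu>) \<longlonglongrightarrow> (\<integral>x. 0 \<partial>\<mu>)"
  proof (rule integral_dominated_convergence[where w = w])
    show "AE x in \<mu>. (\<lambda>n. (f x - s n x)\<^sup>2) \<longlonglongrightarrow> 0"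
      using lim
    proof eventually_elim
      case (elim x)
      have "(\<lambda>n. (f x - s n x)\<^sup>2) \<longlonglongrightarrow> (f x - f x)\<^sup>2" using elim by (intro tendsto_intros)
      then show ?case by simp
    qed
    show "AE x in \<mu>. norm ((f x - s n x)\<^sup>2) \<le> w x" for n using w(2)[of n] by simp
  qed (use w in measurable)
  then have "\<forall>\<^sub>F n in sequentially. (\<integral>x. (f x - s n x)\<^sup>2 \<partial>\<mu>) < \<epsilon>" using \<open>0 < \<epsilon>\<close> by (intro order_tendstoD(2)) auto
  then show "\<exists>g. approximable g \<and> (\<integral>x. (f x - g x)\<^sup>2 \<partial>\<mu>) < \<epsilon>"
    using s eventually_happens'[OF sequentially_bot] by blast
qed

lemma L2_indicator_borel: "A \<in> sets borel \<Longrightarrow> (\<lambda>x. indicator A x :: real) \<in> L2_space \<mu>"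
  by (rule \<mu>.L2_indicator) (simp add: in_sets_\<mu>)

text \<open>One coordinate of a vertex of the cell with index \<open>M * a + t\<close> lies in the
  interval of the coarser cell \<open>b\<close>, in units of half a fine cell. If
  \<open>a\<close> differs from \<open>b\<close>, the fine cell must touch that interval from
  outside.\<close>

lemma plateau_coordinate:
  fixes a b t e M :: int
  assumes h: "\<bar>2 * M * (a - b) + 2 * t + e\<bar> \<le> M" and "\<bar>2 * t\<bar> \<le> M - 1" "\<bar>e\<bar> \<le> 1"
  shows "a = b \<or> a = b - e \<and> e \<noteq> 0 \<and> 2 * t = e * (M - 1)"
proof -
  have M: "1 \<le> M" using assms(2) by linarith
  consider "a = b" | "a - b = 1" | "a - b = - 1" | "2 \<le> a - b" | "a - b \<le> - 2" by linarith
  then show ?thesis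
  proof cases
    case 2
    then have "2 * M + 2 * t + e \<le> M" using h by simp
    then have "e = - 1" "2 * t = - (M - 1)" using assms(2,3) by linarith+
    then show ?thesis using 2 by simp
  next
    case 3
    then have "- 2 * M + 2 * t + e \<ge> - M" using h by simp
    then have "e = 1" "2 * t = M - 1" using assms(2,3) by linarith+
    then show ?thesis using 3 by simp
  next
    case 4
    have "2 * M * 2 \<le> 2 * M * (a - b)" using 4 M by (intro mult_left_mono) auto
    then show ?thesis using h assms(2,3) M by linarith
  next
    case 5
    have "2 * M * (a - b) \<le> 2 * M * (- 2)" using 5 M by (intro mult_left_mono) auto
    then show ?thesis using h assms(2,3) M by linarith
  qed simp
qed

text \<open>The cell \<open>(2, 2)\<close> of any cell meets the others of its level in two opposite corners on
  the main diagonal only. The extension of the indicator of its square, from a deep level, has no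
  energy on half cells along the anti-diagonal.\<close>

lemma approximable_inner_cell:
  assumes c: "c \<in> cs n"
  shows "approximable (\<lambda>x. indicator (cell (Suc n) (child c (2, 2))) x)"
proof (rule approximable_limit)
  let ?b = "child c (2, 2)"
  let ?f = "\<lambda>x. indicator (cell (Suc n) ?b) x :: real"
  let ?V = "insert (0, 0) corners"
  have b: "?b \<in> cs (Suc n)" using c D_diagonal[of 2] by (intro child_in_cs) auto
  show f2: "?f \<in> L2_space \<mu>" by (rule L2_indicator_borel) simp
  fix \<epsilon> :: real assume "0 < \<epsilon>"
  then have "\<exists>m. (1 / 21) ^ m < \<epsilon> / 4" by (intro real_arch_pow_inv) auto
  then obtain m where "(1 / 21) ^ m < \<epsilon> / 4" by blast
  then have m: "4 / 21 ^ m < \<epsilon>" by (simp add: power_divide field_simps)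
  define M :: int where "M = 9 ^ m"
  define N where "N = Suc n + m"
  define g :: "real \<times> real \<Rightarrow> real" where "g p = (if \<bar>9 ^ Suc n * fst p - of_int (fst ?b)\<bar> \<le> 1 / 2
    \<and> \<bar>9 ^ Suc n * snd p - of_int (snd ?b)\<bar> \<le> 1 / 2 then 1 else 0)" for p
  define u where "u = vertex_extension N g"
  have g01: "0 \<le> g p" "g p \<le> 1" for p by (simp_all add: g_def)
  have coord: "\<bar>9 ^ Suc n * ((of_int e / 2 + of_int (M * a + t)) / 9 ^ N) - of_int b\<bar> \<le> (1 / 2 :: real)
      \<longleftrightarrow> \<bar>2 * M * (a - b) + 2 * t + e\<bar> \<le> M" for a t e b :: int
  proof -
    have "9 ^ Suc n * ((of_int e / 2 + of_int (M * a + t)) / 9 ^ N) - of_int b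
      = (of_int (2 * M * (a - b) + 2 * t + e) / (2 * of_int M) :: real)"
      by (simp add: N_def M_def power_add field_simps)
    moreover have "0 < M" by (simp add: M_def)
    ultimately have "\<bar>9 ^ Suc n * ((of_int e / 2 + of_int (M * a + t)) / 9 ^ N) - of_int b\<bar>
      = (of_int \<bar>2 * M * (a - b) + 2 * t + e\<bar> / (2 * of_int M) :: real)" by simp
    moreover have "of_int z / (2 * of_int M) \<le> (1 / 2 :: real) \<longleftrightarrow> z \<le> M" for z :: int
      using \<open>0 < M\<close> by (simp add: divide_le_eq)
    ultimately show ?thesis by (simp only:)
  qed
  have g_vertex: "g (vertex N (shift m a t) e) = (if \<bar>2 * M * (fst a - fst ?b) + 2 * fst t + fst e\<bar> \<le> M
      \<and> \<bar>2 * M * (snd a - snd ?b) + 2 * snd t + snd e\<bar> \<le> M then 1 else 0)" for a t e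
    unfolding g_def fst_vertex snd_vertex fst_shift snd_shift M_def[symmetric] coord by simp
  have tb: "\<bar>2 * fst t\<bar> \<le> M - 1 \<and> \<bar>2 * snd t\<bar> \<le> M - 1" if "t \<in> cs m" for t
    using cs_bounds[OF that] by (simp add: M_def)
  have Vb: "\<bar>fst e\<bar> \<le> 1" "\<bar>snd e\<bar> \<le> 1" if "e \<in> ?V" for e using that by (auto simp: corners_iff)
  have inside: "g (vertex N (shift m ?b t) e) = 1" if "t \<in> cs m" "e \<in> ?V" for t e
  proof -
    have "\<bar>2 * fst t + fst e\<bar> \<le> M" using conjunct1[OF tb[OF that(1)]] Vb(1)[OF that(2)] by linarith
    moreover have "\<bar>2 * snd t + snd e\<bar> \<le> M" using conjunct2[OF tb[OF that(1)]] Vb(2)[OF that(2)] by linarith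
    ultimately show ?thesis unfolding g_vertex by simp
  qed
  have outside: "e \<in> main_ends \<and> a = ?b - e \<and> t = (fst e * (M - 1) div 2, snd e * (M - 1) div 2)"
    if "a \<in> cs (Suc n)" "a \<noteq> ?b" "t \<in> cs m" "e \<in> ?V" "g (vertex N (shift m a t) e) \<noteq> 0" for a t e
  proof -
    have a_cs: "a \<in> cs (Suc n)" by (rule that(1))
    have h: "\<bar>2 * M * (fst a - fst ?b) + 2 * fst t + fst e\<bar> \<le> M" "\<bar>2 * M * (snd a - snd ?b) + 2 * snd t + snd e\<bar> \<le> M"
      using that(5) unfolding g_vertex by (simp_all only: if_False split: if_splits)
    have 1: "fst a = fst ?b \<or> fst a = fst ?b - fst e \<and> fst e \<noteq> 0 \<and> 2 * fst t = fst e * (M - 1)"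
      using tb[OF that(3)] Vb[OF that(4)] by (intro plateau_coordinate h) auto
    have 2: "snd a = snd ?b \<or> snd a = snd ?b - snd e \<and> snd e \<noteq> 0 \<and> 2 * snd t = snd e * (M - 1)"
      using tb[OF that(3)] Vb[OF that(4)] by (intro plateau_coordinate h) auto
    have par: "even (fst a + snd a)" "even (fst ?b + snd ?b)" using cs_even that(1) b by blast+
    have eV: "e = (0, 0) \<or> \<bar>fst e\<bar> = 1 \<and> \<bar>snd e\<bar> = 1" using that(4) by (simp only: insert_iff corners_iff)
    have both: "fst a = fst ?b - fst e \<and> 2 * fst t = fst e * (M - 1) \<and> snd a = snd ?b - snd e \<and> 2 * snd t = snd e * (M - 1) \<and> e \<noteq> (0, 0)"
    proof (cases "fst a = fst ?b")
      case True
      then have "snd a \<noteq> snd ?b" using that(2) by (simp add: prod_eq_iff)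
      then have s: "snd a = snd ?b - snd e" "snd e \<noteq> 0" using 2 by blast+
      then have "odd (snd e)" using eV by auto
      then show ?thesis using par True s(1) by simp
    next
      case False
      then have f: "fst a = fst ?b - fst e" "fst e \<noteq> 0" "2 * fst t = fst e * (M - 1)" using 1 by blast+
      then have e: "odd (fst e)" "e \<noteq> (0, 0)" using eV by auto
      have "snd a \<noteq> snd ?b" using par f(1) e(1) by auto
      then show ?thesis using 2 f e by blast
    qed
    then have a: "a = ?b - e" by (simp add: prod_eq_iff)
    have ec: "e \<in> corners" using both that(4) by blast
    have "e \<notin> anti_ends"
    proof
      assume "e \<in> anti_ends"
      then have e: "e = (1, -1) \<or> e = (-1, 1)" by (simp add: anti_ends_def)
      obtain a' i where a': "a' \<in> cs n" "i \<in> D" "a = child a' i" using a_cs by (elim cs_SucE)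
      have "digit a = i" unfolding a'(3) by (rule parent_child(2)[OF a'(2)])
      moreover have "a = child c ((2, 2) - e)" unfolding a by (simp add: prod_eq_iff)
      moreover have "digit (child c ((2, 2) - e)) = (2, 2) - e"
        using e parent_child_bounds[of "(2, 2) - e" c] by auto
      ultimately have "(2, 2) - e \<in> D" using a'(2) by simp
      then show False using e D_not_anti_neighbour by auto
    qed
    then have "e \<in> main_ends" using ec by (simp add: corners_def)
    moreover have "fst t = fst e * (M - 1) div 2" "snd t = snd e * (M - 1) div 2"
      using both by (metis nonzero_mult_div_cancel_left zero_neq_numeral)+
    ultimately show ?thesis using a by (simp add: prod_eq_iff)
  qed
  have "node_anti N g 0 c' = 0" if c': "c' \<in> cs N" for c'
  proof -
    obtain a t where at: "a \<in> cs (Suc n)" "t \<in> cs m" "c' = shift m a t" using c' unfolding N_def by (elim cs_addE)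
    have "g (vertex N c' e) = g (vertex N c' (0, 0))" if e: "e \<in> anti_ends" for e
    proof (cases "a = ?b")
      case True
      have "e \<in> ?V" using e by (simp add: corners_def)
      then show ?thesis using inside[OF at(2)] unfolding at(3) True by simp
    next
      case False
      have "e \<in> ?V" "e \<notin> main_ends" "(0, 0) \<notin> main_ends"
        using e by (auto simp: corners_def main_ends_def anti_ends_def)
      then have "g (vertex N c' e) = 0" "g (vertex N c' (0, 0)) = 0"
        using outside[OF at(1) False at(2), of e] outside[OF at(1) False at(2), of "(0, 0)"] unfolding at(3) by blast+
      then show ?thesis by simp
    qed
    then show ?thesis by (simp add: node_anti_def)
  qed
  then have "total_anti N g 0 = 0" by (simp add: total_anti_def)
  then have u_decay: "oscillation_decay (1 / 9) u" unfolding u_def by (rule vertex_extension_critical)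
  define bad where "bad = (\<lambda>e. shift m (?b - e) (fst e * (M - 1) div 2, snd e * (M - 1) div 2)) ` main_ends \<inter> cs N"
  have fin_bad: "finite bad" by (simp add: bad_def)
  have card_bad: "card bad \<le> 4"
  proof -
    have "card bad \<le> card ((\<lambda>e. shift m (?b - e) (fst e * (M - 1) div 2, snd e * (M - 1) div 2)) ` main_ends)"
      unfolding bad_def by (intro card_mono) (simp_all add: main_ends_def)
    also have "\<dots> \<le> card main_ends" by (intro card_image_le) (simp add: main_ends_def)
    finally show ?thesis by (simp add: main_ends_def)
  qed
  have pt: "(?f x - u x)\<^sup>2 \<le> (\<Sum>c'\<in>bad. indicator (cell N c') x)" if x: "x \<in> K" for x
  proof -
    obtain c' where c': "c' \<in> cs (N + 0)" "x \<in> cell (N + 0) c'" using x by (elim K_cellE)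
    have "c' \<in> cs (Suc n + m)" using c'(1) by (simp only: N_def add_0_right)
    then obtain a t where at: "a \<in> cs (Suc n)" "t \<in> cs m" "c' = shift m a t" by (elim cs_addE)
    have between: "lo \<le> u x \<and> u x \<le> hi" if "\<And>e. e \<in> ?V \<Longrightarrow> lo \<le> g (vertex N c' e) \<and> g (vertex N c' e) \<le> hi" for lo hi
      unfolding u_def by (rule vertex_extension_between[OF c']) (use that in simp)
    have nn: "0 \<le> (\<Sum>c'\<in>bad. indicator (cell N c') x :: real)" by (intro sum_nonneg) simp
    have u1: "u x = 1" if xb: "x \<in> cell (Suc n) ?b"
    proof -
      obtain t' where t': "t' \<in> cs m" "x \<in> cell (Suc n + m) (shift m ?b t')" using cell_descendantE[OF xb] by blast
      have "shift m ?b t' \<in> cs (N + 0)" using shift_in_cs[OF b t'(1)] by (simp add: N_def)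
      then have "1 \<le> u x \<and> u x \<le> 1"
        unfolding u_def using t'(2) inside[OF t'(1)] by (intro vertex_extension_between[where c = "shift m ?b t'" and k = 0]) (simp_all add: N_def)
      then show ?thesis by linarith
    qed
    have sub: "cell N c' \<subseteq> cell (Suc n) a"
    proof
      fix y assume "y \<in> cell N c'"
      then obtain z where "z \<in> K" "y = place N c' z" unfolding cell_def by blast
      then show "y \<in> cell (Suc n) a"
        unfolding cell_def at(3) N_def place_shift using place_in_K[OF _ at(2)] by blast
    qed
    show ?thesis
    proof (cases "a = ?b")
      case True
      then have "x \<in> cell (Suc n) ?b" using c'(2) sub by auto
      then show ?thesis using u1 nn by simp
    next
      case False
      show ?thesis
      proof (cases "\<exists>e\<in>?V. g (vertex N c' e) \<noteq> 0")
        case True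
        then obtain e where e: "e \<in> ?V" "g (vertex N c' e) \<noteq> 0" by blast
        have "e \<in> main_ends \<and> a = ?b - e \<and> t = (fst e * (M - 1) div 2, snd e * (M - 1) div 2)"
          using e at by (intro outside[OF at(1) False at(2)]) simp_all
        then have "c' \<in> bad" using c'(1) unfolding bad_def at(3) by auto
        then have "(1::real) \<le> (\<Sum>c'\<in>bad. indicator (cell N c') x)"
          using member_le_sum[of c' bad "\<lambda>c'. indicator (cell N c') x :: real"] c'(2) fin_bad by simp
        moreover have "0 \<le> u x \<and> u x \<le> 1" using g01 by (intro between) simp
        then have "\<bar>?f x - u x\<bar> \<le> 1" by (auto simp: indicator_def)
        then have "(?f x - u x)\<^sup>2 \<le> 1" by (simp add: abs_square_le_1)
        ultimately show ?thesis by linarith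
      next
        case False
        then have "g (vertex N c' e) = 0" if "e \<in> ?V" for e using that by blast
        then have "0 \<le> u x \<and> u x \<le> 0" by (intro between) simp
        then have "u x = 0" by linarith
        moreover from this have "x \<notin> cell (Suc n) ?b" using u1 by auto
        ultimately show ?thesis using nn by simp
      qed
    qed
  qed
  have "(\<integral>x. (?f x - u x)\<^sup>2 \<partial>\<mu>) \<le> (\<integral>x. (\<Sum>c'\<in>bad. indicator (cell N c') x) \<partial>\<mu>)"
  proof (rule integral_mono)
    show "integrable \<mu> (\<lambda>x. (?f x - u x)\<^sup>2)"
      using f2 decay_L2[OF u_decay] by (intro \<mu>.L2_integrable \<mu>.L2_diff)
    show "integrable \<mu> (\<lambda>x. \<Sum>c'\<in>bad. indicator (cell N c') x :: real)"
      using cell_in_sets by (intro Bochner_Integration.integrable_sum) (auto simp: bad_def \<mu>.emeasure_eq_measure)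
  qed (use pt in simp)
  also have "\<dots> = (\<Sum>c'\<in>bad. 1 / 21 ^ N)"
  proof -
    have bs: "cell N c' \<in> sets \<mu>" "measure \<mu> (cell N c') = 1 / 21 ^ N" if "c' \<in> bad" for c'
      using that cell_in_sets measure_cell by (auto simp: bad_def)
    have "(\<integral>x. (\<Sum>c'\<in>bad. indicator (cell N c') x) \<partial>\<mu>) = (\<Sum>c'\<in>bad. \<integral>x. (indicator (cell N c') x :: real) \<partial>\<mu>)"
      using bs by (intro Bochner_Integration.integral_sum) (simp add: \<mu>.emeasure_eq_measure)
    also have "\<dots> = (\<Sum>c'\<in>bad. 1 / 21 ^ N)"
    proof (rule sum.cong[OF refl])
      fix c' assume "c' \<in> bad"
      moreover from this have "cell N c' \<inter> space \<mu> = cell N c'" using sets.sets_into_space[OF bs(1)] by blast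
      ultimately show "(\<integral>x. (indicator (cell N c') x :: real) \<partial>\<mu>) = 1 / 21 ^ N" using bs by simp
    qed
    finally show ?thesis .
  qed
  also have "\<dots> = card bad / 21 ^ N" by simp
  also have "\<dots> \<le> 4 / 21 ^ m"
  proof (intro frac_le)
    show "(21::real) ^ m \<le> 21 ^ N" by (intro power_increasing) (simp_all add: N_def)
  qed (use card_bad in simp_all)
  also have "\<dots> < \<epsilon>" by (rule m)
  finally show "\<exists>g. approximable g \<and> (\<integral>x. (?f x - g x)\<^sup>2 \<partial>\<mu>) < \<epsilon>"
    using approximable_decay[OF u_decay] by blast
qed

lemma integrable_of_L2: "f \<in> L2_space \<mu> \<Longrightarrow> integrable \<mu> f"
  by (simp add: L2_space_def \<mu>.square_integrable_imp_integrable)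

lemma AE_sum_children:
  assumes c: "c \<in> cs n"
  shows "AE x in \<mu>. (\<Sum>i\<in>D. indicator (cell (Suc n) (child c i)) x :: real) = indicator (cell n c) x"
  using AE_unique_cell
proof eventually_elim
  case (elim x)
  show ?case
  proof (cases "x \<in> cell n c")
    case False
    then have "x \<notin> cell (Suc n) (child c i)" if "i \<in> D" for i using cell_child_subset[OF that] by blast
    then show ?thesis using False by (simp add: sum.neutral)
  next
    case True
    then obtain j where j: "j \<in> D" "x \<in> cell (Suc n) (child c j)" using cell_child_Un[of n c] by blast
    have un: "i = j" if "i \<in> D" "x \<in> cell (Suc n) (child c i)" for i
    proof -
      have "child c i = child c j"
        using elim that j child_in_cs[OF c] by blast
      then show ?thesis by (rule child_inj(2)[OF _ that(1) j(1)])
    qed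
    have "(\<Sum>i\<in>D. indicator (cell (Suc n) (child c i)) x :: real) = (\<Sum>i\<in>D. if i = j then 1 else 0)"
    proof (rule sum.cong[OF refl])
      fix i assume i: "i \<in> D"
      show "(indicator (cell (Suc n) (child c i)) x :: real) = (if i = j then 1 else 0)"
      proof (cases "i = j")
        case False
        then have "x \<notin> cell (Suc n) (child c i)" using un[of i] i by blast
        then show ?thesis using False by simp
      qed (use j in simp)
    qed
    also have "\<dots> = 1" using j(1) by simp
    finally show ?thesis using True by simp
  qed
qed

text \<open>A cell contains, up to a null set, exactly the points of the disjoint union of the inner
  cells found in it at all depths. Stopping at depth \<open>k\<close> misses the fraction \<open>(20 / 21) ^ k\<close>.\<close>

lemma inner_cells_exhaust:
  "c \<in> cs n \<Longrightarrow> \<exists>h. approximable h \<and> (AE x in \<mu>. 0 \<le> h x \<and> h x \<le> indicator (cell n c) x) \<and>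
    (\<integral>x. h x \<partial>\<mu>) = (1 - (20 / 21) ^ k) / 21 ^ n"
proof (induction k arbitrary: n c)
  case 0
  have "AE x in \<mu>. 0 \<le> (0::real) \<and> 0 \<le> (indicator (cell n c) x :: real)" by simp
  then show ?case using approximable_const[of 0] by (intro exI[of _ "\<lambda>_. 0"]) simp
next
  case (Suc k)
  let ?o = "(2, 2) :: int \<times> int"
  let ?P = "\<lambda>i h. approximable h \<and> (AE x in \<mu>. 0 \<le> h x \<and> h x \<le> indicator (cell (Suc n) (child c i)) x)"
  have oD: "?o \<in> D" using D_diagonal[of 2] by simp
  let ?Q = "\<lambda>i h. ?P i h \<and> (\<integral>x. h x \<partial>\<mu>) = (if i = ?o then 1 else 1 - (20 / 21) ^ k) / 21 ^ Suc n"
  have ex: "\<exists>h. ?Q i h" if i: "i \<in> D" for i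
  proof (cases "i = ?o")
    case True
    have b: "child c ?o \<in> cs (Suc n)" by (rule child_in_cs[OF Suc.prems oD])
    have sp: "cell (Suc n) (child c ?o) \<inter> space \<mu> = cell (Suc n) (child c ?o)"
      using sets.sets_into_space[OF cell_in_sets[OF b]] by blast
    have "AE x in \<mu>. 0 \<le> (indicator (cell (Suc n) (child c ?o)) x :: real)" by simp
    then show ?thesis
      unfolding True using approximable_inner_cell[OF Suc.prems] measure_cell[OF b] sp
      by (intro exI[of _ "indicator (cell (Suc n) (child c ?o))"]) simp
  next
    case False
    then show ?thesis using Suc.IH[OF child_in_cs[OF Suc.prems i]] by simp
  qed
  then have "\<forall>i\<in>D. \<exists>h. ?Q i h" by (intro ballI)
  from bchoice[OF this] obtain h where "\<forall>i\<in>D. ?Q i (h i)" by (elim exE)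
  then have h: "\<And>i. i \<in> D \<Longrightarrow> ?P i (h i)"
    "\<And>i. i \<in> D \<Longrightarrow> (\<integral>x. h i x \<partial>\<mu>) = (if i = ?o then 1 else 1 - (20 / 21) ^ k) / 21 ^ Suc n"
    by (simp_all only:)
  have hi: "integrable \<mu> (h i)" if "i \<in> D" for i
  proof -
    have "h i \<in> L2_space \<mu>" using h(1)[OF that] by (simp add: approximable_def)
    then show ?thesis by (rule integrable_of_L2)
  qed
  have "approximable (\<lambda>x. \<Sum>i\<in>D. h i x)" using h(1) by (intro approximable_sum) simp_all
  moreover have "AE x in \<mu>. 0 \<le> (\<Sum>i\<in>D. h i x) \<and> (\<Sum>i\<in>D. h i x) \<le> indicator (cell n c) x"
  proof -
    have "AE x in \<mu>. \<forall>i\<in>D. 0 \<le> h i x \<and> h i x \<le> indicator (cell (Suc n) (child c i)) x"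
      using h(1) by (intro AE_finite_allI) simp_all
    with AE_sum_children[OF Suc.prems] show ?thesis
    proof eventually_elim
      case (elim x)
      have "(\<Sum>i\<in>D. h i x) \<le> (\<Sum>i\<in>D. indicator (cell (Suc n) (child c i)) x)" using elim by (intro sum_mono) simp
      moreover have "0 \<le> (\<Sum>i\<in>D. h i x)" using elim by (intro sum_nonneg) simp
      ultimately show ?case using elim by simp
    qed
  qed
  moreover have "(\<integral>x. (\<Sum>i\<in>D. h i x) \<partial>\<mu>) = (1 - (20 / 21) ^ Suc k) / 21 ^ n"
  proof -
    have "(\<integral>x. (\<Sum>i\<in>D. h i x) \<partial>\<mu>) = (\<Sum>i\<in>D. \<integral>x. h i x \<partial>\<mu>)"
      using hi by (rule Bochner_Integration.integral_sum)
    also have "\<dots> = (\<Sum>i\<in>D. (if i = ?o then 1 else 1 - (20 / 21) ^ k) / 21 ^ Suc n)"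
      using h(2) by (intro sum.cong refl)
    also have "\<dots> = 1 / 21 ^ Suc n + (\<Sum>i\<in>D - {?o}. (1 - (20 / 21) ^ k) / 21 ^ Suc n)"
      using oD by (subst sum.remove[of D ?o]) (auto intro!: sum.cong)
    also have "\<dots> = 1 / 21 ^ Suc n + 20 * ((1 - (20 / 21) ^ k) / 21 ^ Suc n)"
      using oD card_D by (simp add: card_Diff_singleton)
    also have "\<dots> = (1 - (20 / 21) ^ Suc k) / 21 ^ n" by (simp add: field_simps)
    finally show ?thesis .
  qed
  ultimately show ?case by blast
qed

lemma approximable_cell:
  assumes c: "c \<in> cs n" shows "approximable (\<lambda>x. indicator (cell n c) x)"
proof (rule approximable_limit)
  show f2: "(\<lambda>x. indicator (cell n c) x :: real) \<in> L2_space \<mu>" by (rule L2_indicator_borel) simp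
  fix \<epsilon> :: real assume "0 < \<epsilon>"
  then have "\<exists>k. (20 / 21) ^ k < \<epsilon>" by (intro real_arch_pow_inv) auto
  then obtain k where k: "(20 / 21) ^ k < \<epsilon>" by blast
  obtain h where h: "approximable h" "AE x in \<mu>. 0 \<le> h x \<and> h x \<le> indicator (cell n c) x"
    "(\<integral>x. h x \<partial>\<mu>) = (1 - (20 / 21) ^ k) / 21 ^ n" using inner_cells_exhaust[OF c, of k] by blast
  have h2: "h \<in> L2_space \<mu>" using h(1) by (simp add: approximable_def)
  then have hi: "integrable \<mu> h" by (rule integrable_of_L2)
  have ci: "integrable \<mu> (\<lambda>x. indicator (cell n c) x :: real)"
    using f2 by (rule integrable_of_L2)
  have sp: "cell n c \<inter> space \<mu> = cell n c" using sets.sets_into_space[OF cell_in_sets[OF c]] by blast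
  have "(\<integral>x. (indicator (cell n c) x - h x)\<^sup>2 \<partial>\<mu>) \<le> (\<integral>x. indicator (cell n c) x - h x \<partial>\<mu>)"
  proof (rule integral_mono_AE)
    show "integrable \<mu> (\<lambda>x. (indicator (cell n c) x - h x)\<^sup>2)"
      by (rule \<mu>.L2_integrable[OF \<mu>.L2_diff[OF f2 h2]])
    show "integrable \<mu> (\<lambda>x. indicator (cell n c) x - h x)" using ci hi by simp
    show "AE x in \<mu>. (indicator (cell n c) x - h x)\<^sup>2 \<le> indicator (cell n c) x - h x"
      using h(2)
    proof eventually_elim
      case (elim x)
      have "indicator (cell n c) x \<le> (1::real)" by (simp add: indicator_def)
      then have "0 \<le> indicator (cell n c) x - h x" "indicator (cell n c) x - h x \<le> 1" using elim by linarith+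
      then show ?case by (simp add: power2_eq_square mult_left_le)
    qed
  qed
  also have "\<dots> = 1 / 21 ^ n - (1 - (20 / 21) ^ k) / 21 ^ n" using ci hi h(3) measure_cell[OF c] sp by simp
  also have "\<dots> = (20 / 21) ^ k / 21 ^ n" by (simp add: diff_divide_distrib)
  also have "\<dots> \<le> (20 / 21) ^ k" by (simp add: divide_le_eq)
  also have "\<dots> < \<epsilon>" by (rule k)
  finally show "\<exists>g. approximable g \<and> (\<integral>x. (indicator (cell n c) x - g x)\<^sup>2 \<partial>\<mu>) < \<epsilon>" using h(1) by blast
qed

text \<open>The indicator of a closed set is the limit of the sums of the indicators of the cells that
  meet it.\<close>

lemma approximable_closed:
  assumes F: "closed F" shows "approximable (\<lambda>x. indicator F x)"
proof (rule approximable_sequence[where w = "\<lambda>_. 1"])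
  show "(\<lambda>x. indicator F x :: real) \<in> L2_space \<mu>" using F by (intro L2_indicator_borel) (rule borel_closed)
  define s where "s n x = (\<Sum>c\<in>meeting n F. indicator (cell n c) x :: real)" for n x
  show "approximable (s n)" for n
    unfolding s_def using approximable_cell by (intro approximable_sum) (simp_all add: meeting_def)
  have s_eq: "AE x in \<mu>. \<forall>n. s n x = (if \<exists>c\<in>cs n. x \<in> cell n c \<and> cell n c \<inter> F \<noteq> {} then 1 else 0)"
    using AE_unique_cell
  proof eventually_elim
    case (elim x)
    show ?case
    proof
      fix n
      obtain c where c: "c \<in> cs n" "x \<in> cell n c" and un: "\<And>c'. c' \<in> cs n \<Longrightarrow> x \<in> cell n c' \<Longrightarrow> c' = c" using elim by metis
      have "s n x = (\<Sum>c'\<in>meeting n F. if c' = c then 1 else 0)"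
        unfolding s_def
      proof (rule sum.cong[OF refl])
        fix c' assume "c' \<in> meeting n F"
        then have "c' \<in> cs n" by (simp add: meeting_def)
        then have "c' \<noteq> c \<Longrightarrow> x \<notin> cell n c'" using un[of c'] by blast
        then show "(indicator (cell n c') x :: real) = (if c' = c then 1 else 0)"
          using c by (cases "c' = c") simp_all
      qed
      also have "\<dots> = (if c \<in> meeting n F then 1 else 0)" by simp
      also have "\<dots> = (if \<exists>c\<in>cs n. x \<in> cell n c \<and> cell n c \<inter> F \<noteq> {} then 1 else 0)"
      proof -
        have "c \<in> meeting n F \<longleftrightarrow> (\<exists>c\<in>cs n. x \<in> cell n c \<and> cell n c \<inter> F \<noteq> {})"
        proof
          assume "c \<in> meeting n F"
          then show "\<exists>c\<in>cs n. x \<in> cell n c \<and> cell n c \<inter> F \<noteq> {}" using c unfolding meeting_def by blast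
        next
          assume "\<exists>c\<in>cs n. x \<in> cell n c \<and> cell n c \<inter> F \<noteq> {}"
          then obtain c' where c': "c' \<in> cs n" "x \<in> cell n c'" "cell n c' \<inter> F \<noteq> {}" by blast
          have "c' = c" by (rule un[OF c'(1,2)])
          then show "c \<in> meeting n F" using c c'(3) by (simp add: meeting_def)
        qed
        then show ?thesis by simp
      qed
      finally show "s n x = (if \<exists>c\<in>cs n. x \<in> cell n c \<and> cell n c \<inter> F \<noteq> {} then 1 else 0)" .
    qed
  qed
  show "AE x in \<mu>. (\<lambda>n. s n x) \<longlonglongrightarrow> indicator F x"
    using s_eq AE_space
  proof eventually_elim
    case (elim x)
    have x: "x \<in> K" using elim(2) by simp
    show ?case
    proof (cases "x \<in> F")
      case True
      have "s n x = 1" for n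
      proof -
        obtain c where "c \<in> cs n" "x \<in> cell n c" using x by (elim K_cellE)
        then have "\<exists>c\<in>cs n. x \<in> cell n c \<and> cell n c \<inter> F \<noteq> {}" using True by blast
        then show ?thesis using elim(1) by simp
      qed
      then show ?thesis using True by simp
    next
      case False
      then obtain d where d: "0 < d" "ball x d \<inter> F = {}"
        using F open_Compl[OF F] by (metis Compl_iff disjoint_eq_subset_Compl open_contains_ball)
      have "\<exists>N. (1 / 9) ^ N < d / 2" using d(1) by (intro real_arch_pow_inv) auto
      then obtain N where N: "2 / 9 ^ N < d" by (auto simp: power_divide field_simps)
      have "s n x = 0" if "N \<le> n" for n
      proof -
        have "(2::real) / 9 ^ n \<le> 2 / 9 ^ N" using that by (intro divide_left_mono power_increasing) auto
        then have n: "2 / 9 ^ n < d" using N by linarith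
        have "\<not> (\<exists>c\<in>cs n. x \<in> cell n c \<and> cell n c \<inter> F \<noteq> {})"
        proof
          assume "\<exists>c\<in>cs n. x \<in> cell n c \<and> cell n c \<inter> F \<noteq> {}"
          then obtain c y where "x \<in> cell n c" "y \<in> cell n c" "y \<in> F" by blast
          moreover from this have "y \<in> ball x d" using cell_diameter[of x n c y] n by simp
          ultimately show False using d(2) by blast
        qed
        then show ?thesis using elim(1) by simp
      qed
      then have "\<forall>\<^sub>F n in sequentially. s n x = 0" unfolding eventually_sequentially by blast
      then show ?thesis using False by (simp add: tendsto_eventually)
    qed
  qed
  show "AE x in \<mu>. (indicator F x - s n x)\<^sup>2 \<le> 1" for n
    using s_eq by eventually_elim (auto simp: indicator_def)
qed simp

text \<open>The closed sets are closed under intersection and generate the Borel sets, and the class of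
  approximable indicators is stable under complements and countable disjoint unions.\<close>

lemma approximable_borel:
  assumes "A \<in> sets borel" shows "approximable (\<lambda>x. indicator A x)"
proof -
  have "Int_stable {F :: (real \<times> real) set. closed F}" by (auto simp: Int_stable_def)
  moreover have "{F :: (real \<times> real) set. closed F} \<subseteq> Pow UNIV" by simp
  moreover have "A \<in> sigma_sets UNIV {F. closed F}" using assms unfolding borel_eq_closed by (simp add: sets_measure_of)
  ultimately show ?thesis
  proof (induction A rule: sigma_sets_induct_disjoint)
    case (basic A)
    then show ?case by (simp add: approximable_closed)
  next
    case empty
    then show ?case using approximable_const[of 0] by simp
  next
    case (compl A)
    have "indicator (UNIV - A) x = 1 + (- 1) * (indicator A x :: real)" for x by (simp add: indicator_def)
    then show ?case using approximable_lincomb[OF approximable_const[of 1] compl.IH, of "-1"] by simp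
  next
    case (union A)
    have b: "A i \<in> sets borel" for i using union.hyps(2) unfolding borel_eq_closed by (auto simp: sets_measure_of)
    show ?case
    proof (rule approximable_sequence[where w = "\<lambda>_. 1"])
      show "(\<lambda>x. indicator (\<Union>i. A i) x :: real) \<in> L2_space \<mu>" using b by (intro L2_indicator_borel) auto
      show "approximable (\<lambda>x. \<Sum>i<n. indicator (A i) x)" for n using union.IH by (intro approximable_sum) simp_all
      have u: "(\<Sum>i<n. indicator (A i) x :: real) = indicator (\<Union>i<n. A i) x" for n x
        using union.hyps(1) by (intro indicator_UN_disjoint[symmetric]) (auto simp: disjoint_family_on_def)
      show "AE x in \<mu>. (\<lambda>n. \<Sum>i<n. indicator (A i) x) \<longlonglongrightarrow> (indicator (\<Union>i. A i) x :: real)"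
        unfolding u by (intro AE_I2 LIMSEQ_indicator_UN)
      show "AE x in \<mu>. (indicator (\<Union>i. A i) x - (\<Sum>i<n. indicator (A i) x :: real))\<^sup>2 \<le> 1" for n
        unfolding u by (intro AE_I2) (auto simp: indicator_def)
    qed simp
  qed
qed

lemma approximable_L2:
  assumes f: "f \<in> L2_space \<mu>" shows "approximable f"
proof -
  have fm: "f \<in> borel_measurable \<mu>" using f by (simp add: L2_space_def)
  obtain s where s: "\<And>i. simple_function \<mu> (s i)" "\<And>x. x \<in> space \<mu> \<Longrightarrow> (\<lambda>i. s i x) \<longlonglongrightarrow> f x"
    "\<And>i x. x \<in> space \<mu> \<Longrightarrow> dist (s i x) 0 \<le> 2 * dist (f x) 0"
    using borel_measurable_implies_sequence_metric[OF fm, of 0] by blast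
  have sa: "approximable (s i)" for i
  proof -
    have fin: "finite (s i ` K)" using s(1)[of i] by (simp add: simple_function_def)
    have a: "approximable (\<lambda>x. \<Sum>y\<in>s i ` K. y * indicator (s i -` {y} \<inter> K) x)"
    proof (intro approximable_sum fin approximable_scale approximable_borel)
      fix y assume "y \<in> s i ` K"
      then have "s i -` {y} \<inter> K \<in> sets \<mu>" using s(1)[of i] unfolding simple_function_def space_\<mu> by blast
      then show "s i -` {y} \<inter> K \<in> sets borel" by (simp add: in_sets_\<mu>)
    qed
    have e: "(\<Sum>y\<in>s i ` K. y * indicator (s i -` {y} \<inter> K) x) = s i x" if "x \<in> K" for x
    proof -
      have "(\<Sum>y\<in>s i ` K. y * indicator (s i -` {y} \<inter> K) x) = (\<Sum>y\<in>s i ` K. if y = s i x then y else 0)"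
        using that by (intro sum.cong refl) (auto simp: indicator_def)
      also have "\<dots> = s i x" using that fin by simp
      finally show ?thesis .
    qed
    show ?thesis
    proof (rule approximable_sequence[where s = "\<lambda>_ x. \<Sum>y\<in>s i ` K. y * indicator (s i -` {y} \<inter> K) x" and w = "\<lambda>_. 0"])
      show "s i \<in> L2_space \<mu>"
      proof -
        have sm: "s i \<in> borel_measurable \<mu>" by (rule borel_measurable_simple_function[OF s(1)])
        have "integrable \<mu> (\<lambda>x. (s i x)\<^sup>2)"
        proof (rule Bochner_Integration.integrable_bound[where f = "\<lambda>x. 4 * (f x)\<^sup>2"])
          show "integrable \<mu> (\<lambda>x. 4 * (f x)\<^sup>2)" using f by (simp add: L2_space_def)
          show "(\<lambda>x. (s i x)\<^sup>2) \<in> borel_measurable \<mu>" using sm by measurable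
          show "AE x in \<mu>. norm ((s i x)\<^sup>2) \<le> norm (4 * (f x)\<^sup>2)"
          proof (rule AE_I2)
            fix x assume "x \<in> space \<mu>"
            then have "\<bar>s i x\<bar> \<le> 2 * \<bar>f x\<bar>" using s(3)[of x i] by simp
            then have "\<bar>s i x\<bar>\<^sup>2 \<le> (2 * \<bar>f x\<bar>)\<^sup>2" by (intro power_mono) auto
            then show "norm ((s i x)\<^sup>2) \<le> norm (4 * (f x)\<^sup>2)" by (simp add: power_mult_distrib)
          qed
        qed
        then show ?thesis using sm by (simp add: L2_space_def)
      qed
      show "AE x in \<mu>. (\<lambda>n. \<Sum>y\<in>s i ` K. y * indicator (s i -` {y} \<inter> K) x) \<longlonglongrightarrow> s i x"
        by (rule AE_I2) (simp add: e)
      show "AE x in \<mu>. (s i x - (\<Sum>y\<in>s i ` K. y * indicator (s i -` {y} \<inter> K) x))\<^sup>2 \<le> 0"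
        by (rule AE_I2) (simp add: e)
    qed (simp_all add: a)
  qed
  show ?thesis
  proof (rule approximable_sequence[OF f sa, where w = "\<lambda>x. 9 * (f x)\<^sup>2"])
    show "AE x in \<mu>. (\<lambda>n. s n x) \<longlonglongrightarrow> f x" using s(2) by (intro AE_I2)
    show "integrable \<mu> (\<lambda>x. 9 * (f x)\<^sup>2)" using f by (simp add: L2_space_def)
    show "AE x in \<mu>. (f x - s n x)\<^sup>2 \<le> 9 * (f x)\<^sup>2" for n
    proof (rule AE_I2)
      fix x assume "x \<in> space \<mu>"
      then have "\<bar>s n x\<bar> \<le> 2 * \<bar>f x\<bar>" using s(3)[of x n] by simp
      then have "\<bar>f x - s n x\<bar> \<le> 3 * \<bar>f x\<bar>" by linarith
      then have "\<bar>f x - s n x\<bar>\<^sup>2 \<le> (3 * \<bar>f x\<bar>)\<^sup>2" by (intro power_mono) auto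
      then show "(f x - s n x)\<^sup>2 \<le> 9 * (f x)\<^sup>2" by (simp add: power_mult_distrib)
    qed
  qed
qed

lemma dense_in_L2_critical: "dense_in_L2 \<mu> (besov \<mu> hdim ((1 + hdim) / 2))"
  unfolding dense_in_L2_def
proof (intro ballI allI impI)
  fix f and \<epsilon> :: real assume "f \<in> L2_space \<mu>" "0 < \<epsilon>"
  then obtain u where u: "oscillation_decay (1 / 9) u" "(\<integral>x. (f x - u x)\<^sup>2 \<partial>\<mu>) < \<epsilon>\<^sup>2"
    using approximable_L2 unfolding approximable_def by (meson zero_less_power)
  have "L2_norm \<mu> (\<lambda>x. f x - u x) < \<epsilon>"
    using real_sqrt_less_mono[OF u(2)] \<open>0 < \<epsilon>\<close> by (simp add: L2_norm_def)
  then show "\<exists>u\<in>besov \<mu> hdim ((1 + hdim) / 2). L2_norm \<mu> (\<lambda>x. f x - u x) < \<epsilon>"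
    using critical_decay_besov[OF u(1)] by blast
qed

section \<open>The critical exponents\<close>

text \<open>A function in the space takes the same value at the centre and at the corner
  \<open>p2\<close> of \<open>K\<close>, where the first coordinates differ by \<open>1 /
  2\<close>.\<close>

lemma not_dense_in_C:
  assumes "(1 + hdim) / 2 \<le> \<sigma>" shows "\<not> dense_in_C K (besov \<mu> hdim \<sigma>)"
proof
  assume dense: "dense_in_C K (besov \<mu> hdim \<sigma>)"
  have "continuous_on K (fst :: real \<times> real \<Rightarrow> real)" by (intro continuous_intros)
  then obtain u where u: "u \<in> besov \<mu> hdim \<sigma>" "continuous_on K u" "\<forall>x\<in>K. \<bar>fst x - u x\<bar> < 1 / 4"
    using dense unfolding dense_in_C_def by (metis zero_less_divide_1_iff zero_less_numeral)
  obtain C q where "finite_energy L U K u C q" using besov_finite_energy[OF u(1) assms] by blast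
  then interpret finite_energy L U K u C q .
  interpret finite_energy_representative L U K u C q u
    by unfold_locales (simp add: continuous_representative_def u(2))
  have z: "(0, 0) \<in> cs 0" by simp
  have "u (vertex 0 (0, 0) (1, -1)) = u (vertex 0 (0, 0) (0, 0))"
    by (rule anti_vertex_eq[OF z]) (simp add: anti_ends_def)
  moreover have "vertex 0 (0, 0) (1, -1) \<in> K" "vertex 0 (0, 0) (0, 0) \<in> K"
    by (rule vertex_in_K'[OF z], simp add: corners_iff)+
  then have "\<bar>fst (vertex 0 (0, 0) (1, -1)) - u (vertex 0 (0, 0) (1, -1))\<bar> < 1 / 4"
    "\<bar>fst (vertex 0 (0, 0) (0, 0)) - u (vertex 0 (0, 0) (0, 0))\<bar> < 1 / 4" using u(3) by blast+
  ultimately show False by (simp add: fst_vertex)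
qed

text \<open>Constants stay at a positive distance from the indicator of a cell of level 1, which is
  approximable.\<close>

lemma nonconstant_critical:
  "\<exists>u\<in>besov \<mu> hdim ((1 + hdim) / 2). \<not> (\<exists>k. AE x in \<mu>. u x = k)"
proof -
  let ?f = "\<lambda>x. indicator (cell 1 (0, 0)) x :: real"
  have c: "(0, 0) \<in> cs 1" using child_in_cs[of "(0, 0)" 0 "(0, 0)"] D_diagonal[of 0] by (simp add: shift_def)
  have f2: "?f \<in> L2_space \<mu>" by (rule L2_indicator_borel) simp
  obtain u where u: "oscillation_decay (1 / 9) u" "(\<integral>x. (?f x - u x)\<^sup>2 \<partial>\<mu>) < 1 / 441"
    using approximable_L2[OF f2] unfolding approximable_def by (metis zero_less_divide_1_iff zero_less_numeral)
  have "\<not> (\<exists>k. AE x in \<mu>. u x = k)"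
  proof
    assume "\<exists>k. AE x in \<mu>. u x = k"
    then obtain k where k: "AE x in \<mu>. u x = k" by blast
    have [measurable]: "u \<in> borel_measurable \<mu>" using decay_L2[OF u(1)] by (simp add: L2_space_def)
    have [measurable]: "cell 1 (0, 0) \<in> sets \<mu>" by (rule cell_in_sets[OF c])
    have sp: "cell 1 (0, 0) \<inter> space \<mu> = cell 1 (0, 0)" using sets.sets_into_space[OF cell_in_sets[OF c]] by blast
    have "(\<integral>x. (?f x - u x)\<^sup>2 \<partial>\<mu>) = (\<integral>x. (1 - 2 * k) * ?f x + k\<^sup>2 \<partial>\<mu>)"
    proof (rule integral_cong_AE)
      show "AE x in \<mu>. (?f x - u x)\<^sup>2 = (1 - 2 * k) * ?f x + k\<^sup>2"
        using k by eventually_elim (simp add: indicator_def power2_eq_square algebra_simps)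
    qed measurable
    also have "\<dots> = (1 - 2 * k) / 21 + k\<^sup>2"
    proof -
      have fi: "integrable \<mu> ?f" using f2 by (rule integrable_of_L2)
      have "(\<integral>x. (1 - 2 * k) * ?f x + k\<^sup>2 \<partial>\<mu>) = (1 - 2 * k) * (\<integral>x. ?f x \<partial>\<mu>) + (\<integral>x. k\<^sup>2 \<partial>\<mu>)"
        by (subst Bochner_Integration.integral_add) (simp_all add: fi del: One_nat_def)
      moreover have "(\<integral>x. ?f x \<partial>\<mu>) = 1 / 21" using measure_cell[OF c] sp by simp
      moreover have "(\<integral>x. k\<^sup>2 \<partial>\<mu>) = k\<^sup>2" by (simp add: measure_\<mu>_K)
      ultimately show ?thesis by (simp only: times_divide_eq_right mult_1_right)
    qed
    also have "\<dots> = (k - 1 / 21)\<^sup>2 + 20 / 441" by (simp add: power2_eq_square field_simps)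
    finally show False using u(2) zero_le_power2[of "k - 1 / 21"] by linarith
  qed
  then show ?thesis using critical_decay_besov[OF u(1)] by blast
qed

lemma constant_supercritical:
  assumes u: "u \<in> besov \<mu> hdim \<sigma>" and \<sigma>: "(1 + hdim) / 2 < \<sigma>"
  shows "\<exists>k. AE x in \<mu>. u x = k"
proof -
  obtain C q where f: "finite_energy L U K u C q" "q < 1 / 9"
    using besov_finite_energy[OF u] \<sigma> by (metis less_imp_le)
  interpret finite_energy L U K u C q by (rule f(1))
  obtain v where v: "continuous_representative K \<mu> u v" using continuous_representative_exists by blast
  interpret finite_energy_representative L U K u C q v by unfold_locales (rule v)
  have "AE x in \<mu>. u x = v (0, 0)"
    using v_AE AE_space by eventually_elim (use constant_above_critical[OF f(2)] in simp)
  then show ?thesis by blast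
qed

lemma sigma_star_eq: "sigma_star K \<mu> hdim = ereal ((1 + hdim) / 2)"
proof -
  let ?s = "(1 + hdim) / 2"
  have s: "0 < ?s" using hdim_pos by simp
  have "{\<sigma>. 0 < \<sigma> \<and> dense_in_C K (besov \<mu> hdim \<sigma>)} = {0<..<?s}"
  proof (intro set_eqI iffI)
    fix \<sigma> assume "\<sigma> \<in> {\<sigma>. 0 < \<sigma> \<and> dense_in_C K (besov \<mu> hdim \<sigma>)}"
    then have "0 < \<sigma>" "\<not> ?s \<le> \<sigma>" using not_dense_in_C by blast+
    then show "\<sigma> \<in> {0<..<?s}" unfolding greaterThanLessThan_iff by linarith
  next
    fix \<sigma> assume "\<sigma> \<in> {0<..<?s}"
    then have "0 < \<sigma>" "\<sigma> < ?s" unfolding greaterThanLessThan_iff by blast+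
    then show "\<sigma> \<in> {\<sigma>. 0 < \<sigma> \<and> dense_in_C K (besov \<mu> hdim \<sigma>)}"
      using dense_in_C_subcritical[of \<sigma>] by simp
  qed
  then have eq: "sigma_star K \<mu> hdim = Sup (ereal ` {0<..<?s})" by (simp add: sigma_star_def)
  have "Sup (ereal ` {0<..<?s}) \<le> ereal ?s" by (intro SUP_least) auto
  moreover have "ereal (?s / 2) \<le> Sup (ereal ` {0<..<?s})" using s by (intro SUP_upper) auto
  ultimately have "\<bar>Sup (ereal ` {0<..<?s})\<bar> \<noteq> \<infinity>" by auto
  from ereal_Sup[OF this] have "Sup (ereal ` {0<..<?s}) = ereal (Sup {0<..<?s})" by simp
  then show ?thesis using eq s by simp
qed

lemma sigma_sharp_eq: "sigma_sharp \<mu> hdim = ereal ((1 + hdim) / 2)"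
  unfolding sigma_sharp_def
proof (rule antisym)
  let ?T = "{\<sigma>. 0 < \<sigma> \<and> (\<exists>u\<in>besov \<mu> hdim \<sigma>. \<not> (\<exists>k. AE x in \<mu>. u x = k))}"
  show "Sup (ereal ` ?T) \<le> ereal ((1 + hdim) / 2)"
  proof (rule SUP_least)
    fix \<sigma> assume "\<sigma> \<in> ?T"
    then have "\<not> (1 + hdim) / 2 < \<sigma>" using constant_supercritical by blast
    then show "ereal \<sigma> \<le> ereal ((1 + hdim) / 2)" by simp
  qed
  have "(1 + hdim) / 2 \<in> ?T" using nonconstant_critical hdim_pos by simp
  then show "ereal ((1 + hdim) / 2) \<le> Sup (ereal ` ?T)" by (rule SUP_upper)
qed

lemma critical_constant_on_segments:
  assumes u: "u \<in> besov \<mu> hdim ((1 + hdim) / 2)"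
  shows "(\<exists>v. continuous_representative K \<mu> u v) \<and>
    (\<forall>v. continuous_representative K \<mu> u v \<longrightarrow>
      (\<forall>a b. closed_segment a b \<subseteq> K \<and> (\<exists>t. b - a = t *\<^sub>R (p4 - p2)) \<longrightarrow> v constant_on closed_segment a b))"
proof -
  obtain C q where f: "finite_energy L U K u C q" using besov_finite_energy[OF u order_refl] by blast
  interpret finite_energy L U K u C q by (rule f)
  have "v constant_on closed_segment a b"
    if v: "continuous_representative K \<mu> u v" and ab: "closed_segment a b \<subseteq> K" "b - a = t *\<^sub>R (p4 - p2)" for v a b t
  proof -
    interpret finite_energy_representative L U K u C q v by unfold_locales (rule v)
    show ?thesis by (rule constant_on_anti_segment[OF ab])
  qed
  then show ?thesis using continuous_representative_exists by blast
qed

end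

theorem theorem5p4:
  fixes L U :: "(int \<times> int) set" and K :: "(real \<times> real) set"
    and \<alpha> \<sigma> :: real and \<mu> :: "(real \<times> real) measure"
  assumes "L \<in> lower_right_eyebolts" and "U \<in> upper_left_eyebolts"
    and "is_eyebolted_vicsek_cross L U K"
  defines "\<alpha> \<equiv> ln 21 / ln 9"
    and "\<mu> \<equiv> normalized_hausdorff \<alpha> K"
    and "\<sigma> \<equiv> 1 / 2 * (1 + ln 21 / ln 9)"
  shows "sigma_star K \<mu> \<alpha> = ereal \<sigma> \<and> sigma_sharp \<mu> \<alpha> = ereal \<sigma> \<and>
    dense_in_L2 \<mu> (besov \<mu> \<alpha> \<sigma>) \<and>
    (\<forall>u \<in> besov \<mu> \<alpha> \<sigma>.
       (\<exists>v. continuous_representative K \<mu> u v) \<and>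
       (\<forall>v. continuous_representative K \<mu> u v \<longrightarrow>
          (\<forall>a b. closed_segment a b \<subseteq> K \<and> (\<exists>t. b - a = t *\<^sub>R (p4 - p2)) \<longrightarrow>
             v constant_on closed_segment a b))) \<and>
    \<not> dense_in_C K (besov \<mu> \<alpha> \<sigma>)"
proof -
  interpret X: eyebolted_cross L U K using assms(1-3) by unfold_locales
  have \<alpha>: "\<alpha> = hdim" by (simp add: \<alpha>_def hdim_def)
  have \<mu>: "\<mu> = X.\<mu>" by (simp add: \<mu>_def \<alpha> X.\<mu>_def)
  have \<sigma>: "\<sigma> = (1 + hdim) / 2" by (simp add: \<sigma>_def hdim_def)
  show ?thesis
    unfolding \<mu> \<sigma> unfolding \<alpha>
    using X.sigma_star_eq X.sigma_sharp_eq X.dense_in_L2_critical X.critical_constant_on_segments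
      X.not_dense_in_C[OF order_refl] by blast
qed

end
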